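(* Let $(A,\Delta,\epsilon,\Phi)$ be a quasi-Hopf superalgebra over a field $K$ with antipode $S$ and canonical elements $\alpha,\beta\in A$, and let $F\in A\otimes A$ be an invertible homogeneous element satisfying $(\epsilon\otimes 1)F=1=(1\otimes\epsilon)F$. Define $$\Delta_F(a)=F\Delta(a)F^{-1}\quad(a\in A),$$ $$\Phi_F=(F\otimes 1)\cdot(\Delta\otimes 1)F\cdot\Phi\cdot(1\otimes\Delta)F^{-1}\cdot(1\otimes F^{-1}),$$ $$S_F=S,\qquad \alpha_F=m\cdot(1\otimes\alpha)(S\otimes 1)F^{-1},\qquad \beta_F=m\cdot(1\otimes\beta)(1\otimes S)F.$$ Then $(A,\Delta_F,\epsilon,\Phi_F)$, together with the antipode $S_F$ and the canonical elements $\alpha_F,\beta_F$, is also a quasi-Hopf superalgebra.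
   Context: All algebras are unital, associative and $\mathbf{Z}_2$-graded; $[a]\in\mathbf{Z}_2$ denotes the degree of a homogeneous element $a$. Tensor products carry the graded multiplication $(a\otimes b)(a'\otimes b')=(-1)^{[b][a']}aa'\otimes bb'$ for homogeneous elements (similarly for more factors). Homomorphisms and anti-homomorphisms of graded algebras preserve degree, the field $K$ being in degree $0$ (so $\epsilon$ vanishes on odd elements). In formulas such as $(\Delta\otimes 1)$, "$1$" denotes the identity map when it acts as a map, and the unit of $A$ when it is an element; $A\otimes K$ and $K\otimes A$ are identified with $A$. A $\mathbf{Z}_2$-graded quasi-bialgebra $(A,\Delta,\epsilon,\Phi)$ is a $\mathbf{Z}_2$-graded unital associative algebra $A$ over $K$ with algebra homomorphisms $\epsilon:A\to K$ and $\Delta:A\to A\otimes A$ and an invertible homogeneous element $\Phi\in A\otimes A\otimes A$ such that - $(1\otimes\Delta)\Delta(a)=\Phi^{-1}\,(\Delta\otimes 1)\Delta(a)\,\Phi$ for all $a\in A$; - $(\Delta\otimes 1\otimes 1)\Phi\cdot(1\otimes 1\otimes\Delta)\Phi=(\Phi\otimes 1)\cdot(1\otimes\Delta\otimes 1)\Phi\cdot(1\otimes\Phi)$; - $(\epsilon\otimes 1)\Delta=1=(1\otimes\epsilon)\Delta$ (identity map of $A$); - $(1\otimes\epsilon\otimes 1)\Phi=1$. A quasi-Hopf superalgebra is a $\mathbf{Z}_2$-graded quasi-bialgebra equipped with a graded algebra anti-homomorphism $S:A\to A$ (antipode), i.e. $S(ab)=(-1)^{[a][b]}S(b)S(a)$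 for homogeneous $a,b$, and even canonical elements $\alpha,\beta\in A$ such that, with $m:A\otimes A\to A$ the product map, - $m\cdot(1\otimes\alpha)(S\otimes 1)\Delta(a)=\epsilon(a)\alpha$ for all $a$, i.e. $\sum S(a_{(1)})\alpha a_{(2)}=\epsilon(a)\alpha$ where $\Delta(a)=\sum a_{(1)}\otimes a_{(2)}$; - $m\cdot(1\otimes\beta)(1\otimes S)\Delta(a)=\epsilon(a)\beta$ for all $a$, i.e. $\sum a_{(1)}\beta S(a_{(2)})=\epsilon(a)\beta$; - $m\cdot(m\otimes1)\cdot(1\otimes\beta\otimes\alpha)(1\otimes S\otimes1)\Phi^{-1}=1$, i.e. $\sum\bar X_\nu\beta S(\bar Y_\nu)\alpha\bar Z_\nu=1$ where $\Phi^{-1}=\sum\bar X_\nu\otimes\bar Y_\nu\otimes\bar Z_\nu$; - $m\cdot(m\otimes1)\cdot(S\otimes1\otimes1)(1\otimes\alpha\otimes\beta)(1\otimes1\otimes S)\Phi=1$, i.e. $\sum S(X_\nu)\alpha Y_\nu\beta S(Z_\nu)=1$ where $\Phi=\sum X_\nu\otimes Y_\nu\otimes Z_\nu$. Explicitly, if $F=\sum_i f_i\otimes f^i$ and $F^{-1}=\sum_i\bar f_i\otimes\bar f^i$, then $\alpha_F=\sum_iS(\bar f_i)\alpha\bar f^i$ and $\beta_F=\sum_i f_i\beta S(f^i)$. *)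

theory Defs
  imports Complex_Main "HOL-Library.Function_Algebras" "HOL-Library.Z2"
begin

section \<open>Tensor powers of a vector space\<close>

text \<open>
  Tensor powers are realised uniformly: an element of \<open>A\<^sup>\<otimes>\<^sup>n\<close> is a functional on functions
  \<open>'a list \<Rightarrow> 'k\<close>, and the pure tensor \<open>x\<^sub>1 \<otimes> \<dots> \<otimes> x\<^sub>n\<close> is evaluation of \<open>n\<close>-linear forms at
  \<open>[x\<^sub>1, \<dots>, x\<^sub>n]\<close> (and is 0 on functions that are not \<open>n\<close>-linear). \<open>A\<^sup>\<otimes>\<^sup>n\<close> is the span of the
  pure tensors of length \<open>n\<close>. Over a field this is the usual tensor power; its universal
  property is lemma \<open>tensor_universal\<close> below, with uniqueness in \<open>tensor_unique\<close>.

  Since pure tensors are indexed by lists, \<open>\<otimes>\<close> is concatenation, so associators and the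
  identifications of \<open>K \<otimes> A\<close> and \<open>A \<otimes> K\<close> with \<open>A\<close> are identities; \<open>K\<close> is \<open>A\<^sup>\<otimes>\<^sup>0\<close> and
  \<open>A\<close> is identified with \<open>A\<^sup>\<otimes>\<^sup>1\<close> by \<open>x \<mapsto> pure [x]\<close>.
\<close>

type_synonym ('a, 'k) tensor = "('a list \<Rightarrow> 'k) \<Rightarrow> 'k"

definition tscale :: "'k::field \<Rightarrow> ('a, 'k) tensor \<Rightarrow> ('a, 'k) tensor" where
  "tscale c t = (\<lambda>\<phi>. c * t \<phi>)"

interpretation tensor: vector_space "tscale :: 'k::field \<Rightarrow> ('a, 'k) tensor \<Rightarrow> ('a, 'k) tensor"
  by unfold_locales (auto simp: tscale_def algebra_simps fun_eq_iff)

text \<open>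
  The linear extension of a map \<open>g\<close> given on pure tensors. For \<open>t \<in> A\<^sup>\<otimes>\<^sup>n\<close> it has the intended
  meaning whenever \<open>g\<close> is \<open>n\<close>-linear on lists of length \<open>n\<close> with values in some \<open>A\<^sup>\<otimes>\<^sup>m\<close>;
  see \<open>lift_pure\<close>.
\<close>

definition lift :: "('a list \<Rightarrow> ('b, 'k) tensor) \<Rightarrow> ('a, 'k) tensor \<Rightarrow> ('b, 'k) tensor" where
  "lift g t = (\<lambda>\<phi>. t (\<lambda>xs. g xs \<phi>))"

lemma linear_lift: "Vector_Spaces.linear tscale tscale (lift g)"
  by (simp add: Vector_Spaces.linear_iff tensor.vector_space_axioms lift_def tscale_def fun_eq_iff)

locale tensor_powers = vector_space scale
  for scale :: "'k::field \<Rightarrow> 'a::ab_group_add \<Rightarrow> 'a"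
begin

definition multilinear :: "('k \<Rightarrow> 'v::ab_group_add \<Rightarrow> 'v) \<Rightarrow> nat \<Rightarrow> ('a list \<Rightarrow> 'v) \<Rightarrow> bool" where
  "multilinear scale' n g \<longleftrightarrow>
     (\<forall>xs i. length xs = n \<and> i < n \<longrightarrow> Vector_Spaces.linear scale scale' (\<lambda>x. g (xs[i := x])))"

definition pure :: "'a list \<Rightarrow> ('a, 'k) tensor" where
  "pure xs = (\<lambda>\<phi>. if multilinear (*) (length xs) \<phi> then \<phi> xs else 0)"

definition tpower :: "nat \<Rightarrow> ('a, 'k) tensor set" where
  "tpower n = tensor.span {pure xs | xs. length xs = n}"

definition emb :: "'a \<Rightarrow> ('a, 'k) tensor" where
  "emb x = pure [x]"

definition unemb :: "('a, 'k) tensor \<Rightarrow> 'a" where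
  "unemb = inv emb"

definition tensor_prod :: "('a, 'k) tensor \<Rightarrow> ('a, 'k) tensor \<Rightarrow> ('a, 'k) tensor"
    (infixr \<open>\<otimes>\<close> 75) where
  "s \<otimes> t = lift (\<lambda>xs. lift (\<lambda>ys. pure (xs @ ys)) t) s"

text \<open>
  \<open>tmap [f\<^sub>1, \<dots>, f\<^sub>n]\<close> is \<open>f\<^sub>1 \<otimes> \<dots> \<otimes> f\<^sub>n\<close> for linear maps \<open>f\<^sub>i\<close> from \<open>A\<close> to tensor powers of \<open>A\<close>.
  It is only applied to degree-preserving maps, so no sign occurs.
\<close>

definition tmap :: "('a \<Rightarrow> ('a, 'k) tensor) list \<Rightarrow> ('a, 'k) tensor \<Rightarrow> ('a, 'k) tensor" where
  "tmap fs = lift (\<lambda>xs. foldr (\<otimes>) (map2 (\<lambda>f x. f x) fs xs) (pure []))"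

definition of_form :: "('a \<Rightarrow> 'k) \<Rightarrow> 'a \<Rightarrow> ('a, 'k) tensor" where
  "of_form f x = tscale (f x) (pure [])"

lemma multilinear_cong:
  assumes "multilinear scale' n g" and "\<And>xs. length xs = n \<Longrightarrow> f xs = g xs"
  shows "multilinear scale' n f"
  using assms by (simp add: multilinear_def)

lemma multilinear_compose:
  assumes "multilinear scale' n g" and "Vector_Spaces.linear scale' scale'' h"
  shows "multilinear scale'' n (\<lambda>xs. h (g xs))"
  using assms unfolding multilinear_def
  by (auto simp: Vector_Spaces.linear_iff)

lemma vector_space_self: "vector_space ((*) :: 'k \<Rightarrow> 'k \<Rightarrow> 'k)"
  by unfold_locales (simp_all add: algebra_simps)

lemma linear_eval: "Vector_Spaces.linear tscale (*) (\<lambda>t :: ('c, 'k) tensor. t \<phi>)"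
  by (simp add: Vector_Spaces.linear_iff tensor.vector_space_axioms vector_space_self tscale_def)

lemma multilinear_pure: "multilinear tscale n pure"
  unfolding multilinear_def
proof (intro allI impI)
  fix xs :: "'a list" and i :: nat
  assume A: "length xs = n \<and> i < n"
  show "Vector_Spaces.linear scale tscale (\<lambda>x. pure (xs[i := x]))"
    unfolding Vector_Spaces.linear_iff
  proof (intro conjI allI)
    show "vector_space scale" "vector_space (tscale :: 'k \<Rightarrow> ('a, 'k) tensor \<Rightarrow> _)"
      by unfold_locales
    have lin: "Vector_Spaces.linear scale (*) (\<lambda>x. \<phi> (xs[i := x]))" if "multilinear (*) n \<phi>"
      for \<phi> :: "'a list \<Rightarrow> 'k"
      using that A by (auto simp: multilinear_def)
    show "pure (xs[i := x + y]) = pure (xs[i := x]) + pure (xs[i := y])" for x y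
      using lin A by (auto simp: pure_def fun_eq_iff Vector_Spaces.linear_iff)
    show "pure (xs[i := scale c x]) = tscale c (pure (xs[i := x]))" for c x
      using lin A by (auto simp: pure_def fun_eq_iff tscale_def Vector_Spaces.linear_iff)
  qed
qed

lemma lift_pure:
  assumes "multilinear tscale n g" "length xs = n"
  shows "lift g (pure xs) = g xs"
proof
  fix \<phi>
  have "multilinear (*) n (\<lambda>xs. g xs \<phi>)"
    using multilinear_compose[OF assms(1) linear_eval] .
  then show "lift g (pure xs) \<phi> = g xs \<phi>"
    using assms(2) by (simp add: lift_def pure_def)
qed

lemma tensor_unique:
  assumes h: "Vector_Spaces.linear tscale scale' h" "Vector_Spaces.linear tscale scale' h'"
    and eq: "\<And>xs. length xs = n \<Longrightarrow> h (pure xs) = h' (pure xs)" and t: "t \<in> tpower n"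
  shows "h t = h' t"
proof -
  interpret h: Vector_Spaces.linear tscale scale' h by fact
  interpret P: vector_space_pair "tscale :: 'k \<Rightarrow> ('a, 'k) tensor \<Rightarrow> _" scale' ..
  show ?thesis
    by (rule P.linear_eq_on[OF h, of t "{pure xs | xs. length xs = n}"])
       (use t eq in \<open>auto simp: tpower_def\<close>)
qed

lemma tensor_universal:
  assumes V: "vector_space scale'" and g: "multilinear scale' n g"
  shows "\<exists>h. Vector_Spaces.linear tscale scale' h \<and> (\<forall>xs. length xs = n \<longrightarrow> h (pure xs) = g xs)"
proof -
  interpret V: vector_space scale' by fact
  interpret P: vector_space_pair "tscale :: 'k \<Rightarrow> ('a, 'k) tensor \<Rightarrow> _" scale' ..
  interpret Q: vector_space_pair scale' "(*) :: 'k \<Rightarrow> 'k \<Rightarrow> 'k"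
    by (rule vector_space_pair.intro[OF V vector_space_self])
  have separate: "v = 0" if "\<And>f. Vector_Spaces.linear scale' (*) f \<Longrightarrow> f v = 0" for v
  proof (rule ccontr)
    assume "v \<noteq> 0"
    then have "V.independent {v}" by simp
    from Q.linear_independent_extend[OF this, of "\<lambda>_. 1"]
    obtain f where f: "Vector_Spaces.linear scale' (*) f" "f v = 1" by auto
    from that[OF f(1)] f(2) show False by simp
  qed
  obtain B where B: "B \<subseteq> {pure xs | xs. length xs = n}" "tensor.independent B"
      "{pure xs | xs. length xs = n} \<subseteq> tensor.span B"
    using tensor.maximal_independent_subset by blast
  define rep where "rep b = (SOME xs. length xs = n \<and> b = pure xs)" for b
  have rep: "length (rep b) = n \<and> b = pure (rep b)" if "b \<in> B" for b
  proof -
    have "\<exists>xs. length xs = n \<and> b = pure xs" using B(1) that by blast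
    then show ?thesis unfolding rep_def by (rule someI_ex)
  qed
  obtain h where h: "Vector_Spaces.linear tscale scale' h" "\<forall>b\<in>B. h b = g (rep b)"
    using P.linear_independent_extend[OF B(2), of "\<lambda>b. g (rep b)"] by blast
  interpret h: Vector_Spaces.linear tscale scale' h by fact
  have "h (pure xs) = g xs" if xs: "length xs = n" for xs
  proof -
    obtain r T where T: "finite T" "T \<subseteq> B" "pure xs = (\<Sum>b\<in>T. tscale (r b) b)"
      using B(3) xs unfolding tensor.span_explicit by blast
    have "f (h (pure xs) - g xs) = 0" if f: "Vector_Spaces.linear scale' (*) f" for f
    proof -
      interpret f: Vector_Spaces.linear scale' "(*)" f by fact
      let ?\<phi> = "\<lambda>xs. f (g xs)"
      have m: "multilinear (*) n ?\<phi>" by (rule multilinear_compose[OF g f])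
      have ev: "pure ys ?\<phi> = ?\<phi> ys" if "length ys = n" for ys
        using m that by (simp add: pure_def)
      interpret e: Vector_Spaces.linear tscale "(*)" "\<lambda>t :: ('a, 'k) tensor. t ?\<phi>"
        by (rule linear_eval)
      have "f (g xs) = (\<Sum>b\<in>T. tscale (r b) b) ?\<phi>" using ev[OF xs] T(3) by simp
      also have "\<dots> = (\<Sum>b\<in>T. r b * b ?\<phi>)" by (simp add: e.sum e.scale)
      also have "\<dots> = (\<Sum>b\<in>T. r b * f (g (rep b)))"
      proof (rule sum.cong[OF refl])
        fix b assume "b \<in> T"
        then have "length (rep b) = n" "b = pure (rep b)" using rep T(2) by auto
        then show "r b * b ?\<phi> = r b * f (g (rep b))" using ev by metis
      qed
      also have "\<dots> = f (h (pure xs))"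
        unfolding T(3) using h(2) T(2) by (auto simp: h.sum h.scale f.sum f.scale intro!: sum.cong)
      finally show ?thesis by (simp add: f.diff)
    qed
    then have "h (pure xs) - g xs = 0" by (rule separate)
    then show ?thesis by simp
  qed
  with h(1) show ?thesis by blast
qed

lemma unemb_emb [simp]: "unemb (emb x) = x"
proof -
  have "multilinear scale 1 hd"
    unfolding multilinear_def
  proof (intro allI impI)
    fix xs :: "'a list" and i :: nat
    assume "length xs = 1 \<and> i < 1"
    then have "(\<lambda>x. hd (xs[i := x])) = (\<lambda>x. x)" by (cases xs) auto
    then show "Vector_Spaces.linear scale scale (\<lambda>x. hd (xs[i := x]))"
      by (simp add: Vector_Spaces.linear_iff vector_space_axioms)
  qed
  from tensor_universal[OF vector_space_axioms this]
  obtain h where "\<forall>xs. length xs = 1 \<longrightarrow> h (pure xs) = hd xs" by blast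
  then have "h (emb y) = y" for y by (simp add: emb_def)
  then have "inj emb" by (metis injI)
  then show ?thesis by (simp add: unemb_def)
qed

end

section \<open>Superalgebras and their tensor powers\<close>

locale superalgebra = tensor_powers scale
  for scale :: "'k::field \<Rightarrow> 'a::ring_1 \<Rightarrow> 'a" (infixr \<open>*s\<close> 75) +
  fixes grade :: "bit \<Rightarrow> 'a set"
  assumes scale_mult_left: "(c *s x) * y = c *s (x * y)"
    and scale_mult_right: "x * (c *s y) = c *s (x * y)"
    and grade_subspace: "subspace (grade d)"
    and grade_disjoint: "grade 0 \<inter> grade 1 = {0}"
    and grade_sum: "\<exists>y\<in>grade 0. \<exists>z\<in>grade 1. x = y + z"
    and grade_one: "1 \<in> grade 0"
    and grade_mult: "x \<in> grade d \<Longrightarrow> y \<in> grade e \<Longrightarrow> x * y \<in> grade (d + e)"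
begin

definition part :: "bit \<Rightarrow> 'a \<Rightarrow> 'a" where
  "part d x = (THE y. y \<in> grade d \<and> x - y \<in> grade (d + 1))"

definition ksign :: "bit \<Rightarrow> 'k" where
  "ksign d = (if d = 0 then 1 else - 1)"

text \<open>
  Moving \<open>y\<^sub>j\<close> of degree \<open>e\<^sub>j\<close> to the left past all \<open>x\<^sub>i\<close> of degree \<open>d\<^sub>i\<close> with \<open>i > j\<close> gives the
  sign of \<open>(x\<^sub>1 \<otimes> \<dots> \<otimes> x\<^sub>n) \<cdot> (y\<^sub>1 \<otimes> \<dots> \<otimes> y\<^sub>n)\<close>. The product is defined by decomposing all
  factors into homogeneous components; see \<open>tmult_homogeneous\<close>.
\<close>

definition cross_degree :: "bit list \<Rightarrow> bit list \<Rightarrow> bit" where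
  "cross_degree ds es = (\<Sum>i<length ds. \<Sum>j<i. ds ! i * es ! j)"

definition pure_mult :: "'a list \<Rightarrow> 'a list \<Rightarrow> ('a, 'k) tensor" where
  "pure_mult xs ys =
     (\<Sum>ds | length ds = length xs. \<Sum>es | length es = length ys.
        tscale (ksign (cross_degree ds es))
          (pure (map2 (*) (map2 part ds xs) (map2 part es ys))))"

definition tmult :: "('a, 'k) tensor \<Rightarrow> ('a, 'k) tensor \<Rightarrow> ('a, 'k) tensor"
    (infixl \<open>\<cdot>\<close> 70) where
  "s \<cdot> t = lift (\<lambda>xs. lift (\<lambda>ys. pure_mult xs ys) t) s"

lemma part_unique:
  assumes "y \<in> grade d" "z \<in> grade (d + 1)"
  shows "part d (y + z) = y"
  unfolding part_def
proof (rule the_equality)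
  show "y \<in> grade d \<and> y + z - y \<in> grade (d + 1)" using assms by simp
next
  fix y' assume y': "y' \<in> grade d \<and> y + z - y' \<in> grade (d + 1)"
  have "y' - y \<in> grade d" using y' assms grade_subspace subspace_diff by blast
  moreover have "z - (y + z - y') \<in> grade (d + 1)"
    using y' assms grade_subspace subspace_diff by blast
  then have "y' - y \<in> grade (d + 1)" by (simp add: algebra_simps)
  ultimately have "y' - y \<in> grade 0 \<inter> grade 1" by (cases d) auto
  then show "y' = y" using grade_disjoint by simp
qed

lemma part_decompose:
  obtains y z where "y \<in> grade d" "z \<in> grade (d + 1)" "x = y + z"
  using grade_sum[of x] by (cases d) (auto simp: add.commute)

lemma part_linear: "Vector_Spaces.linear scale scale (part d)"
  unfolding Vector_Spaces.linear_iff
proof (intro conjI allI)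
  show "vector_space scale" "vector_space scale" by unfold_locales
  show "part d (x + y) = part d x + part d y" for x y
  proof -
    obtain x1 x2 where x: "x1 \<in> grade d" "x2 \<in> grade (d + 1)" "x = x1 + x2"
      using part_decompose .
    obtain y1 y2 where y: "y1 \<in> grade d" "y2 \<in> grade (d + 1)" "y = y1 + y2"
      using part_decompose .
    have "x1 + y1 \<in> grade d" "x2 + y2 \<in> grade (d + 1)"
      using x y grade_subspace subspace_add by blast+
    from part_unique[OF this] show ?thesis
      using x y part_unique by (simp add: algebra_simps)
  qed
  show "part d (c *s x) = c *s part d x" for c x
  proof -
    obtain x1 x2 where x: "x1 \<in> grade d" "x2 \<in> grade (d + 1)" "x = x1 + x2"
      using part_decompose .
    have "c *s x1 \<in> grade d" "c *s x2 \<in> grade (d + 1)"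
      using x grade_subspace subspace_scale by blast+
    from part_unique[OF this] show ?thesis
      using x part_unique by (simp add: scale_right_distrib)
  qed
qed

lemma part_homogeneous:
  assumes "x \<in> grade e" shows "part d x = (if d = e then x else 0)"
proof (cases "d = e")
  case True
  then show ?thesis using part_unique[of x d 0] assms grade_subspace subspace_0 by simp
next
  case False
  then have "e = d + 1" by (cases d; cases e) auto
  then show ?thesis using part_unique[of 0 d x] assms grade_subspace subspace_0 False by simp
qed

lemma multilinear_slot:
  assumes slot: "\<And>xs i. length xs = n \<Longrightarrow> i < n \<Longrightarrow>
      \<exists>l. Vector_Spaces.linear scale scale l \<and> (\<forall>x. f (xs[i := x]) = (f xs)[i := l x])"
    and len: "\<And>xs. length xs = n \<Longrightarrow> length (f xs) = n"
  shows "multilinear tscale n (\<lambda>xs. pure (f xs))"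
  unfolding multilinear_def
proof (intro allI impI)
  fix xs :: "'a list" and i :: nat
  assume A: "length xs = n \<and> i < n"
  obtain l where l: "Vector_Spaces.linear scale scale l" "\<And>x. f (xs[i := x]) = (f xs)[i := l x]"
    using slot A by blast
  have "Vector_Spaces.linear scale tscale (\<lambda>x. pure ((f xs)[i := x]))"
    using multilinear_pure[of n] A len unfolding multilinear_def by blast
  then show "Vector_Spaces.linear scale tscale (\<lambda>x. pure (f (xs[i := x])))"
    using l by (auto simp: Vector_Spaces.linear_iff)
qed

lemma multilinear_sum:
  assumes "\<And>j. j \<in> J \<Longrightarrow> multilinear tscale n (g j)"
  shows "multilinear tscale n (\<lambda>xs. \<Sum>j\<in>J. g j xs :: ('c, 'k) tensor)"
  using assms unfolding multilinear_def
  by (auto simp: Vector_Spaces.linear_iff sum.distrib tensor.scale_sum_right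
      vector_space_axioms tensor.vector_space_axioms)

lemma multilinear_tscale:
  assumes "multilinear tscale n g"
  shows "multilinear tscale n (\<lambda>xs. tscale c (g xs :: ('c, 'k) tensor))"
  using assms unfolding multilinear_def
  by (auto simp: Vector_Spaces.linear_iff tensor.scale_right_distrib tensor.scale_left_commute)

lemma mult_left_linear: "Vector_Spaces.linear scale scale (\<lambda>x. part d x * y)"
  and mult_right_linear: "Vector_Spaces.linear scale scale (\<lambda>x. y * part d x)"
  using part_linear[of d]
  by (auto simp: Vector_Spaces.linear_iff distrib_right distrib_left scale_mult_left scale_mult_right)

lemma multilinear_pure_mult_left:
  assumes ys: "length ys = n"
  shows "multilinear tscale n (\<lambda>xs. pure_mult xs ys)"
proof (rule multilinear_cong)
  let ?D = "{ds :: bit list. length ds = n}"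
  show "multilinear tscale n (\<lambda>xs. \<Sum>ds\<in>?D. \<Sum>es\<in>?D.
        tscale (ksign (cross_degree ds es))
          (pure (map2 (*) (map2 part ds xs) (map2 part es ys))))"
  proof (intro multilinear_sum multilinear_tscale multilinear_slot)
    fix ds es :: "bit list" and xs :: "'a list" and i :: nat
    assume *: "ds \<in> ?D" "es \<in> ?D" "length xs = n" "i < n"
    have "map2 (*) (map2 part ds (xs[i := x])) (map2 part es ys) =
        (map2 (*) (map2 part ds xs) (map2 part es ys))[i := part (ds ! i) x * part (es ! i) (ys ! i)]" for x
      using * ys by (auto intro!: nth_equalityI simp: nth_list_update)
    then show "\<exists>l. Vector_Spaces.linear scale scale l \<and>
        (\<forall>x. map2 (*) (map2 part ds (xs[i := x])) (map2 part es ys) =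
          (map2 (*) (map2 part ds xs) (map2 part es ys))[i := l x])"
      using mult_left_linear by blast
  qed (use ys in auto)
qed (use ys in \<open>simp add: pure_mult_def\<close>)

lemma multilinear_pure_mult_right:
  assumes xs: "length xs = n"
  shows "multilinear tscale n (pure_mult xs)"
proof (rule multilinear_cong)
  let ?D = "{ds :: bit list. length ds = n}"
  show "multilinear tscale n (\<lambda>ys. \<Sum>ds\<in>?D. \<Sum>es\<in>?D.
        tscale (ksign (cross_degree ds es))
          (pure (map2 (*) (map2 part ds xs) (map2 part es ys))))"
  proof (intro multilinear_sum multilinear_tscale multilinear_slot)
    fix ds es :: "bit list" and ys :: "'a list" and i :: nat
    assume *: "ds \<in> ?D" "es \<in> ?D" "length ys = n" "i < n"
    have "map2 (*) (map2 part ds xs) (map2 part es (ys[i := y])) =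
        (map2 (*) (map2 part ds xs) (map2 part es ys))[i := part (ds ! i) (xs ! i) * part (es ! i) y]" for y
      using * xs by (auto intro!: nth_equalityI simp: nth_list_update)
    then show "\<exists>l. Vector_Spaces.linear scale scale l \<and>
        (\<forall>y. map2 (*) (map2 part ds xs) (map2 part es (ys[i := y])) =
          (map2 (*) (map2 part ds xs) (map2 part es ys))[i := l y])"
      using mult_right_linear by blast
  qed (use xs in auto)
qed (use xs in \<open>simp add: pure_mult_def\<close>)

lemma tmult_pure:
  assumes "length xs = n" "length ys = n"
  shows "pure xs \<cdot> pure ys = pure_mult xs ys"
proof -
  have "pure xs \<cdot> pure ys = lift (\<lambda>xs. lift (pure_mult xs) (pure ys)) (pure xs)"
    by (simp add: tmult_def)
  also have "\<dots> = lift (pure_mult xs) (pure ys)"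
  proof (rule lift_pure[OF multilinear_cong])
    show "multilinear tscale n (\<lambda>xs. pure_mult xs ys)"
      using assms by (simp add: multilinear_pure_mult_left)
    show "lift (pure_mult zs) (pure ys) = pure_mult zs ys" if "length zs = n" for zs
      using that assms by (intro lift_pure multilinear_pure_mult_right) auto
  qed fact
  also have "\<dots> = pure_mult xs ys"
    using assms by (intro lift_pure multilinear_pure_mult_right) auto
  finally show ?thesis .
qed

lemma pure_zero:
  assumes "0 \<in> set xs" shows "pure xs = 0"
proof -
  obtain i where i: "i < length xs" "xs ! i = 0" using assms by (metis in_set_conv_nth)
  have "Vector_Spaces.linear scale tscale (\<lambda>x. pure (xs[i := x]))"
    using multilinear_pure[of "length xs"] i unfolding multilinear_def by blast
  then interpret l: Vector_Spaces.linear scale tscale "\<lambda>x. pure (xs[i := x])" .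
  have "pure (xs[i := 0]) = 0" by (rule l.zero)
  then show ?thesis using i by (metis list_update_id)
qed

lemma tmult_homogeneous:
  assumes xs: "length xs = n" "list_all2 (\<lambda>x d. x \<in> grade d) xs ds"
    and ys: "length ys = n" "list_all2 (\<lambda>y e. y \<in> grade e) ys es"
  shows "pure xs \<cdot> pure ys = tscale (ksign (cross_degree ds es)) (pure (map2 (*) xs ys))"
proof -
  let ?D = "{ds :: bit list. length ds = n}"
  let ?f = "\<lambda>ds' es'. tscale (ksign (cross_degree ds' es'))
      (pure (map2 (*) (map2 part ds' xs) (map2 part es' ys)))"
  have len: "length ds = n" "length es = n"
    using xs ys by (auto dest: list_all2_lengthD)
  have "finite {ds :: bit list. set ds \<subseteq> {0, 1} \<and> length ds = n}"
    by (rule finite_lists_length_eq) simp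
  moreover have "{ds :: bit list. set ds \<subseteq> {0, 1} \<and> length ds = n} = ?D"
    by auto
  ultimately have fin: "finite ?D" by simp
  have p: "part d (xs ! i) = (if d = ds ! i then xs ! i else 0)"
    "part d (ys ! i) = (if d = es ! i then ys ! i else 0)" if "i < n" for d i
    using that xs ys by (auto simp: list_all2_conv_all_nth intro!: part_homogeneous[THEN trans])
  have zero: "?f ds' es' = 0" if *: "length ds' = n" "length es' = n" "ds' \<noteq> ds \<or> es' \<noteq> es" for ds' es'
  proof -
    obtain i where i: "i < n" "ds' ! i \<noteq> ds ! i \<or> es' ! i \<noteq> es ! i"
      using * len by (metis nth_equalityI)
    then have "map2 (*) (map2 part ds' xs) (map2 part es' ys) ! i = 0"
      using * xs ys p[OF i(1)] by auto
    then have "0 \<in> set (map2 (*) (map2 part ds' xs) (map2 part es' ys))"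
      using i(1) * xs(1) ys(1) by (metis length_map length_zip min.idem nth_mem)
    then show ?thesis by (simp only: pure_zero tensor.scale_zero_right)
  qed
  have "pure xs \<cdot> pure ys = (\<Sum>ds'\<in>?D. \<Sum>es'\<in>?D. ?f ds' es')"
    using tmult_pure[OF xs(1) ys(1)] xs ys by (simp add: pure_mult_def)
  also have "\<dots> = (\<Sum>ds'\<in>{ds}. \<Sum>es'\<in>?D. ?f ds' es')"
    using fin len zero by (intro sum.mono_neutral_right ballI sum.neutral) auto
  also have "\<dots> = (\<Sum>es'\<in>?D. ?f ds es')"
    by simp
  also have "\<dots> = (\<Sum>es'\<in>{es}. ?f ds es')"
    using fin len zero by (intro sum.mono_neutral_right ballI) auto
  also have "\<dots> = ?f ds es"
    by simp
  also have "map2 (*) (map2 part ds xs) (map2 part es ys) = map2 (*) xs ys"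
    using xs ys len p by (intro nth_equalityI) auto
  finally show ?thesis .
qed

definition tone :: "nat \<Rightarrow> ('a, 'k) tensor" where
  "tone n = pure (replicate n 1)"

definition tgrade :: "nat \<Rightarrow> bit \<Rightarrow> ('a, 'k) tensor set" where
  "tgrade n d = tensor.span
     {pure xs | xs ds. length xs = n \<and> list_all2 (\<lambda>x e. x \<in> grade e) xs ds \<and> sum_list ds = d}"

definition is_tinv :: "nat \<Rightarrow> ('a, 'k) tensor \<Rightarrow> ('a, 'k) tensor \<Rightarrow> bool" where
  "is_tinv n t s \<longleftrightarrow> s \<in> tpower n \<and> t \<cdot> s = tone n \<and> s \<cdot> t = tone n"

definition tinvertible :: "nat \<Rightarrow> ('a, 'k) tensor \<Rightarrow> bool" where
  "tinvertible n t \<longleftrightarrow> t \<in> tpower n \<and> (\<exists>s. is_tinv n t s)"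

definition tinv :: "nat \<Rightarrow> ('a, 'k) tensor \<Rightarrow> ('a, 'k) tensor" where
  "tinv n t = (THE s. is_tinv n t s)"

definition thomogeneous :: "nat \<Rightarrow> ('a, 'k) tensor \<Rightarrow> bool" where
  "thomogeneous n t \<longleftrightarrow> (\<exists>d. t \<in> tgrade n d)"

text \<open>The iterated product map \<open>x\<^sub>1 \<otimes> \<dots> \<otimes> x\<^sub>n \<mapsto> x\<^sub>1 \<cdots> x\<^sub>n\<close>, i.e. \<open>m\<close> for \<open>n = 2\<close> and
  \<open>m \<cdot> (m \<otimes> 1)\<close> for \<open>n = 3\<close>.\<close>

definition mprod :: "('a, 'k) tensor \<Rightarrow> 'a" where
  "mprod t = unemb (lift (\<lambda>xs. emb (prod_list xs)) t)"

end

section \<open>Graded quasi-bialgebras and quasi-Hopf superalgebras\<close>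

locale graded_quasi_bialgebra = superalgebra scale grade
  for scale :: "'k::field \<Rightarrow> 'a::ring_1 \<Rightarrow> 'a" (infixr \<open>*s\<close> 75)
    and grade :: "bit \<Rightarrow> 'a set" +
  fixes \<Delta> :: "'a \<Rightarrow> ('a, 'k) tensor"
    and \<epsilon> :: "'a \<Rightarrow> 'k"
    and \<Phi> :: "('a, 'k) tensor"
  assumes counit_linear: "Vector_Spaces.linear scale (*) \<epsilon>"
    and counit_one: "\<epsilon> 1 = 1"
    and counit_mult: "\<epsilon> (a * b) = \<epsilon> a * \<epsilon> b"
    and counit_odd: "a \<in> grade 1 \<Longrightarrow> \<epsilon> a = 0"
    and comult_in_tpower: "\<Delta> a \<in> tpower 2"
    and comult_linear: "Vector_Spaces.linear scale tscale \<Delta>"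
    and comult_one: "\<Delta> 1 = tone 2"
    and comult_mult: "\<Delta> (a * b) = \<Delta> a \<cdot> \<Delta> b"
    and comult_grade: "a \<in> grade d \<Longrightarrow> \<Delta> a \<in> tgrade 2 d"
    and assoc_invertible: "tinvertible 3 \<Phi>"
    and assoc_homogeneous: "thomogeneous 3 \<Phi>"
    and quasi_coassoc: "tmap [emb, \<Delta>] (\<Delta> a) = tinv 3 \<Phi> \<cdot> tmap [\<Delta>, emb] (\<Delta> a) \<cdot> \<Phi>"
    and pentagon: "tmap [\<Delta>, emb, emb] \<Phi> \<cdot> tmap [emb, emb, \<Delta>] \<Phi> =
      (\<Phi> \<otimes> emb 1) \<cdot> tmap [emb, \<Delta>, emb] \<Phi> \<cdot> (emb 1 \<otimes> \<Phi>)"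
    and counit_left: "tmap [of_form \<epsilon>, emb] (\<Delta> a) = emb a"
    and counit_right: "tmap [emb, of_form \<epsilon>] (\<Delta> a) = emb a"
    and counit_assoc: "tmap [emb, of_form \<epsilon>, emb] \<Phi> = tone 2"

locale quasi_hopf_superalgebra = graded_quasi_bialgebra scale grade \<Delta> \<epsilon> \<Phi>
  for scale :: "'k::field \<Rightarrow> 'a::ring_1 \<Rightarrow> 'a" (infixr \<open>*s\<close> 75)
    and grade :: "bit \<Rightarrow> 'a set"
    and \<Delta> :: "'a \<Rightarrow> ('a, 'k) tensor"
    and \<epsilon> :: "'a \<Rightarrow> 'k"
    and \<Phi> :: "('a, 'k) tensor" +
  fixes S :: "'a \<Rightarrow> 'a"
    and \<alpha> \<beta> :: 'a
  assumes antipode_linear: "Vector_Spaces.linear scale scale S"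
    and antipode_one: "S 1 = 1"
    and antipode_mult: "a \<in> grade d \<Longrightarrow> b \<in> grade e \<Longrightarrow> S (a * b) = ksign (d * e) *s (S b * S a)"
    and antipode_grade: "a \<in> grade d \<Longrightarrow> S a \<in> grade d"
    and alpha_even: "\<alpha> \<in> grade 0"
    and beta_even: "\<beta> \<in> grade 0"
    and antipode_alpha:
      "mprod ((emb 1 \<otimes> emb \<alpha>) \<cdot> tmap [emb \<circ> S, emb] (\<Delta> a)) = \<epsilon> a *s \<alpha>"
    and antipode_beta:
      "mprod ((emb 1 \<otimes> emb \<beta>) \<cdot> tmap [emb, emb \<circ> S] (\<Delta> a)) = \<epsilon> a *s \<beta>"
    and antipode_assoc_inv:
      "mprod ((emb 1 \<otimes> emb \<beta> \<otimes> emb \<alpha>) \<cdot> tmap [emb, emb \<circ> S, emb] (tinv 3 \<Phi>)) = 1"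
    and antipode_assoc:
      "mprod (tmap [emb \<circ> S, emb, emb]
        ((emb 1 \<otimes> emb \<alpha> \<otimes> emb \<beta>) \<cdot> tmap [emb, emb, emb \<circ> S] \<Phi>)) = 1"

section \<open>Twisting\<close>

context superalgebra
begin

definition twist_comult ::
  "('a, 'k) tensor \<Rightarrow> ('a \<Rightarrow> ('a, 'k) tensor) \<Rightarrow> 'a \<Rightarrow> ('a, 'k) tensor" where
  "twist_comult F \<Delta> a = F \<cdot> \<Delta> a \<cdot> tinv 2 F"

definition twist_assoc ::
  "('a, 'k) tensor \<Rightarrow> ('a \<Rightarrow> ('a, 'k) tensor) \<Rightarrow> ('a, 'k) tensor \<Rightarrow> ('a, 'k) tensor" where
  "twist_assoc F \<Delta> \<Phi> =
     (F \<otimes> emb 1) \<cdot> tmap [\<Delta>, emb] F \<cdot> \<Phi> \<cdot> tmap [emb, \<Delta>] (tinv 2 F) \<cdot> (emb 1 \<otimes> tinv 2 F)"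

definition twist_alpha :: "('a, 'k) tensor \<Rightarrow> ('a \<Rightarrow> 'a) \<Rightarrow> 'a \<Rightarrow> 'a" where
  "twist_alpha F S \<alpha> = mprod ((emb 1 \<otimes> emb \<alpha>) \<cdot> tmap [emb \<circ> S, emb] (tinv 2 F))"

definition twist_beta :: "('a, 'k) tensor \<Rightarrow> ('a \<Rightarrow> 'a) \<Rightarrow> 'a \<Rightarrow> 'a" where
  "twist_beta F S \<beta> = mprod ((emb 1 \<otimes> emb \<beta>) \<cdot> tmap [emb, emb \<circ> S] F)"

text \<open>\<open>F \<in> A \<otimes> A\<close> invertible and homogeneous with \<open>(\<epsilon> \<otimes> 1) F = 1 = (1 \<otimes> \<epsilon>) F\<close>.\<close>

definition gauge_transformation :: "('a \<Rightarrow> 'k) \<Rightarrow> ('a, 'k) tensor \<Rightarrow> bool" where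
  "gauge_transformation \<epsilon> F \<longleftrightarrow> tinvertible 2 F \<and> thomogeneous 2 F \<and>
     tmap [of_form \<epsilon>, emb] F = tone 1 \<and> tmap [emb, of_form \<epsilon>] F = tone 1"

end

end

theory Submission
  imports Defs
begin

text \<open>
  Quasi-coassociativity and the pentagon for the twist are identities between long products in
  \<open>A\<^sup>\<otimes>\<^sup>3\<close> and \<open>A\<^sup>\<otimes>\<^sup>4\<close>. Write \<open>G\<close> for the inverse of \<open>F\<close>. The maps \<open>\<Delta>\<close>, \<open>\<epsilon>\<close> and the identity are
  even algebra homomorphisms, so their tensor products are algebra homomorphisms (\<open>tmap_tmult\<close>),
  and replacing \<open>\<Delta>\<close> by \<open>F \<Delta>(-) G\<close> in one slot conjugates the result by \<open>1 \<otimes> F \<otimes> 1\<close>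
  (\<open>tmap_conj\<close>). Once both sides of an axiom are expanded, neighbouring factors cancel and the
  corresponding axiom of \<open>A\<close> remains. In the pentagon one also moves \<open>\<Phi>\<close> past
  \<open>((\<Delta> \<otimes> 1)\<Delta> \<otimes> 1) F\<close> by quasi-coassociativity, and lets \<open>F \<otimes> 1 \<otimes> 1\<close> commute with
  \<open>1 \<otimes> 1 \<otimes> F\<close>.

  No signs appear in these computations because \<open>F\<close>, \<open>\<Phi>\<close> and their inverses are even: the
  counit conditions say that an even map sends them to a unit element, which is not odd
  (\<open>normalised_even\<close>), and the inverse of an even element is even (\<open>tinv_even\<close>). Both points use
  that \<open>A\<^sup>\<otimes>\<^sup>n\<close> is the direct sum of its even and odd parts, in every characteristic.

  For the antipode, each axiom says that a linear evaluation takes a certain value, where the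
  evaluations are
  \<open>\<mu>\<^sub>\<gamma>(x \<otimes> y) = S(x) \<gamma> y\<close>, \<open>\<nu>\<^sub>\<delta>(x \<otimes> y) = x \<delta> S(y)\<close>,
  \<open>\<omega>\<^sub>\<gamma>\<^sub>,\<^sub>\<delta>(x \<otimes> y \<otimes> z) = S(x) \<gamma> y \<delta> S(z)\<close> and
  \<open>\<chi>\<^sub>\<delta>\<^sub>,\<^sub>\<gamma>(x \<otimes> y \<otimes> z) = x \<delta> S(y) \<gamma> z\<close>.
  Since \<open>S\<close> reverses products, the sign of the graded product and the sign of \<open>S\<close> combine so that
  an even factor is absorbed into the parameter:
  \<open>\<mu>\<^sub>\<gamma>(s t) = \<mu>\<^sub>\<gamma>\<^sub>'(t)\<close> with \<open>\<gamma>' = \<mu>\<^sub>\<gamma>(s)\<close> for even \<open>s\<close>, and similarly for the other three. Thus \<open>\<alpha>\<^sub>F = \<mu>\<^sub>\<alpha>(G)\<close> and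
  \<open>\<beta>\<^sub>F = \<nu>\<^sub>\<beta>(F)\<close> are exactly the parameters for which the outer factors \<open>F \<otimes> 1\<close> and \<open>1 \<otimes> G\<close>
  of \<open>\<Phi>\<^sub>F\<close> turn \<open>\<omega>\<close> with parameters \<open>\<alpha>\<^sub>F, \<beta>\<^sub>F\<close> back into \<open>\<omega>\<close> with parameters \<open>\<alpha>, \<beta>\<close>. The inner factors
  \<open>(\<Delta> \<otimes> 1) F\<close> and \<open>(1 \<otimes> \<Delta>) G\<close> then disappear, because \<open>\<mu>\<^sub>\<alpha>(\<Delta>(a)) = \<epsilon>(a) \<alpha>\<close> and \<open>\<nu>\<^sub>\<beta>(\<Delta>(a)) = \<epsilon>(a) \<beta>\<close>
  replace them by \<open>(\<epsilon> \<otimes> 1) F = 1\<close> and \<open>(1 \<otimes> \<epsilon>) G = 1\<close>, and what is left is the axiom for \<open>\<Phi>\<close>. The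
  axiom for the inverse of \<open>\<Phi>\<^sub>F\<close> is obtained in the same way with \<open>\<chi>\<close>.
\<close>

section \<open>Linear maps on tensor powers\<close>

context tensor_powers
begin

text \<open>
  The maps that occur below, such as \<open>\<lambda>t. s \<otimes> t\<close> and \<open>\<lambda>t. s \<cdot> t\<close>, are linear only between tensors
  of the right degree: a pure tensor vanishes on functions that are not multilinear, and the functions
  to which it is applied are multilinear only if the other argument lies in the right tensor power.
  Hence linearity is relative to \<open>tpower n\<close>.
\<close>

definition tlin :: "nat \<Rightarrow> ('k \<Rightarrow> 'v::ab_group_add \<Rightarrow> 'v) \<Rightarrow> (('a, 'k) tensor \<Rightarrow> 'v) \<Rightarrow> bool" where
  "tlin n scale' h \<longleftrightarrow>
     (\<forall>s\<in>tpower n. \<forall>t\<in>tpower n. h (s + t) = h s + h t) \<and>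
     (\<forall>c. \<forall>t\<in>tpower n. h (tscale c t) = scale' c (h t))"

lemma tlin_add: "tlin n scale' h \<Longrightarrow> s \<in> tpower n \<Longrightarrow> t \<in> tpower n \<Longrightarrow> h (s + t) = h s + h t"
  and tlin_scale: "tlin n scale' h \<Longrightarrow> t \<in> tpower n \<Longrightarrow> h (tscale c t) = scale' c (h t)"
  by (simp_all add: tlin_def)

lemma linear_imp_tlin: "Vector_Spaces.linear tscale scale' h \<Longrightarrow> tlin n scale' h"
  by (simp add: tlin_def Vector_Spaces.linear_iff)

lemma subspace_tpower: "tensor.subspace (tpower n)"
  by (simp add: tpower_def)

lemma tpower_add: "s \<in> tpower n \<Longrightarrow> t \<in> tpower n \<Longrightarrow> s + t \<in> tpower n"
  and tpower_tscale: "t \<in> tpower n \<Longrightarrow> tscale c t \<in> tpower n"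
  and tpower_zero: "0 \<in> tpower n"
  using subspace_tpower
  by (auto simp: tensor.subspace_add tensor.subspace_scale tensor.subspace_0)

lemma pure_in_tpower: "length xs = n \<Longrightarrow> pure xs \<in> tpower n"
  unfolding tpower_def by (rule tensor.span_base) auto

lemma tlin_zero:
  assumes "tlin n scale' h" shows "h 0 = 0"
  using tlin_add[OF assms tpower_zero tpower_zero] by simp

lemma tlin_eq_on_span:
  assumes h: "tlin n scale' h" "tlin n scale' h'" and U: "U \<subseteq> tpower n"
    and eq: "\<And>u. u \<in> U \<Longrightarrow> h u = h' u" and t: "t \<in> tensor.span U"
  shows "h t = h' t"
proof -
  have "t \<in> tpower n \<and> h t = h' t"
  proof (rule tensor.span_induct[OF t])
    show "tensor.subspace {t \<in> tpower n. h t = h' t}"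
      using h
      by (intro tensor.subspaceI)
        (auto simp: tpower_zero tpower_add tpower_tscale tlin_zero tlin_add tlin_scale)
  qed (use U eq in auto)
  then show ?thesis by simp
qed

lemma tlin_eq:
  assumes "tlin n scale' h" "tlin n scale' h'"
    and "\<And>xs. length xs = n \<Longrightarrow> h (pure xs) = h' (pure xs)" and "t \<in> tpower n"
  shows "h t = h' t"
proof (rule tlin_eq_on_span[OF assms(1,2)])
  show "t \<in> tensor.span {pure xs | xs. length xs = n}"
    using assms(4) by (simp add: tpower_def)
qed (use assms(3) in \<open>auto intro: pure_in_tpower\<close>)

lemma tlin_span_subset:
  assumes h: "tlin n tscale h" and U: "U \<subseteq> tpower n"
    and W: "tensor.subspace W" and in_W: "\<And>u. u \<in> U \<Longrightarrow> h u \<in> W" and t: "t \<in> tensor.span U"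
  shows "h t \<in> W"
proof -
  have "t \<in> tpower n \<and> h t \<in> W"
  proof (rule tensor.span_induct[OF t])
    show "tensor.subspace {t \<in> tpower n. h t \<in> W}"
      using h W
      by (intro tensor.subspaceI)
        (auto simp: tpower_zero tpower_add tpower_tscale tlin_zero tlin_add tlin_scale
          tensor.subspace_add tensor.subspace_scale tensor.subspace_0)
  qed (use U in_W in auto)
  then show ?thesis by simp
qed

lemma tlin_tpower:
  assumes "tlin n tscale h" and "tensor.subspace W"
    and "\<And>xs. length xs = n \<Longrightarrow> h (pure xs) \<in> W" and "t \<in> tpower n"
  shows "h t \<in> W"
proof (rule tlin_span_subset[OF assms(1) _ assms(2)])
  show "t \<in> tensor.span {pure xs | xs. length xs = n}"
    using assms(4) by (simp add: tpower_def)
qed (use assms(3) in \<open>auto intro: pure_in_tpower\<close>)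

lemma tlin_id: "tlin n tscale (\<lambda>t. t)"
  by (simp add: tlin_def)

lemma tlin_compose_linear:
  "Vector_Spaces.linear scale' scale'' h \<Longrightarrow> tlin n scale' f \<Longrightarrow> tlin n scale'' (\<lambda>t. h (f t))"
  by (simp add: tlin_def Vector_Spaces.linear_iff)

lemma tlin_compose:
  "tlin m scale'' h \<Longrightarrow> tlin n tscale f \<Longrightarrow> (\<And>t. t \<in> tpower n \<Longrightarrow> f t \<in> tpower m) \<Longrightarrow>
    tlin n scale'' (\<lambda>t. h (f t))"
  by (simp add: tlin_def)

text \<open>
  The products \<open>\<otimes>\<close> and \<open>\<cdot>\<close> are both iterated lifts of a function that is multilinear in each of two
  lists. Such a lift is linear in its first argument for trivial reasons; linearity in the second
  one is proved for pure tensors and extended to their span.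
\<close>

context
  fixes m n and g :: "'a list \<Rightarrow> 'a list \<Rightarrow> ('b, 'k) tensor"
  assumes left: "\<And>ys. length ys = n \<Longrightarrow> multilinear tscale m (\<lambda>xs. g xs ys)"
    and right: "\<And>xs. length xs = m \<Longrightarrow> multilinear tscale n (g xs)"
begin

lemma lift_lift_pure_left:
  assumes t: "t \<in> tpower n" and xs: "length xs = m"
  shows "lift (\<lambda>xs. lift (g xs) t) (pure xs) = lift (g xs) t"
proof (rule lift_pure[OF _ xs])
  show "multilinear tscale m (\<lambda>xs. lift (g xs) t)"
    unfolding multilinear_def
  proof (intro allI impI)
    fix xs :: "'a list" and i assume xs: "length xs = m \<and> i < m"
    have lin: "Vector_Spaces.linear scale tscale (\<lambda>x. g (xs[i := x]) ys)" if "length ys = n" for ys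
      using left[OF that] xs unfolding multilinear_def by blast
    have pure: "lift (g (xs[i := x])) (pure ys) = g (xs[i := x]) ys" if "length ys = n" for x ys
      using right that xs by (intro lift_pure) auto
    note lift_linear = linear_lift[of "g (xs[i := x])" for x]
    have "lift (g (xs[i := x + y])) t = lift (g (xs[i := x])) t + lift (g (xs[i := y])) t" for x y
      by (rule tensor_unique[OF linear_lift _ _ t, where h' = "\<lambda>t. lift (g (xs[i := x])) t + lift (g (xs[i := y])) t"])
        (use lift_linear lin pure in
          \<open>auto simp: Vector_Spaces.linear_iff tensor.scale_right_distrib\<close>)
    moreover have "lift (g (xs[i := scale c x])) t = tscale c (lift (g (xs[i := x])) t)" for c x
      by (rule tensor_unique[OF linear_lift _ _ t, where h' = "\<lambda>t. tscale c (lift (g (xs[i := x])) t)"])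
        (use lift_linear lin pure in
          \<open>auto simp: Vector_Spaces.linear_iff tensor.scale_right_distrib tensor.scale_left_commute\<close>)
    ultimately show "Vector_Spaces.linear scale tscale (\<lambda>x. lift (g (xs[i := x])) t)"
      by (simp add: Vector_Spaces.linear_iff vector_space_axioms tensor.vector_space_axioms)
  qed
qed

lemma lift_lift_pure:
  assumes "length xs = m" "length ys = n"
  shows "lift (\<lambda>xs. lift (g xs) (pure ys)) (pure xs) = g xs ys"
  using assms by (simp add: lift_lift_pure_left pure_in_tpower lift_pure[OF right])

lemma tlin_lift_lift:
  assumes s: "s \<in> tpower m"
  shows "tlin n tscale (\<lambda>t. lift (\<lambda>xs. lift (g xs) t) s)"
proof -
  let ?B = "\<lambda>s t. lift (\<lambda>xs. lift (g xs) t) s"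
  have B: "?B (s + s') t = ?B s t + ?B s' t" "?B (tscale c s) t = tscale c (?B s t)" for s s' t c
    using linear_lift[of "\<lambda>xs. lift (g xs) t"] by (simp_all add: Vector_Spaces.linear_iff)
  have B0: "?B 0 t = 0" for t
    using B(1)[of _ 0 0] by simp
  have "tlin n tscale (?B s)"
  proof (rule tensor.span_induct[where P = "\<lambda>s. tlin n tscale (?B s)"])
    show "s \<in> tensor.span {pure xs | xs. length xs = m}"
      using s by (simp add: tpower_def)
    show "tensor.subspace {s. tlin n tscale (?B s)}"
      by (intro tensor.subspaceI)
        (auto simp: tlin_def B B0 tensor.scale_right_distrib tensor.scale_left_commute)
    fix s assume "s \<in> {pure xs | xs. length xs = m}"
    then obtain xs where xs: "s = pure xs" "length xs = m" by blast
    show "tlin n tscale (?B s)"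
      using linear_lift[of "g xs"] xs(2)
      by (auto simp: xs(1) tlin_def lift_lift_pure_left tpower_add tpower_tscale Vector_Spaces.linear_iff)
  qed
  then show ?thesis by simp
qed

end

section \<open>The product of tensors\<close>

lemma list_update_append2: "length xs = m \<Longrightarrow> (xs @ ys)[m + i := y] = xs @ ys[i := y]"
  by (simp add: list_update_append)

lemma multilinear_append:
  assumes "multilinear scale' (m + n) g"
  shows "length ys = n \<Longrightarrow> multilinear scale' m (\<lambda>xs. g (xs @ ys))"
    and "length xs = m \<Longrightarrow> multilinear scale' n (\<lambda>ys. g (xs @ ys))"
proof -
  assume ys: "length ys = n"
  show "multilinear scale' m (\<lambda>xs. g (xs @ ys))"
    unfolding multilinear_def
  proof (intro allI impI)
    fix xs :: "'a list" and i assume xs: "length xs = m \<and> i < m"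
    then have "Vector_Spaces.linear scale scale' (\<lambda>x. g ((xs @ ys)[i := x]))"
      using assms ys unfolding multilinear_def by simp
    then show "Vector_Spaces.linear scale scale' (\<lambda>x. g (xs[i := x] @ ys))"
      using xs by (simp add: list_update_append1)
  qed
next
  assume xs: "length xs = m"
  show "multilinear scale' n (\<lambda>ys. g (xs @ ys))"
    unfolding multilinear_def
  proof (intro allI impI)
    fix ys :: "'a list" and i assume ys: "length ys = n \<and> i < n"
    then have "Vector_Spaces.linear scale scale' (\<lambda>x. g ((xs @ ys)[m + i := x]))"
      using assms xs unfolding multilinear_def by simp
    then show "Vector_Spaces.linear scale scale' (\<lambda>x. g (xs @ ys[i := x]))"
      using xs by (simp add: list_update_append2)
  qed
qed

lemmas multilinear_pure_append = multilinear_append[OF multilinear_pure]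

lemma tensor_prod_pure: "pure xs \<otimes> pure ys = pure (xs @ ys)"
  unfolding tensor_prod_def
  by (rule lift_lift_pure) (auto intro: multilinear_pure_append)

lemma linear_tensor_prod_left: "Vector_Spaces.linear tscale tscale (\<lambda>s. s \<otimes> t)"
  unfolding tensor_prod_def by (rule linear_lift)

lemma tlin_tensor_prod_right: "s \<in> tpower m \<Longrightarrow> tlin n tscale (\<lambda>t. s \<otimes> t)"
  unfolding tensor_prod_def
  by (rule tlin_lift_lift) (auto intro: multilinear_pure_append)

lemma tlin_left:
  "tlin n tscale f \<Longrightarrow> tlin n tscale (\<lambda>t. f t \<otimes> u)"
  by (rule tlin_compose_linear[OF linear_tensor_prod_left])

lemma tlin_right:
  "s \<in> tpower m \<Longrightarrow> tlin n tscale f \<Longrightarrow> (\<And>t. t \<in> tpower n \<Longrightarrow> f t \<in> tpower k) \<Longrightarrow>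
    tlin n tscale (\<lambda>t. s \<otimes> f t)"
  by (rule tlin_compose[OF tlin_tensor_prod_right])

lemma tensor_prod_closed:
  assumes "s \<in> tpower m" "t \<in> tpower n"
  shows "s \<otimes> t \<in> tpower (m + n)"
proof (rule tlin_tpower[OF _ subspace_tpower _ assms(1)])
  show "tlin m tscale (\<lambda>s. s \<otimes> t)" by (intro tlin_left tlin_id)
  fix xs :: "'a list" assume xs: "length xs = m"
  show "pure xs \<otimes> t \<in> tpower (m + n)"
    by (rule tlin_tpower[OF tlin_tensor_prod_right subspace_tpower _ assms(2)])
      (use xs in \<open>auto simp: tensor_prod_pure intro: pure_in_tpower\<close>)
qed

lemma tensor_prod_assoc:
  assumes "s \<in> tpower m" "t \<in> tpower n" "u \<in> tpower k"
  shows "(s \<otimes> t) \<otimes> u = s \<otimes> t \<otimes> u"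
proof (rule tlin_eq[OF _ _ _ assms(1)])
  show "tlin m tscale (\<lambda>s. (s \<otimes> t) \<otimes> u)" "tlin m tscale (\<lambda>s. s \<otimes> t \<otimes> u)"
    by (intro tlin_left tlin_id)+
  fix xs :: "'a list" assume xs: "length xs = m"
  show "(pure xs \<otimes> t) \<otimes> u = pure xs \<otimes> t \<otimes> u"
  proof (rule tlin_eq[OF _ _ _ assms(2)])
    show "tlin n tscale (\<lambda>t. (pure xs \<otimes> t) \<otimes> u)"
      by (intro tlin_left tlin_tensor_prod_right[OF pure_in_tpower[OF xs]])
    show "tlin n tscale (\<lambda>t. pure xs \<otimes> t \<otimes> u)"
      by (rule tlin_right[OF pure_in_tpower[OF xs]])
        (auto intro: tlin_left tlin_id tensor_prod_closed assms)
    fix ys :: "'a list" assume ys: "length ys = n"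
    show "(pure xs \<otimes> pure ys) \<otimes> u = pure xs \<otimes> pure ys \<otimes> u"
    proof (rule tlin_eq[OF _ _ _ assms(3)])
      show "tlin k tscale (\<lambda>u. (pure xs \<otimes> pure ys) \<otimes> u)"
        by (rule tlin_tensor_prod_right[of _ "m + n"])
          (simp add: tensor_prod_pure pure_in_tpower xs ys)
      show "tlin k tscale (\<lambda>u. pure xs \<otimes> pure ys \<otimes> u)"
        by (rule tlin_right[OF pure_in_tpower[OF refl]])
          (auto intro: tlin_tensor_prod_right tensor_prod_closed pure_in_tpower)
    qed (simp add: tensor_prod_pure)
  qed
qed

lemma tensor_prod_unit_left: "t \<in> tpower n \<Longrightarrow> pure [] \<otimes> t = t"
  by (erule tlin_eq[OF tlin_tensor_prod_right[OF pure_in_tpower[OF refl]] tlin_id, rotated])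
    (simp add: tensor_prod_pure)

lemma tensor_prod_unit_right: "t \<in> tpower n \<Longrightarrow> t \<otimes> pure [] = t"
  by (erule tlin_eq[OF tlin_left[OF tlin_id] tlin_id, rotated]) (simp add: tensor_prod_pure)

lemma tensor_prod_tscale_left: "tscale c s \<otimes> t = tscale c (s \<otimes> t)"
  using linear_tensor_prod_left by (simp add: Vector_Spaces.linear_iff)

lemma tensor_prod_tscale_right:
  "s \<in> tpower m \<Longrightarrow> t \<in> tpower n \<Longrightarrow> s \<otimes> tscale c t = tscale c (s \<otimes> t)"
  by (rule tlin_scale[OF tlin_tensor_prod_right])

section \<open>Tensor products of linear maps\<close>

text \<open>
  Linear maps from \<open>A\<close> into a single tensor power: the maps to which \<open>tmap\<close> applies meaningfully.
\<close>

definition graded_linear :: "('a \<Rightarrow> ('a, 'k) tensor) \<Rightarrow> nat \<Rightarrow> bool" where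
  "graded_linear f n \<longleftrightarrow> Vector_Spaces.linear scale tscale f \<and> (\<forall>x. f x \<in> tpower n)"

lemma multilinear_tmap:
  assumes "list_all2 graded_linear fs ns"
  shows "multilinear tscale (length fs) (\<lambda>xs. foldr (\<otimes>) (map2 (\<lambda>f x. f x) fs xs) (pure []))
    \<and> (\<forall>xs. length xs = length fs \<longrightarrow>
        foldr (\<otimes>) (map2 (\<lambda>f x. f x) fs xs) (pure []) \<in> tpower (sum_list ns))"
  using assms
proof (induction rule: list_all2_induct)
  case Nil
  then show ?case by (auto simp: multilinear_def intro: pure_in_tpower)
next
  case (Cons f fs n ns)
  let ?g = "\<lambda>fs xs. foldr (\<otimes>) (map2 (\<lambda>f x. f x) fs xs) (pure [])"
  have f: "Vector_Spaces.linear scale tscale f" "f x \<in> tpower n" for x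
    using Cons.hyps by (auto simp: graded_linear_def)
  have "?g (f # fs) xs \<in> tpower (sum_list (n # ns))" if "length xs = length (f # fs)" for xs
    using that Cons.IH f(2) by (cases xs) (auto intro: tensor_prod_closed)
  moreover have "Vector_Spaces.linear scale tscale (\<lambda>x. ?g (f # fs) (xs[i := x]))"
    if len: "length xs = length (f # fs)" and i: "i < length (f # fs)" for xs i
  proof -
    obtain y ys where xs: "xs = y # ys" "length ys = length fs" using len by (cases xs) auto
    show ?thesis
    proof (cases i)
      case 0
      then show ?thesis
        using f(1) linear_tensor_prod_left[of "?g fs ys"] by (simp add: xs Vector_Spaces.linear_iff)
    next
      case (Suc j)
      then have j: "j < length fs" using i by simp
      then have lin: "Vector_Spaces.linear scale tscale (\<lambda>x. ?g fs (ys[j := x]))"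
        using Cons.IH xs(2) unfolding multilinear_def by blast
      have closed: "?g fs (ys[j := x]) \<in> tpower (sum_list ns)" for x
        using Cons.IH xs(2) by simp
      note l = tlin_tensor_prod_right[OF f(2)[of y], of "sum_list ns"]
      from lin show ?thesis
        by (simp add: xs Suc Vector_Spaces.linear_iff tlin_add[OF l closed closed]
            tlin_scale[OF l closed])
    qed
  qed
  ultimately show ?case unfolding multilinear_def by blast
qed

lemma tmap_pure:
  assumes "list_all2 graded_linear fs ns" "length xs = length fs"
  shows "tmap fs (pure xs) = foldr (\<otimes>) (map2 (\<lambda>f x. f x) fs xs) (pure [])"
  unfolding tmap_def using multilinear_tmap[OF assms(1)] assms(2) by (intro lift_pure) auto

lemma linear_tmap: "Vector_Spaces.linear tscale tscale (tmap fs)"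
  unfolding tmap_def by (rule linear_lift)

lemmas tlin_tmap = tlin_compose_linear[OF linear_tmap]

lemma tmap_closed:
  assumes "list_all2 graded_linear fs ns" "t \<in> tpower (length fs)"
  shows "tmap fs t \<in> tpower (sum_list ns)"
  by (rule tlin_tpower[OF linear_imp_tlin[OF linear_tmap] subspace_tpower _ assms(2)])
    (use multilinear_tmap[OF assms(1)] tmap_pure[OF assms(1)] in simp)

lemma tmap_Nil [simp]: "tmap [] (pure []) = pure []"
  by (simp add: tmap_pure)

lemma tmap_Cons:
  assumes "list_all2 graded_linear (f # fs) (n # ns)" "length xs = length fs"
  shows "tmap (f # fs) (pure (x # xs)) = f x \<otimes> tmap fs (pure xs)"
  using assms tmap_pure[of fs ns xs] tmap_pure[of "f # fs" "n # ns" "x # xs"] by simp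

lemma tmap_append_pure:
  assumes "list_all2 graded_linear fs ms" "list_all2 graded_linear gs ns"
    and "length xs = length fs" "length ys = length gs"
  shows "tmap (fs @ gs) (pure (xs @ ys)) = tmap fs (pure xs) \<otimes> tmap gs (pure ys)"
  using assms(1,3)
proof (induction fs ms arbitrary: xs rule: list_all2_induct)
  case Nil
  have "tmap gs (pure ys) \<in> tpower (sum_list ns)"
    by (rule tmap_closed[OF assms(2)]) (simp add: pure_in_tpower assms(4))
  then show ?case using Nil by (simp add: tensor_prod_unit_left)
next
  case (Cons f fs m ms)
  obtain z zs where xs: "xs = z # zs" "length zs = length fs" using Cons.prems by (cases xs) auto
  have closed: "tmap fs (pure zs) \<in> tpower (sum_list ms)" "tmap gs (pure ys) \<in> tpower (sum_list ns)"
    using Cons.hyps xs(2) assms(2,4) by (auto intro!: tmap_closed pure_in_tpower)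
  have "list_all2 graded_linear (f # fs @ gs) (m # ms @ ns)"
    using Cons.hyps assms(2) by (auto intro: list_all2_appendI)
  then have "tmap (f # fs @ gs) (pure (z # zs @ ys)) = f z \<otimes> tmap (fs @ gs) (pure (zs @ ys))"
    by (rule tmap_Cons) (simp add: xs(2) assms(4))
  also have "\<dots> = f z \<otimes> tmap fs (pure zs) \<otimes> tmap gs (pure ys)"
    using Cons.IH[OF xs(2)] by simp
  also have "\<dots> = (f z \<otimes> tmap fs (pure zs)) \<otimes> tmap gs (pure ys)"
    using Cons.hyps closed by (metis graded_linear_def tensor_prod_assoc)
  also have "f z \<otimes> tmap fs (pure zs) = tmap (f # fs) (pure xs)"
    unfolding xs(1) by (rule tmap_Cons[symmetric, OF _ xs(2)]) (use Cons.hyps in auto)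
  finally show ?case by (simp add: xs(1))
qed

text \<open>
  Composites of maps that take one slot to several slots are computed with this blockwise rule.
\<close>

lemma tmap_tensor_prod:
  assumes fs: "list_all2 graded_linear fs ms" and gs: "list_all2 graded_linear gs ns"
    and s: "s \<in> tpower (length fs)" and t: "t \<in> tpower (length gs)"
  shows "tmap (fs @ gs) (s \<otimes> t) = tmap fs s \<otimes> tmap gs t"
proof (rule tlin_eq[OF _ _ _ s])
  show "tlin (length fs) tscale (\<lambda>s. tmap (fs @ gs) (s \<otimes> t))"
    "tlin (length fs) tscale (\<lambda>s. tmap fs s \<otimes> tmap gs t)"
    by (intro tlin_tmap tlin_left tlin_id)+
  fix xs :: "'a list" assume xs: "length xs = length fs"
  show "tmap (fs @ gs) (pure xs \<otimes> t) = tmap fs (pure xs) \<otimes> tmap gs t"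
  proof (rule tlin_eq[OF _ _ _ t])
    show "tlin (length gs) tscale (\<lambda>t. tmap (fs @ gs) (pure xs \<otimes> t))"
      by (intro tlin_tmap tlin_tensor_prod_right[OF pure_in_tpower[OF xs]])
    show "tlin (length gs) tscale (\<lambda>t. tmap fs (pure xs) \<otimes> tmap gs t)"
      by (rule tlin_right[OF tmap_closed[OF fs pure_in_tpower[OF xs]]])
        (auto intro: tlin_tmap tlin_id tmap_closed[OF gs])
  qed (simp add: tensor_prod_pure tmap_append_pure[OF fs gs xs])
qed

lemma graded_linear_emb: "graded_linear emb 1"
proof -
  have "Vector_Spaces.linear scale tscale (\<lambda>x. pure ([undefined][0 := x]))"
    using multilinear_pure[of 1] unfolding multilinear_def by (metis length_Cons list.size(3) One_nat_def lessI)
  then show ?thesis by (simp add: graded_linear_def emb_def[abs_def] pure_in_tpower)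
qed

lemma linear_emb: "Vector_Spaces.linear scale tscale emb"
  using graded_linear_emb by (simp add: graded_linear_def)

lemma emb_in_tpower: "emb x \<in> tpower 1"
  using graded_linear_emb by (simp add: graded_linear_def)

lemma graded_linear_compose:
  "graded_linear f n \<Longrightarrow> Vector_Spaces.linear scale scale h \<Longrightarrow> graded_linear (f \<circ> h) n"
  by (auto simp: graded_linear_def Vector_Spaces.linear_iff)

lemma graded_linear_of_form:
  "Vector_Spaces.linear scale (*) h \<Longrightarrow> graded_linear (of_form h) 0"
  by (auto simp: graded_linear_def Vector_Spaces.linear_iff of_form_def tensor.scale_left_distrib
      tensor.vector_space_axioms intro!: tpower_tscale pure_in_tpower)

lemma tmap_emb: 
  assumes "t \<in> tpower n" shows "tmap (replicate n emb) t = t"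
proof (rule tlin_eq[OF tlin_tmap[OF tlin_id] tlin_id _ assms])
  have *: "list_all2 graded_linear (replicate n emb) (replicate n 1)" for n
    by (induction n) (auto simp: graded_linear_emb[simplified])
  fix xs :: "'a list" assume "length xs = n"
  then show "tmap (replicate n emb) (pure xs) = pure xs"
  proof (induction xs arbitrary: n)
    case Nil
    then show ?case by simp
  next
    case (Cons x xs)
    then obtain m where m: "n = Suc m" "length xs = m" by auto
    have "tmap (emb # replicate m emb) (pure (x # xs)) = emb x \<otimes> tmap (replicate m emb) (pure xs)"
      using *[of n] m by (intro tmap_Cons) auto
    then show ?case using Cons.IH[OF m(2)] m(1) by (simp add: emb_def[of x] tensor_prod_pure)
  qed
qed

lemma tmap_emb_singleton: "graded_linear f n \<Longrightarrow> tmap [f] (emb x) = f x"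
  unfolding emb_def
  by (subst tmap_Cons[where n = n and ns = "[]"])
    (auto simp: graded_linear_def intro: tensor_prod_unit_right)

lemma tmap_pair:
  assumes "graded_linear f m" "graded_linear g n"
  shows "tmap [f, g] (pure [x, y]) = f x \<otimes> g y"
  using tmap_tensor_prod[of "[f]" "[m]" "[g]" "[n]" "emb x" "emb y"] assms
  by (simp add: tmap_emb_singleton emb_in_tpower[simplified]) (simp add: emb_def tensor_prod_pure)

lemma graded_linear_tmap:
  assumes f: "graded_linear f m" and hs: "list_all2 graded_linear hs ns" "length hs = m"
  shows "graded_linear (\<lambda>a. tmap hs (f a)) (sum_list ns)"
  using f tmap_closed[OF hs(1)] linear_tmap[of hs] hs(2)
  by (auto simp: graded_linear_def Vector_Spaces.linear_iff)

lemma tmap_tmap_pair: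
  assumes f: "graded_linear f m" and g: "graded_linear g n"
    and hs: "list_all2 graded_linear hs ms" "length hs = m"
    and ks: "list_all2 graded_linear ks ns" "length ks = n"
    and t: "t \<in> tpower 2"
  shows "tmap (hs @ ks) (tmap [f, g] t) = tmap [\<lambda>a. tmap hs (f a), \<lambda>a. tmap ks (g a)] t"
proof (rule tlin_eq[OF _ _ _ t])
  fix xs :: "'a list" assume "length xs = 2"
  then obtain x y where xs: "xs = [x, y]" by (auto simp: length_Suc_conv numeral_2_eq_2)
  have "f x \<in> tpower m" "g y \<in> tpower n" using f g by (auto simp: graded_linear_def)
  then show "tmap (hs @ ks) (tmap [f, g] (pure xs)) = tmap [\<lambda>a. tmap hs (f a), \<lambda>a. tmap ks (g a)] (pure xs)"
    unfolding xs tmap_pair[OF f g]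
    using tmap_tensor_prod[OF hs(1) ks(1)] hs(2) ks(2)
      tmap_pair[OF graded_linear_tmap[OF f hs] graded_linear_tmap[OF g ks]]
    by simp
qed (rule tlin_tmap[OF linear_imp_tlin[OF linear_tmap]] linear_imp_tlin[OF linear_tmap])+

end

text \<open>
  Degrees are added and multiplied as elements of the field with two elements; rewriting these
  operations to bit operations would block all ring normalisation.
\<close>

declare add_bit_eq_xor [simp del] mult_bit_eq_and [simp del]

context superalgebra
begin

section \<open>Signs of homogeneous lists\<close>

abbreviation homogeneous_list :: "'a list \<Rightarrow> bit list \<Rightarrow> bool" where
  "homogeneous_list \<equiv> list_all2 (\<lambda>x d. x \<in> grade d)"

lemma cross_degree_Nil [simp]: "cross_degree [] es = 0"
  by (simp add: cross_degree_def)

lemma cross_degree_Cons [simp]: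
  "cross_degree (d # ds) (e # es) = sum_list ds * e + cross_degree ds es"
  unfolding cross_degree_def
  by (simp add: sum.lessThan_Suc_shift sum.distrib sum_list_sum_nth atLeast0LessThan
      sum_distrib_right del: sum.lessThan_Suc)

text \<open>
  The extra term is the sign of the exchange of the second left block with the first right block;
  it becomes the sign in \<open>tmult_tensor_prod\<close>.
\<close>

lemma cross_degree_append:
  assumes "length ds = length es"
  shows "cross_degree (ds @ ds') (es @ es') =
    cross_degree ds es + cross_degree ds' es' + sum_list ds' * sum_list es"
  using assms by (induction ds es rule: list_induct2) (auto simp: algebra_simps)

lemma sum_list_map2_add:
  "length ds = length es \<Longrightarrow> sum_list (map2 (+) ds es) = sum_list ds + sum_list (es :: bit list)"
  by (induction ds es rule: list_induct2) (auto simp: algebra_simps)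

text \<open>
  Biadditivity of the sign exponent is what makes the graded product associative.
\<close>

lemma cross_degree_add:
  assumes "length ds = length es" "length es = length fs"
  shows "cross_degree (map2 (+) ds es) fs = cross_degree ds fs + cross_degree es fs"
    and "cross_degree ds (map2 (+) es fs) = cross_degree ds es + cross_degree ds fs"
  using assms
  by (induction ds es fs rule: list_induct3)
    (auto simp: sum_list_map2_add algebra_simps)

lemma ksign_zero [simp]: "ksign 0 = 1"
  by (simp add: ksign_def)

lemma ksign_add: "ksign (d + e) = ksign d * ksign e"
  by (cases d; cases e) (auto simp: ksign_def)

lemma homogeneous_list_mult:
  "homogeneous_list xs ds \<Longrightarrow> homogeneous_list ys es \<Longrightarrow>
    homogeneous_list (map2 (*) xs ys) (map2 (+) ds es)"
  by (auto simp: list_all2_conv_all_nth grade_mult)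

lemma tmult_pure_homogeneous:
  assumes "homogeneous_list xs ds" "homogeneous_list ys es" "length xs = length ys"
  shows "pure xs \<cdot> pure ys = tscale (ksign (cross_degree ds es)) (pure (map2 (*) xs ys))"
  using assms by (intro tmult_homogeneous) auto

section \<open>Homogeneous tensors\<close>

lemma tgrade_base:
  "homogeneous_list xs ds \<Longrightarrow> length xs = n \<Longrightarrow> sum_list ds = d \<Longrightarrow> pure xs \<in> tgrade n d"
  unfolding tgrade_def by (rule tensor.span_base) blast

lemma subspace_tgrade: "tensor.subspace (tgrade n d)"
  by (simp add: tgrade_def)

lemma tgrade_tpower: "t \<in> tgrade n d \<Longrightarrow> t \<in> tpower n"
  unfolding tgrade_def tpower_def by (erule tensor.span_mono[THEN subsetD, rotated]) blast

lemma tgrade_tscale: "t \<in> tgrade n d \<Longrightarrow> tscale c t \<in> tgrade n d"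
  using subspace_tgrade by (rule tensor.subspace_scale)

lemma grade_emb: "x \<in> grade d \<Longrightarrow> emb x \<in> tgrade 1 d"
  unfolding emb_def by (rule tgrade_base[of _ "[d]"]) auto

text \<open>
  Every identity between linear maps can therefore be checked on pure tensors of homogeneous
  elements, where the product is given by one explicit sign.
\<close>

lemma tpower_homogeneous_span:
  "tpower n = tensor.span {pure xs | xs ds. length xs = n \<and> homogeneous_list xs ds}"
    (is "_ = ?H n")
proof
  show "tpower n \<subseteq> ?H n"
    unfolding tpower_def
  proof (rule tensor.span_minimal)
    have "pure xs \<in> ?H (length xs)" for xs
    proof (induction xs)
      case Nil
      have "pure [] \<in> {pure xs | xs ds. length xs = length [] \<and> homogeneous_list xs ds}"
        by (intro CollectI exI[of _ "[]"]) simp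
      then show ?case by (rule tensor.span_base)
    next
      case (Cons x xs)
      have "pure (z # xs) \<in> ?H (length (x # xs))" if z: "z \<in> grade d" for z d
      proof -
        have "emb z \<otimes> pure xs \<in> ?H (length (x # xs))"
        proof (rule tlin_span_subset[OF tlin_tensor_prod_right[OF emb_in_tpower] _ _ _ Cons.IH])
          fix u assume "u \<in> {pure zs | zs ds. length zs = length xs \<and> homogeneous_list zs ds}"
          then obtain zs ds where zs: "u = pure zs" "length zs = length xs" "homogeneous_list zs ds"
            by blast
          have "homogeneous_list (z # zs) (d # ds)" using z zs by simp
          then show "emb z \<otimes> u \<in> ?H (length (x # xs))"
            unfolding zs(1) emb_def tensor_prod_pure
            by (intro tensor.span_base) (use zs in force)
        qed (auto intro: pure_in_tpower)
        then show ?thesis by (simp add: emb_def tensor_prod_pure)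
      qed
      moreover obtain y z where yz: "y \<in> grade 0" "z \<in> grade 1" "x = y + z"
        using grade_sum by blast
      moreover have "pure ((y + z) # xs) = pure (y # xs) + pure (z # xs)"
        using linear_emb linear_tensor_prod_left[of "pure xs"]
        by (simp add: Vector_Spaces.linear_iff emb_def)
          (metis append_Cons append_Nil tensor_prod_pure)
      ultimately show ?case by (simp only: tensor.span_add)
    qed
    then show "{pure xs | xs. length xs = n} \<subseteq> ?H n" by blast
  qed simp
qed (unfold tpower_def, rule tensor.span_mono, blast)

lemma tlin_eq_homogeneous:
  assumes "tlin n scale' h" "tlin n scale' h'" and t: "t \<in> tpower n"
    and eq: "\<And>xs ds. length xs = n \<Longrightarrow> homogeneous_list xs ds \<Longrightarrow> h (pure xs) = h' (pure xs)"
  shows "h t = h' t"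
proof (rule tlin_eq_on_span[OF assms(1,2) _ _ t[unfolded tpower_homogeneous_span]])
  fix u assume "u \<in> {pure xs | xs ds. length xs = n \<and> homogeneous_list xs ds}"
  then show "h u = h' u" using eq by blast
qed (blast intro: pure_in_tpower)

lemma tlin_eq_tgrade:
  assumes "tlin n scale' h" "tlin n scale' h'" and t: "t \<in> tgrade n d"
    and eq: "\<And>xs ds. length xs = n \<Longrightarrow> homogeneous_list xs ds \<Longrightarrow> sum_list ds = d \<Longrightarrow>
      h (pure xs) = h' (pure xs)"
  shows "h t = h' t"
proof (rule tlin_eq_on_span[OF assms(1,2) _ _ t[unfolded tgrade_def]])
  fix u assume "u \<in> {pure xs | xs ds. length xs = n \<and> homogeneous_list xs ds \<and> sum_list ds = d}"
  then show "h u = h' u" using eq by blast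
qed (blast intro: pure_in_tpower)

lemma tlin_tpower_homogeneous:
  assumes "tlin n tscale h" and "tensor.subspace W" and t: "t \<in> tpower n"
    and W: "\<And>xs ds. length xs = n \<Longrightarrow> homogeneous_list xs ds \<Longrightarrow> h (pure xs) \<in> W"
  shows "h t \<in> W"
proof (rule tlin_span_subset[OF assms(1) _ assms(2) _ t[unfolded tpower_homogeneous_span]])
  fix u assume "u \<in> {pure xs | xs ds. length xs = n \<and> homogeneous_list xs ds}"
  then show "h u \<in> W" using W by blast
qed (blast intro: pure_in_tpower)

lemma tlin_tgrade:
  assumes "tlin n tscale h" and "tensor.subspace W" and t: "t \<in> tgrade n d"
    and W: "\<And>xs ds. length xs = n \<Longrightarrow> homogeneous_list xs ds \<Longrightarrow> sum_list ds = d \<Longrightarrow>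
      h (pure xs) \<in> W"
  shows "h t \<in> W"
proof (rule tlin_span_subset[OF assms(1) _ assms(2) _ t[unfolded tgrade_def]])
  fix u assume "u \<in> {pure xs | xs ds. length xs = n \<and> homogeneous_list xs ds \<and> sum_list ds = d}"
  then show "h u \<in> W" using W by blast
qed (blast intro: pure_in_tpower)

section \<open>The graded product\<close>

lemma linear_tmult_left: "Vector_Spaces.linear tscale tscale (\<lambda>s. s \<cdot> t)"
  unfolding tmult_def by (rule linear_lift)

lemma tlin_tmult_right:
  assumes "s \<in> tpower n"
  shows "tlin n tscale (\<lambda>t. s \<cdot> t)"
  unfolding tmult_def
  by (rule tlin_lift_lift[OF _ _ assms]) 
    (auto intro: multilinear_pure_mult_left multilinear_pure_mult_right)

lemma tlin_mult_left: "tlin n tscale f \<Longrightarrow> tlin n tscale (\<lambda>t. f t \<cdot> u)"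
  by (rule tlin_compose_linear[OF linear_tmult_left])

lemma tlin_mult_right:
  "s \<in> tpower m \<Longrightarrow> tlin n tscale f \<Longrightarrow> (\<And>t. t \<in> tpower n \<Longrightarrow> f t \<in> tpower m) \<Longrightarrow>
    tlin n tscale (\<lambda>t. s \<cdot> f t)"
  by (rule tlin_compose[OF tlin_tmult_right])

lemma tmult_tscale_left: "tscale c s \<cdot> t = tscale c (s \<cdot> t)"
  using linear_tmult_left by (simp add: Vector_Spaces.linear_iff)

lemma tmult_tscale_right: "s \<in> tpower n \<Longrightarrow> t \<in> tpower n \<Longrightarrow> s \<cdot> tscale c t = tscale c (s \<cdot> t)"
  by (rule tlin_scale[OF tlin_tmult_right])

lemma linear_tscale: "Vector_Spaces.linear tscale tscale (tscale c)"
  by (simp add: Vector_Spaces.linear_iff tensor.vector_space_axioms tensor.scale_right_distrib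
      tensor.scale_left_commute)

lemma tmult_closed:
  assumes "s \<in> tpower n" "t \<in> tpower n"
  shows "s \<cdot> t \<in> tpower n"
proof (rule tlin_tpower_homogeneous[OF _ subspace_tpower assms(1)])
  fix xs ds assume xs: "length xs = n" "homogeneous_list xs ds"
  show "pure xs \<cdot> t \<in> tpower n"
  proof (rule tlin_tpower_homogeneous[OF _ subspace_tpower assms(2)])
    fix ys es assume ys: "length ys = n" "homogeneous_list ys es"
    show "pure xs \<cdot> pure ys \<in> tpower n"
      using xs ys tmult_pure_homogeneous[OF xs(2) ys(2)] by (simp add: tpower_tscale pure_in_tpower)
  qed (rule tlin_tmult_right[OF pure_in_tpower[OF xs(1)]])
qed (intro tlin_mult_left tlin_id)

lemma tmult_tgrade:
  assumes "s \<in> tgrade n d" "t \<in> tgrade n e"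
  shows "s \<cdot> t \<in> tgrade n (d + e)"
proof (rule tlin_tgrade[OF _ subspace_tgrade assms(1)])
  fix xs ds assume xs: "length xs = n" "homogeneous_list xs ds" "sum_list ds = d"
  show "pure xs \<cdot> t \<in> tgrade n (d + e)"
  proof (rule tlin_tgrade[OF _ subspace_tgrade assms(2)])
    fix ys es assume ys: "length ys = n" "homogeneous_list ys es" "sum_list es = e"
    have "length ds = length es" using xs ys by (auto dest!: list_all2_lengthD)
    then show "pure xs \<cdot> pure ys \<in> tgrade n (d + e)"
      using xs ys tmult_pure_homogeneous[OF xs(2) ys(2)] homogeneous_list_mult[OF xs(2) ys(2)]
      by (auto intro!: tgrade_tscale tgrade_base simp: sum_list_map2_add)
  qed (rule tlin_tmult_right[OF pure_in_tpower[OF xs(1)]])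
qed (intro tlin_mult_left tlin_id)

lemma map2_mult_assoc:
  "map2 (*) (map2 (*) xs ys) zs = map2 (*) xs (map2 (*) ys (zs :: 'a list))"
  by (intro nth_equalityI) (auto simp: mult.assoc)

lemma tmult_assoc:
  assumes s: "s \<in> tpower n" and t: "t \<in> tpower n" and u: "u \<in> tpower n"
  shows "(s \<cdot> t) \<cdot> u = s \<cdot> (t \<cdot> u)"
proof (rule tlin_eq_homogeneous[OF _ _ u])
  show "tlin n tscale (\<lambda>u. (s \<cdot> t) \<cdot> u)" "tlin n tscale (\<lambda>u. s \<cdot> (t \<cdot> u))"
    using s t by (auto intro!: tlin_tmult_right tmult_closed tlin_mult_right[OF s])
  fix zs fs assume zs: "length zs = n" "homogeneous_list zs fs"
  note mem_zs = pure_in_tpower[OF zs(1)]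
  show "(s \<cdot> t) \<cdot> pure zs = s \<cdot> (t \<cdot> pure zs)"
  proof (rule tlin_eq_homogeneous[OF _ _ t])
    show "tlin n tscale (\<lambda>t. (s \<cdot> t) \<cdot> pure zs)" "tlin n tscale (\<lambda>t. s \<cdot> (t \<cdot> pure zs))"
      using s mem_zs
      by (auto intro!: tlin_tmult_right tmult_closed tlin_mult_right[OF s] tlin_mult_left tlin_id)
    fix ys es assume ys: "length ys = n" "homogeneous_list ys es"
    show "(s \<cdot> pure ys) \<cdot> pure zs = s \<cdot> (pure ys \<cdot> pure zs)"
    proof (rule tlin_eq_homogeneous[OF _ _ s])
      show "tlin n tscale (\<lambda>s. (s \<cdot> pure ys) \<cdot> pure zs)" "tlin n tscale (\<lambda>s. s \<cdot> (pure ys \<cdot> pure zs))"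
        by (intro tlin_mult_left tlin_id)+
      fix xs ds assume xs: "length xs = n" "homogeneous_list xs ds"
      have len: "length ds = length es" "length es = length fs"
        using xs ys zs by (auto dest!: list_all2_lengthD)
      note xy = homogeneous_list_mult[OF xs(2) ys(2)] and yz = homogeneous_list_mult[OF ys(2) zs(2)]
      have "(pure xs \<cdot> pure ys) \<cdot> pure zs = tscale (ksign (cross_degree ds es) * ksign (cross_degree (map2 (+) ds es) fs))
          (pure (map2 (*) (map2 (*) xs ys) zs))"
        using xs ys zs tmult_pure_homogeneous[OF xs(2) ys(2)] tmult_pure_homogeneous[OF xy zs(2)]
        by (simp add: tmult_tscale_left)
      moreover have "pure xs \<cdot> (pure ys \<cdot> pure zs) = tscale (ksign (cross_degree es fs) * ksign (cross_degree ds (map2 (+) es fs)))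
          (pure (map2 (*) xs (map2 (*) ys zs)))"
        using xs ys zs tmult_pure_homogeneous[OF ys(2) zs(2)] tmult_pure_homogeneous[OF xs(2) yz]
        by (simp add: tmult_tscale_right[of _ n] pure_in_tpower)
      ultimately show "(pure xs \<cdot> pure ys) \<cdot> pure zs = pure xs \<cdot> (pure ys \<cdot> pure zs)"
        by (simp add: map2_mult_assoc cross_degree_add[OF len] ksign_add mult_ac)
    qed
  qed
qed

lemma homogeneous_ones: "homogeneous_list (replicate n 1) (replicate n 0)"
  by (simp add: list_all2_conv_all_nth grade_one)

lemma sum_list_zeros: "sum_list (replicate n (0 :: bit)) = 0"
  by (induction n) auto

lemma tone_tgrade: "tone n \<in> tgrade n 0"
  unfolding tone_def by (rule tgrade_base[OF homogeneous_ones]) (simp_all add: sum_list_zeros)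

lemma tone_tpower: "tone n \<in> tpower n"
  using tone_tgrade by (rule tgrade_tpower)

lemma cross_degree_zeros:
  "cross_degree (replicate (length ds) 0) ds = 0" "cross_degree ds (replicate (length ds) 0) = 0"
  by (simp_all add: cross_degree_def)

lemma tmult_tone:
  assumes "t \<in> tpower n"
  shows "tone n \<cdot> t = t" and "t \<cdot> tone n = t"
proof -
  show "tone n \<cdot> t = t"
  proof (rule tlin_eq_homogeneous[OF tlin_tmult_right[OF tone_tpower] tlin_id assms])
    fix xs ds assume xs: "length xs = n" "homogeneous_list xs ds"
    have "map2 (*) (replicate n 1) xs = xs" using xs(1) by (intro nth_equalityI) auto
    then show "tone n \<cdot> pure xs = pure xs"
      unfolding tone_def using tmult_pure_homogeneous[OF homogeneous_ones xs(2), of n] xs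
        cross_degree_zeros[of ds] list_all2_lengthD[OF xs(2)] by simp
  qed
  show "t \<cdot> tone n = t"
  proof (rule tlin_eq_homogeneous[OF tlin_mult_left[OF tlin_id] tlin_id assms])
    fix xs ds assume xs: "length xs = n" "homogeneous_list xs ds"
    have "map2 (*) xs (replicate n 1) = xs" using xs(1) by (intro nth_equalityI) auto
    then show "pure xs \<cdot> tone n = pure xs"
      unfolding tone_def using tmult_pure_homogeneous[OF xs(2) homogeneous_ones, of n] xs
        cross_degree_zeros[of ds] list_all2_lengthD[OF xs(2)] by simp
  qed
qed

lemma tone_add: "tone m \<otimes> tone n = tone (m + n)"
  by (simp add: tone_def tensor_prod_pure replicate_add)

lemma tensor_prod_tgrade:
  assumes "s \<in> tgrade m d" "t \<in> tgrade n e"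
  shows "s \<otimes> t \<in> tgrade (m + n) (d + e)"
proof (rule tlin_tgrade[OF _ subspace_tgrade assms(1)])
  fix xs ds assume xs: "length xs = m" "homogeneous_list xs ds" "sum_list ds = d"
  show "pure xs \<otimes> t \<in> tgrade (m + n) (d + e)"
  proof (rule tlin_tgrade[OF _ subspace_tgrade assms(2)])
    fix ys es assume ys: "length ys = n" "homogeneous_list ys es" "sum_list es = e"
    show "pure xs \<otimes> pure ys \<in> tgrade (m + n) (d + e)"
      unfolding tensor_prod_pure
      by (rule tgrade_base[of _ "ds @ es"]) (use xs ys in \<open>auto intro: list_all2_appendI\<close>)
  qed (rule tlin_tensor_prod_right[OF pure_in_tpower[OF xs(1)]])
qed (intro tlin_left tlin_id)

text \<open>
  For \<open>m = n = 1\<close> this is the defining rule of the graded product. Only the two inner blocks are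
  exchanged, so the outer ones may be inhomogeneous.
\<close>

lemma tmult_tensor_prod:
  assumes s: "s \<in> tpower m" and t: "t \<in> tgrade n d" and s': "s' \<in> tgrade m e" and t': "t' \<in> tpower n"
  shows "(s \<otimes> t) \<cdot> (s' \<otimes> t') = tscale (ksign (d * e)) ((s \<cdot> s') \<otimes> (t \<cdot> t'))"
proof (rule tlin_eq_homogeneous[OF _ _ t'])
  note mt = tgrade_tpower[OF t] and ms' = tgrade_tpower[OF s']
  note mst = tensor_prod_closed[OF s mt]
  show "tlin n tscale (\<lambda>t'. (s \<otimes> t) \<cdot> (s' \<otimes> t'))"
    by (rule tlin_mult_right[OF mst]) (auto intro: tlin_tensor_prod_right ms' tensor_prod_closed)
  show "tlin n tscale (\<lambda>t'. tscale (ksign (d * e)) ((s \<cdot> s') \<otimes> (t \<cdot> t')))"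
    by (rule tlin_compose_linear[OF linear_tscale], rule tlin_right[OF tmult_closed[OF s ms']])
      (auto intro: tlin_tmult_right tmult_closed mt)
  fix ys' fs' assume ys': "length ys' = n" "homogeneous_list ys' fs'"
  note my' = pure_in_tpower[OF ys'(1)]
  show "(s \<otimes> t) \<cdot> (s' \<otimes> pure ys') = tscale (ksign (d * e)) ((s \<cdot> s') \<otimes> (t \<cdot> pure ys'))"
  proof (rule tlin_eq_tgrade[OF _ _ s'])
    show "tlin m tscale (\<lambda>s'. (s \<otimes> t) \<cdot> (s' \<otimes> pure ys'))"
      by (rule tlin_mult_right[OF mst]) (auto intro: tlin_left tlin_id my' tensor_prod_closed)
    show "tlin m tscale (\<lambda>s'. tscale (ksign (d * e)) ((s \<cdot> s') \<otimes> (t \<cdot> pure ys')))"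
      by (intro tlin_compose_linear[OF linear_tscale] tlin_left tlin_tmult_right s)
    fix xs' es' assume xs': "length xs' = m" "homogeneous_list xs' es'" "sum_list es' = e"
    note mx' = pure_in_tpower[OF xs'(1)]
    show "(s \<otimes> t) \<cdot> (pure xs' \<otimes> pure ys') =
        tscale (ksign (d * e)) ((s \<cdot> pure xs') \<otimes> (t \<cdot> pure ys'))"
    proof (rule tlin_eq_tgrade[OF _ _ t])
      show "tlin n tscale (\<lambda>t. (s \<otimes> t) \<cdot> (pure xs' \<otimes> pure ys'))"
        by (intro tlin_mult_left tlin_tensor_prod_right[OF s])
      show "tlin n tscale (\<lambda>t. tscale (ksign (d * e)) ((s \<cdot> pure xs') \<otimes> (t \<cdot> pure ys')))"
        by (rule tlin_compose_linear[OF linear_tscale], rule tlin_right[OF tmult_closed[OF s mx']])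
          (auto intro: tlin_mult_left tlin_id tmult_closed my')
      fix ys fs assume ys: "length ys = n" "homogeneous_list ys fs" "sum_list fs = d"
      note my = pure_in_tpower[OF ys(1)]
      show "(s \<otimes> pure ys) \<cdot> (pure xs' \<otimes> pure ys') =
          tscale (ksign (d * e)) ((s \<cdot> pure xs') \<otimes> (pure ys \<cdot> pure ys'))"
      proof (rule tlin_eq_homogeneous[OF _ _ s])
        show "tlin m tscale (\<lambda>s. (s \<otimes> pure ys) \<cdot> (pure xs' \<otimes> pure ys'))"
          by (intro tlin_mult_left tlin_left tlin_id)
        show "tlin m tscale (\<lambda>s. tscale (ksign (d * e)) ((s \<cdot> pure xs') \<otimes> (pure ys \<cdot> pure ys')))"
          by (intro tlin_compose_linear[OF linear_tscale] tlin_left tlin_mult_left tlin_id)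
        fix xs es assume xs: "length xs = m" "homogeneous_list xs es"
        have len: "length es = length es'"
          using xs(2) xs'(2) xs(1) xs'(1) by (auto dest!: list_all2_lengthD)
        have "pure (xs @ ys) \<cdot> pure (xs' @ ys') = tscale (ksign (cross_degree (es @ fs) (es' @ fs')))
            (pure (map2 (*) (xs @ ys) (xs' @ ys')))"
          using xs xs' ys ys' by (intro tmult_pure_homogeneous) (auto intro: list_all2_appendI)
        also have "map2 (*) (xs @ ys) (xs' @ ys') = map2 (*) xs xs' @ map2 (*) ys ys'"
          using xs xs' by simp
        finally show "(pure xs \<otimes> pure ys) \<cdot> (pure xs' \<otimes> pure ys') =
            tscale (ksign (d * e)) ((pure xs \<cdot> pure xs') \<otimes> (pure ys \<cdot> pure ys'))"
          using tmult_pure_homogeneous[OF xs(2) xs'(2)] tmult_pure_homogeneous[OF ys(2) ys'(2)]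
            xs(1) xs'(1) ys(1,3) ys'(1) xs'(3)
          by (simp add: tensor_prod_pure cross_degree_append[OF len] ksign_add
              tensor_prod_tscale_left tensor_prod_tscale_right[of _ m _ n] pure_in_tpower tpower_tscale mult_ac)
      qed
    qed
  qed
qed

lemma tmult_tensor_prod_even_left:
  assumes "s \<in> tpower m" "t \<in> tgrade n 0" "s' \<in> tpower m" "t' \<in> tpower n"
  shows "(s \<otimes> t) \<cdot> (s' \<otimes> t') = (s \<cdot> s') \<otimes> (t \<cdot> t')"
proof (rule tlin_eq_homogeneous[OF _ _ assms(3)])
  note m = assms(1) tgrade_tpower[OF assms(2)] assms(4)
  show "tlin m tscale (\<lambda>s'. (s \<otimes> t) \<cdot> (s' \<otimes> t'))"
    by (rule tlin_mult_right[OF tensor_prod_closed[OF m(1,2)]])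
      (auto intro: tlin_left tlin_id tensor_prod_closed m)
  show "tlin m tscale (\<lambda>s'. (s \<cdot> s') \<otimes> (t \<cdot> t'))"
    by (intro tlin_left tlin_tmult_right m)
  fix xs ds assume xs: "length xs = m" "homogeneous_list xs ds"
  show "(s \<otimes> t) \<cdot> (pure xs \<otimes> t') = (s \<cdot> pure xs) \<otimes> (t \<cdot> t')"
    using tmult_tensor_prod[OF assms(1,2) tgrade_base[OF xs(2,1) refl] assms(4)] by simp
qed

lemma tmult_tensor_prod_even_right:
  assumes "s \<in> tpower m" "t \<in> tpower n" "s' \<in> tgrade m 0" "t' \<in> tpower n"
  shows "(s \<otimes> t) \<cdot> (s' \<otimes> t') = (s \<cdot> s') \<otimes> (t \<cdot> t')"
proof (rule tlin_eq_homogeneous[OF _ _ assms(2)])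
  note m = assms(1) tgrade_tpower[OF assms(3)] assms(4)
  show "tlin n tscale (\<lambda>t. (s \<otimes> t) \<cdot> (s' \<otimes> t'))"
    by (intro tlin_mult_left tlin_tensor_prod_right[OF m(1)])
  show "tlin n tscale (\<lambda>t. (s \<cdot> s') \<otimes> (t \<cdot> t'))"
    by (rule tlin_right[OF tmult_closed[OF m(1,2)]])
      (auto intro: tlin_mult_left tlin_id tmult_closed m)
  fix xs ds assume xs: "length xs = n" "homogeneous_list xs ds"
  show "(s \<otimes> pure xs) \<cdot> (s' \<otimes> t') = (s \<cdot> s') \<otimes> (pure xs \<cdot> t')"
    using tmult_tensor_prod[OF assms(1) tgrade_base[OF xs(2,1) refl] assms(3,4)] by simp
qed

section \<open>Homogeneous components of tensors\<close>

definition component :: "nat \<Rightarrow> bit \<Rightarrow> ('a, 'k) tensor \<Rightarrow> ('a, 'k) tensor" where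
  "component n d =
     lift (\<lambda>xs. \<Sum>ds | length ds = n \<and> sum_list ds = d. pure (map2 part ds xs))"

text \<open>
  Of the summands of the multilinear expansion of \<open>pure xs\<close>, only the one that matches the degrees
  of \<open>xs\<close> is nonzero. Projections are used instead of the parity automorphism, which is the
  identity in characteristic 2.
\<close>

lemma component_pure:
  assumes xs: "length xs = n" "homogeneous_list xs es"
  shows "component n d (pure xs) = (if sum_list es = d then pure xs else 0)"
proof -
  let ?D = "{ds :: bit list. length ds = n \<and> sum_list ds = d}"
  have "multilinear tscale n (\<lambda>xs. \<Sum>ds\<in>?D. pure (map2 part ds xs))"
  proof (intro multilinear_sum multilinear_slot)
    fix ds :: "bit list" and xs :: "'a list" and i assume *: "ds \<in> ?D" "length xs = n" "i < n"
    have "map2 part ds (xs[i := x]) = (map2 part ds xs)[i := part (ds ! i) x]" for x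
      using * by (auto intro!: nth_equalityI simp: nth_list_update)
    then show "\<exists>l. Vector_Spaces.linear scale scale l \<and>
        (\<forall>x. map2 part ds (xs[i := x]) = (map2 part ds xs)[i := l x])"
      using part_linear by blast
  qed auto
  then have "component n d (pure xs) = (\<Sum>ds\<in>?D. pure (map2 part ds xs))"
    unfolding component_def by (rule lift_pure) fact
  also have "\<dots> = (\<Sum>ds\<in>?D. if ds = es then pure xs else 0)"
  proof (rule sum.cong[OF refl])
    fix ds assume ds: "ds \<in> ?D"
    have len: "length es = n" using xs list_all2_lengthD by fastforce
    have p: "part d (xs ! i) = (if d = es ! i then xs ! i else 0)" if "i < n" for i d
      using xs that by (intro part_homogeneous) (auto simp: list_all2_conv_all_nth)
    show "pure (map2 part ds xs) = (if ds = es then pure xs else 0)"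
    proof (cases "ds = es")
      case True
      then have "map2 part ds xs = xs" using xs len p by (intro nth_equalityI) auto
      with True show ?thesis by simp
    next
      case False
      then obtain i where i: "i < n" "ds ! i \<noteq> es ! i" using ds len by (auto simp: list_eq_iff_nth_eq)
      then have "map2 part ds xs ! i = 0" using ds xs p by simp
      moreover have "i < length (map2 part ds xs)" using i(1) ds xs by simp
      ultimately have "0 \<in> set (map2 part ds xs)" by (metis nth_mem)
      with False show ?thesis by (simp add: pure_zero)
    qed
  qed
  also have "\<dots> = (if sum_list es = d then pure xs else 0)"
  proof -
    have "finite {ds :: bit list. set ds \<subseteq> {0, 1} \<and> length ds = n}"
      by (rule finite_lists_length_eq) simp
    then have "finite ?D" by (rule rev_finite_subset) auto
    then show ?thesis using xs list_all2_lengthD[OF xs(2)] by simp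
  qed
  finally show ?thesis .
qed

lemma linear_component: "Vector_Spaces.linear tscale tscale (component n d)"
  unfolding component_def by (rule linear_lift)

lemma component_tgrade:
  assumes "t \<in> tpower n" shows "component n d t \<in> tgrade n d"
proof (rule tlin_tpower_homogeneous[OF linear_imp_tlin[OF linear_component] subspace_tgrade assms])
  fix xs ds assume xs: "length xs = n" "homogeneous_list xs ds"
  show "component n d (pure xs) \<in> tgrade n d"
    unfolding component_pure[OF xs]
    using tgrade_base[OF xs(2,1)] tensor.subspace_0[OF subspace_tgrade] by auto
qed

lemma component_sum:
  assumes "t \<in> tpower n" shows "component n 0 t + component n 1 t = t"
proof (rule tlin_eq_homogeneous[OF _ tlin_id assms])
  show "tlin n tscale (\<lambda>t. component n 0 t + component n 1 t)"
    using linear_component[of n 0] linear_component[of n 1]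
    by (simp add: tlin_def Vector_Spaces.linear_iff tensor.scale_right_distrib add_ac)
  fix xs ds assume xs: "length xs = n" "homogeneous_list xs ds"
  show "component n 0 (pure xs) + component n 1 (pure xs) = pure xs"
    unfolding component_pure[OF xs] by (cases "sum_list ds") simp_all
qed

lemma component_homogeneous:
  assumes "t \<in> tgrade n e" shows "component n d t = (if d = e then t else 0)"
proof (rule tlin_eq_tgrade[OF linear_imp_tlin[OF linear_component] _ assms,
      where h' = "\<lambda>t. if d = e then t else 0"])
  show "tlin n tscale (\<lambda>t. if d = e then t else 0)"
    by (simp add: tlin_def)
  fix xs ds assume xs: "length xs = n" "homogeneous_list xs ds" "sum_list ds = e"
  show "component n d (pure xs) = (if d = e then pure xs else 0)"
    unfolding component_pure[OF xs(1,2)] xs(3) by simp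
qed

lemma tgrade_disjoint: "t \<in> tgrade n d \<Longrightarrow> t \<in> tgrade n e \<Longrightarrow> d \<noteq> e \<Longrightarrow> t = 0"
  using component_homogeneous by metis

section \<open>Inverses\<close>

lemma is_tinv_unique:
  assumes "t \<in> tpower n" "is_tinv n t s" "is_tinv n t s'"
  shows "s = s'"
proof -
  have s: "s \<in> tpower n" "s \<cdot> t = tone n" and s': "s' \<in> tpower n" "t \<cdot> s' = tone n"
    using assms by (auto simp: is_tinv_def)
  have "s = s \<cdot> (t \<cdot> s')" using s s' by (simp add: tmult_tone)
  also have "\<dots> = s'"
    using s s' tmult_assoc[OF s(1) assms(1) s'(1)] by (simp add: tmult_tone)
  finally show ?thesis .
qed

lemma tinv_eq: "t \<in> tpower n \<Longrightarrow> is_tinv n t s \<Longrightarrow> tinv n t = s"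
  unfolding tinv_def using is_tinv_unique by (intro the_equality) auto

lemma is_tinv_tinv: "tinvertible n t \<Longrightarrow> is_tinv n t (tinv n t)"
  unfolding tinvertible_def using tinv_eq by auto

lemma tinvertible_tinv:
  assumes "tinvertible n t"
  shows "t \<in> tpower n" "tinv n t \<in> tpower n" "t \<cdot> tinv n t = tone n" "tinv n t \<cdot> t = tone n"
  using is_tinv_tinv[OF assms] assms by (auto simp: is_tinv_def tinvertible_def)

text \<open>
  If \<open>s\<close> is the inverse of \<open>t\<close>, then comparing odd parts in \<open>t \<cdot> s = 1\<close> shows that \<open>t\<close> kills the odd part
  of \<open>s\<close>, which therefore vanishes.
\<close>

lemma tinv_even:
  assumes t: "t \<in> tgrade n 0" and inv: "tinvertible n t"
  shows "tinv n t \<in> tgrade n 0"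
proof -
  let ?inv = "tinv n t" and ?odd = "component n 1 (tinv n t)" and ?even = "component n 0 (tinv n t)"
  note s = tinvertible_tinv[OF inv]
  have m: "?even \<in> tgrade n 0" "?odd \<in> tgrade n 1" using s(2) by (rule component_tgrade)+
  have "tone n = t \<cdot> ?even + t \<cdot> ?odd"
    using s(3) component_sum[OF s(2)]
      tlin_add[OF tlin_tmult_right[OF s(1)] m(1)[THEN tgrade_tpower] m(2)[THEN tgrade_tpower]]
    by simp
  then have "component n 1 (tone n) = component n 1 (t \<cdot> ?even) + component n 1 (t \<cdot> ?odd)"
    using linear_component[of n 1] by (simp add: Vector_Spaces.linear_iff)
  then have "t \<cdot> ?odd = 0"
    using component_homogeneous[OF tone_tgrade, of n 1]
      component_homogeneous[OF tmult_tgrade[OF t m(1)], of 1]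
      component_homogeneous[OF tmult_tgrade[OF t m(2)], of 1] by simp
  then have "?inv \<cdot> (t \<cdot> ?odd) = 0" by (simp only: tlin_zero[OF tlin_tmult_right[OF s(2)]])
  then have "?odd = 0"
    unfolding tmult_assoc[OF s(2,1) tgrade_tpower[OF m(2)], symmetric] s(4)
    by (simp add: tmult_tone(1)[OF tgrade_tpower[OF m(2)]])
  then have "?even = ?inv" using component_sum[OF s(2)] by simp
  then show ?thesis using m(1) by simp
qed

section \<open>Even maps\<close>

definition even_map :: "('a \<Rightarrow> ('a, 'k) tensor) \<Rightarrow> nat \<Rightarrow> bool" where
  "even_map f n \<longleftrightarrow> graded_linear f n \<and> (\<forall>d. \<forall>x\<in>grade d. f x \<in> tgrade n d)"

definition even_hom :: "('a \<Rightarrow> ('a, 'k) tensor) \<Rightarrow> nat \<Rightarrow> bool" where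
  "even_hom f n \<longleftrightarrow> even_map f n \<and> f 1 = tone n \<and> (\<forall>x y. f (x * y) = f x \<cdot> f y)"

lemma even_map_graded_linear: "list_all2 even_map fs ns \<Longrightarrow> list_all2 graded_linear fs ns"
  by (erule list_all2_mono) (simp add: even_map_def)

lemma even_hom_even_map: "list_all2 even_hom fs ns \<Longrightarrow> list_all2 even_map fs ns"
  by (erule list_all2_mono) (simp add: even_hom_def)

lemma tmap_tgrade:
  assumes "list_all2 even_map fs ns" "t \<in> tgrade (length fs) d"
  shows "tmap fs t \<in> tgrade (sum_list ns) d"
proof (rule tlin_tgrade[OF linear_imp_tlin[OF linear_tmap] subspace_tgrade assms(2)])
  fix xs ds assume xs: "length xs = length fs" "homogeneous_list xs ds" "sum_list ds = d"
  show "tmap fs (pure xs) \<in> tgrade (sum_list ns) d"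
    using assms(1) xs
  proof (induction fs ns arbitrary: xs ds d rule: list_all2_induct)
    case Nil
    then show ?case using tone_tgrade[of 0] by (simp add: tone_def)
  next
    case (Cons f fs n ns)
    then obtain y ys e es where *: "xs = y # ys" "ds = e # es" by (cases xs; cases ds) auto
    have "tmap (f # fs) (pure (y # ys)) = f y \<otimes> tmap fs (pure ys)"
      by (rule tmap_Cons[OF even_map_graded_linear]) (use Cons * in auto)
    moreover have "f y \<in> tgrade n e" "tmap fs (pure ys) \<in> tgrade (sum_list ns) (sum_list es)"
      using Cons * by (auto simp: even_map_def)
    ultimately show ?case using Cons.prems * by (auto intro: tensor_prod_tgrade)
  qed
qed

text \<open>
  Splitting off the first factor of both lists produces the sign of one exchange. An even
  homomorphism preserves the degrees, so the same sign reappears when the images are recombined.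
\<close>

lemma tmap_tmult_pure:
  assumes "list_all2 even_hom fs ns" "homogeneous_list xs ds" "homogeneous_list ys es"
    and "length xs = length fs" "length ys = length fs"
  shows "tmap fs (pure xs \<cdot> pure ys) = tmap fs (pure xs) \<cdot> tmap fs (pure ys)"
  using assms
proof (induction fs ns arbitrary: xs ds ys es rule: list_all2_induct)
  case Nil
  then show ?case using tmult_tone(1)[OF tone_tpower[of 0]] by (simp add: tone_def)
next
  case (Cons f fs n ns)
  obtain x xs' d ds' where x: "xs = x # xs'" "ds = d # ds'" using Cons.prems by (cases xs; cases ds) auto
  obtain y ys' e es' where y: "ys = y # ys'" "es = e # es'" using Cons.prems by (cases ys; cases es) auto
  have hx: "x \<in> grade d" "homogeneous_list xs' ds'" "length xs' = length fs"
    and hy: "y \<in> grade e" "homogeneous_list ys' es'" "length ys' = length fs"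
    using Cons.prems x y by auto
  let ?T = "tmap fs"
  note ev = even_hom_even_map[OF Cons.hyps(2)]
  note gl = even_map_graded_linear[OF ev]
  have f: "graded_linear f n" "f x \<in> tgrade n d" "f y \<in> tgrade n e" "f (x * y) = f x \<cdot> f y"
    using Cons.hyps(1) hx hy by (auto simp: even_hom_def even_map_def)
  have m: "pure xs' \<in> tgrade (length fs) (sum_list ds')" "pure ys' \<in> tgrade (length fs) (sum_list es')"
    using hx hy by (auto intro: tgrade_base)
  note mp = m[THEN tgrade_tpower] and mT = tmap_tgrade[OF ev m(1)] tmap_tgrade[OF ev m(2)]
  have T: "tmap (f # fs) (emb z \<otimes> t) = f z \<otimes> ?T t" if "t \<in> tpower (length fs)" for z t
    using tmap_tensor_prod[of "[f]" "[n]" fs ns "emb z" t] that f(1) gl emb_in_tpower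
    by (simp add: tmap_emb_singleton)
  have ep: "pure (z # zs) = emb z \<otimes> pure zs" for z zs
    by (simp add: emb_def tensor_prod_pure)
  have "emb x \<cdot> emb y = emb (x * y)"
    using tmult_pure_homogeneous[of "[x]" "[d]" "[y]" "[e]"] hx hy by (simp add: emb_def)
  then have "pure xs \<cdot> pure ys =
      tscale (ksign (sum_list ds' * e)) (emb (x * y) \<otimes> (pure xs' \<cdot> pure ys'))"
    using tmult_tensor_prod[OF emb_in_tpower m(1) grade_emb[OF hy(1)] mp(2)] by (simp add: x y ep)
  then have "tmap (f # fs) (pure xs \<cdot> pure ys) =
      tscale (ksign (sum_list ds' * e)) (tmap (f # fs) (emb (x * y) \<otimes> (pure xs' \<cdot> pure ys')))"
    using linear_tmap by (simp add: Vector_Spaces.linear_iff)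
  also have "tmap (f # fs) (emb (x * y) \<otimes> (pure xs' \<cdot> pure ys')) = (f x \<cdot> f y) \<otimes> (?T (pure xs') \<cdot> ?T (pure ys'))"
    using T tmult_closed[OF mp] Cons.IH[OF hx(2) hy(2) hx(3) hy(3)] f(4) by simp
  also have "tscale (ksign (sum_list ds' * e)) \<dots> = (f x \<otimes> ?T (pure xs')) \<cdot> (f y \<otimes> ?T (pure ys'))"
    using tmult_tensor_prod[OF tgrade_tpower[OF f(2)] mT(1) f(3) tgrade_tpower[OF mT(2)]] by simp
  finally show ?case using T mp by (simp add: x y ep)
qed

lemma tmap_tmult:
  assumes fs: "list_all2 even_hom fs ns" and s: "s \<in> tpower (length fs)" and t: "t \<in> tpower (length fs)"
  shows "tmap fs (s \<cdot> t) = tmap fs s \<cdot> tmap fs t"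
proof (rule tlin_eq_homogeneous[OF _ _ t])
  note closed = tmap_closed[OF even_map_graded_linear[OF even_hom_even_map[OF fs]]]
  show "tlin (length fs) tscale (\<lambda>t. tmap fs (s \<cdot> t))"
    by (intro tlin_tmap tlin_tmult_right s)
  show "tlin (length fs) tscale (\<lambda>t. tmap fs s \<cdot> tmap fs t)"
    by (rule tlin_mult_right[OF closed[OF s]]) (auto intro: tlin_tmap tlin_id closed)
  fix ys es assume ys: "length ys = length fs" "homogeneous_list ys es"
  show "tmap fs (s \<cdot> pure ys) = tmap fs s \<cdot> tmap fs (pure ys)"
    by (rule tlin_eq_homogeneous[OF _ _ s])
      (use tmap_tmult_pure[OF fs _ ys(2) _ ys(1)] in
        \<open>auto intro!: tlin_tmap tlin_mult_left tlin_id\<close>)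
qed

lemma tmap_tone:
  assumes "list_all2 even_hom fs ns"
  shows "tmap fs (tone (length fs)) = tone (sum_list ns)"
  using assms
proof (induction fs ns rule: list_all2_induct)
  case Nil
  then show ?case by (simp add: tone_def)
next
  case (Cons f fs n ns)
  have "list_all2 graded_linear (f # fs) (n # ns)"
    using Cons.hyps by (intro even_map_graded_linear even_hom_even_map) auto
  then have "tmap (f # fs) (tone (length (f # fs))) = f 1 \<otimes> tmap fs (tone (length fs))"
    using tmap_Cons[of f fs n ns "replicate (length fs) 1" 1] by (simp add: tone_def)
  then show ?case using Cons by (simp add: even_hom_def tone_add)
qed

lemma even_hom_emb: "even_hom emb 1"
proof -
  have "emb (x * y) = emb x \<cdot> emb y" for x y
  proof -
    have hom: "emb (x * y) = emb x \<cdot> emb y" if "x \<in> grade d" "y \<in> grade e" for x y d e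
      using tmult_pure_homogeneous[of "[x]" "[d]" "[y]" "[e]"] that by (simp add: emb_def)
    obtain x0 x1 where x: "x0 \<in> grade 0" "x1 \<in> grade 1" "x = x0 + x1" using grade_sum by blast
    obtain y0 y1 where y: "y0 \<in> grade 0" "y1 \<in> grade 1" "y = y0 + y1" using grade_sum by blast
    have [simp]: "emb (u + v) = emb u + emb v" for u v
      using linear_emb by (simp add: Vector_Spaces.linear_iff)
    have [simp]: "(u + v) \<cdot> w = u \<cdot> w + v \<cdot> w" for u v w
      using linear_tmult_left by (simp add: Vector_Spaces.linear_iff)
    have [simp]: "emb w \<cdot> (emb u + emb v) = emb w \<cdot> emb u + emb w \<cdot> emb v" for u v w
      by (rule tlin_add[OF tlin_tmult_right[OF emb_in_tpower] emb_in_tpower emb_in_tpower])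
    show ?thesis
      using hom[OF x(1) y(1)] hom[OF x(1) y(2)] hom[OF x(2) y(1)] hom[OF x(2) y(2)]
      by (simp add: x(3) y(3) distrib_left distrib_right add_ac)
  qed
  then show ?thesis
    using graded_linear_emb grade_emb by (auto simp: even_hom_def even_map_def tone_def emb_def)
qed

end

context superalgebra
begin

section \<open>Conjugation by even tensors\<close>

lemma emb_one: "emb 1 = tone 1"
  by (simp add: emb_def tone_def)

lemma tone_zero: "tone 0 = pure []"
  by (simp add: tone_def)

text \<open>
  Inserting \<open>P \<cdot> f a \<cdot> P'\<close> for \<open>f a\<close> in one slot multiplies by \<open>1 \<otimes> P \<otimes> 1\<close> and \<open>1 \<otimes> P' \<otimes> 1\<close>. Evenness of
  \<open>P\<close> and \<open>P'\<close> removes the signs of moving them past the neighbouring slots. It is used with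
  \<open>P = F\<close> for the twisted comultiplication and with \<open>P' = \<Phi>\<close> for quasi-coassociativity.
\<close>

lemma tmap_conj:
  assumes fs: "list_all2 graded_linear fs ms" and gs: "list_all2 graded_linear gs ns"
    and f: "graded_linear f n" and P: "P \<in> tgrade n 0" "P' \<in> tgrade n 0"
    and t: "t \<in> tpower (length fs + (1 + length gs))"
  shows "tmap (fs @ [\<lambda>a. P \<cdot> f a \<cdot> P'] @ gs) t =
    (tone (sum_list ms) \<otimes> P \<otimes> tone (sum_list ns)) \<cdot> tmap (fs @ [f] @ gs) t \<cdot>
    (tone (sum_list ms) \<otimes> P' \<otimes> tone (sum_list ns))"
proof -
  let ?k = "sum_list ms" and ?l = "sum_list ns" and ?g = "\<lambda>a. P \<cdot> f a \<cdot> P'"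
  have m: "tone ?k \<in> tpower ?k" "tone ?l \<in> tgrade ?l 0" "tone ?l \<in> tpower ?l" "tone ?k \<in> tgrade ?k 0"
    "P \<in> tpower n" "P' \<in> tpower n"
    using P tgrade_tpower by (auto intro: tone_tpower tone_tgrade)
  have P1: "P \<otimes> tone ?l \<in> tgrade (n + ?l) 0" "P' \<otimes> tone ?l \<in> tpower (n + ?l)"
    using tensor_prod_tgrade[OF P(1) m(2)] by (auto intro: tensor_prod_closed m)
  have g: "graded_linear ?g n"
  proof -
    have "?g a \<in> tpower n" for a using f m by (auto simp: graded_linear_def intro: tmult_closed)
    moreover have "P \<cdot> (f a + f b) = P \<cdot> f a + P \<cdot> f b" "P \<cdot> tscale c (f a) = tscale c (P \<cdot> f a)" for a b c
      using tlin_add[OF tlin_tmult_right[OF m(5)]] tlin_scale[OF tlin_tmult_right[OF m(5)]] f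
      by (auto simp: graded_linear_def)
    moreover have "(u + v) \<cdot> P' = u \<cdot> P' + v \<cdot> P'" for u v
      using linear_tmult_left by (simp add: Vector_Spaces.linear_iff)
    ultimately show ?thesis
      using f by (auto simp: graded_linear_def Vector_Spaces.linear_iff tmult_tscale_left)
  qed
  have split: "tmap (fs @ [h] @ gs) (pure (xs @ [y] @ zs)) = tmap fs (pure xs) \<otimes> h y \<otimes> tmap gs (pure zs)"
    if h: "graded_linear h n" and len: "length xs = length fs" "length zs = length gs" for h xs y zs
  proof -
    have "list_all2 graded_linear (h # gs) (n # ns)" using h gs by simp
    from tmap_append_pure[OF fs this len(1), of "y # zs"] tmap_Cons[OF this len(2)]
    show ?thesis using len(2) by simp
  qed
  show ?thesis
  proof (rule tlin_eq[OF _ _ _ t])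
    show "tlin (length fs + (1 + length gs)) tscale (tmap (fs @ [?g] @ gs))"
      by (rule linear_imp_tlin[OF linear_tmap])
    have gl: "list_all2 graded_linear (fs @ [f] @ gs) (ms @ [n] @ ns)"
      using fs gs f by (auto intro: list_all2_appendI)
    have "tmap (fs @ [f] @ gs) t \<in> tpower (?k + (n + ?l))" if "t \<in> tpower (length fs + (1 + length gs))" for t
      using tmap_closed[OF gl, of t] that by (simp add: add_ac)
    then show "tlin (length fs + (1 + length gs)) tscale (\<lambda>t. (tone ?k \<otimes> P \<otimes> tone ?l) \<cdot> tmap (fs @ [f] @ gs) t \<cdot>
        (tone ?k \<otimes> P' \<otimes> tone ?l))"
      by (intro tlin_mult_left tlin_mult_right[OF tensor_prod_closed[OF m(1) tgrade_tpower[OF P1(1)]]]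
          linear_imp_tlin[OF linear_tmap])
    fix ws :: "'a list" assume ws: "length ws = length fs + (1 + length gs)"
    define xs y zs where "xs = take (length fs) ws" "y = ws ! length fs" "zs = drop (Suc (length fs)) ws"
    have len: "length xs = length fs" "length zs = length gs" and ws_eq: "ws = xs @ [y] @ zs"
      using ws by (auto simp: xs_y_zs_def id_take_nth_drop)
    let ?A = "tmap fs (pure xs)" and ?C = "tmap gs (pure zs)"
    have M: "?A \<in> tpower ?k" "f y \<in> tpower n" "?C \<in> tpower ?l"
      using f tmap_closed[OF fs pure_in_tpower[OF len(1)]] tmap_closed[OF gs pure_in_tpower[OF len(2)]]
      by (auto simp: graded_linear_def)
    have "(tone ?k \<otimes> P \<otimes> tone ?l) \<cdot> (?A \<otimes> f y \<otimes> ?C) = ?A \<otimes> (P \<cdot> f y) \<otimes> ?C"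
      using tmult_tensor_prod_even_left[OF m(1) P1(1) M(1) tensor_prod_closed[OF M(2,3)]]
        tmult_tensor_prod_even_left[OF m(5) m(2) M(2,3)] M by (simp add: tmult_tone)
    moreover have "(?A \<otimes> (P \<cdot> f y) \<otimes> ?C) \<cdot> (tone ?k \<otimes> P' \<otimes> tone ?l) = ?A \<otimes> ?g y \<otimes> ?C"
      using tmult_tensor_prod_even_right[OF M(1) tensor_prod_closed[OF tmult_closed[OF m(5) M(2)] M(3)] m(4) P1(2)]
        tmult_tensor_prod_even_right[OF tmult_closed[OF m(5) M(2)] M(3) P(2) m(3)] M by (simp add: tmult_tone)
    ultimately show "tmap (fs @ [?g] @ gs) (pure ws) = (tone ?k \<otimes> P \<otimes> tone ?l) \<cdot> tmap (fs @ [f] @ gs) (pure ws) \<cdot>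
        (tone ?k \<otimes> P' \<otimes> tone ?l)"
      unfolding ws_eq split[OF g len] split[OF f len] by simp
  qed
qed

lemma tmult_cancel:
  assumes "x \<cdot> y = tone n" "x \<in> tpower n" "y \<in> tpower n" "u \<in> tpower n"
  shows "x \<cdot> (y \<cdot> u) = u"
  using assms tmult_assoc[OF assms(2-4)] by (simp add: tmult_tone)

lemma tensor_prod_inverse:
  assumes "s \<cdot> s' = tone m" "t \<cdot> t' = tone n" "s \<in> tgrade m 0" "t \<in> tgrade n 0"
    "s' \<in> tgrade m 0" "t' \<in> tgrade n 0"
  shows "(s \<otimes> t) \<cdot> (s' \<otimes> t') = tone (m + n)"
  using assms tmult_tensor_prod_even_left[of s m t n s' t'] by (simp add: tgrade_tpower tone_add)

end

section \<open>Evenness of associators and twists\<close>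

text \<open>
  From here on the exponents of the tensor powers are numerals, so \<open>1\<close> must not become \<open>Suc 0\<close>.
\<close>

declare One_nat_def [simp del]

lemma Suc_small_numerals: "Suc 0 = 1" "Suc 1 = 2" "Suc 2 = 3" "Suc 3 = 4"
  by simp_all

context graded_quasi_bialgebra
begin

lemma even_hom_comult: "even_hom \<Delta> 2"
  using comult_linear comult_in_tpower comult_grade comult_one comult_mult
  by (simp add: even_hom_def even_map_def graded_linear_def)

lemma even_hom_counit: "even_hom (of_form \<epsilon>) 0"
proof -
  have "of_form \<epsilon> x \<in> tgrade 0 d" if "x \<in> grade d" for x d
  proof (cases "d = 0")
    case True
    then show ?thesis
      using tone_tgrade[of 0] by (simp add: of_form_def tgrade_tscale tone_zero)
  next
    case False
    then show ?thesis
      using that counit_odd tensor.subspace_0[OF subspace_tgrade] by (simp add: of_form_def)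
  qed
  moreover have "of_form \<epsilon> (x * y) = of_form \<epsilon> x \<cdot> of_form \<epsilon> y" for x y
    using tmult_tone(1)[OF tone_tpower[of 0]]
    by (simp add: of_form_def counit_mult tmult_tscale_left tmult_tscale_right[of _ 0] tone_tpower flip: tone_zero)
  ultimately show ?thesis
    using graded_linear_of_form[OF counit_linear]
    by (auto simp: even_hom_def even_map_def of_form_def counit_one tone_zero)
qed

text \<open>
  The counit reduces the unit of \<open>A \<otimes> A\<close> to the unit of \<open>A\<close>.
\<close>

lemma tone_nonzero:
  assumes "n \<in> {1, 2}" shows "tone n \<noteq> 0"
proof -
  have "emb 1 \<noteq> emb 0" by (metis unemb_emb zero_neq_one)
  moreover have "emb 0 = 0" by (simp add: emb_def pure_zero)
  ultimately have 1: "tone 1 \<noteq> 0" by (simp add: emb_one)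
  have "tmap [of_form \<epsilon>, emb] (tone 2) = tone 1"
    using tmap_tone[of "[of_form \<epsilon>, emb]" "[0, 1]"] even_hom_counit even_hom_emb
    by (simp add: Suc_small_numerals)
  moreover have "tmap [of_form \<epsilon>, emb] 0 = 0"
    using tlin_zero[OF linear_imp_tlin[OF linear_tmap]] .
  ultimately show ?thesis using 1 assms by auto
qed

text \<open>
  An even map sends an odd \<open>t\<close> to an odd tensor, but the unit is even and nonzero, and only \<open>0\<close> is both
  even and odd.
\<close>

lemma normalised_even:
  assumes "list_all2 even_hom fs ns" "thomogeneous (length fs) t" "tmap fs t = tone (sum_list ns)"
    and "sum_list ns \<in> {1, 2}"
  shows "t \<in> tgrade (length fs) 0"
proof -
  obtain d where d: "t \<in> tgrade (length fs) d" using assms(2) by (auto simp: thomogeneous_def)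
  have "tone (sum_list ns) \<in> tgrade (sum_list ns) d"
    using tmap_tgrade[OF even_hom_even_map[OF assms(1)] d] assms(3) by simp
  then have "d = 0"
    using tgrade_disjoint[OF _ tone_tgrade] tone_nonzero[OF assms(4)] by blast
  with d show ?thesis by simp
qed

lemma assoc_even: "\<Phi> \<in> tgrade 3 0"
  using normalised_even[of "[emb, of_form \<epsilon>, emb]" "[1, 0, 1]" \<Phi>] assoc_homogeneous counit_assoc
    even_hom_emb even_hom_counit
  by (simp add: Suc_small_numerals)

lemma twist_even:
  assumes "gauge_transformation \<epsilon> F" shows "F \<in> tgrade 2 0"
  using normalised_even[of "[of_form \<epsilon>, emb]" "[0, 1]" F] assms even_hom_emb even_hom_counit
  by (simp add: gauge_transformation_def Suc_small_numerals)

lemmas even_homs = even_hom_emb even_hom_comult even_hom_counit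

lemma graded_linear_emb_comult_counit:
  "graded_linear emb 1" "graded_linear \<Delta> 2" "graded_linear (of_form \<epsilon>) 0"
  using even_homs by (simp_all add: even_hom_def even_map_def)

lemma tmap_comult_tpower:
  assumes "s \<in> tpower 2"
  shows "tmap [\<Delta>, emb] s \<in> tpower 3" "tmap [emb, \<Delta>] s \<in> tpower 3"
  using tmap_closed[of "[\<Delta>, emb]" "[2, 1]" s] tmap_closed[of "[emb, \<Delta>]" "[1, 2]" s] assms
    graded_linear_emb_comult_counit by (simp_all add: Suc_small_numerals)

lemma tmap_counit_tpower:
  assumes "s \<in> tpower 2"
  shows "tmap [of_form \<epsilon>, emb] s \<in> tpower 1" "tmap [emb, of_form \<epsilon>] s \<in> tpower 1"
  using tmap_closed[of "[of_form \<epsilon>, emb]" "[0, 1]" s] tmap_closed[of "[emb, of_form \<epsilon>]" "[1, 0]" s]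
    graded_linear_emb_comult_counit assms by (simp_all add: Suc_small_numerals)

end

section \<open>The twisted quasi-bialgebra\<close>

locale twisted_quasi_bialgebra = graded_quasi_bialgebra scale grade \<Delta> \<epsilon> \<Phi>
  for scale :: "'k::field \<Rightarrow> 'a::ring_1 \<Rightarrow> 'a" (infixr \<open>*s\<close> 75)
    and grade :: "bit \<Rightarrow> 'a set"
    and \<Delta> :: "'a \<Rightarrow> ('a, 'k) tensor"
    and \<epsilon> :: "'a \<Rightarrow> 'k"
    and \<Phi> :: "('a, 'k) tensor" +
  fixes F :: "('a, 'k) tensor"
  assumes gauge: "gauge_transformation \<epsilon> F"
begin

abbreviation "G \<equiv> tinv 2 F"
abbreviation "\<Psi> \<equiv> tinv 3 \<Phi>"
abbreviation "\<Delta>F \<equiv> twist_comult F \<Delta>"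
abbreviation "\<Phi>F \<equiv> twist_assoc F \<Delta> \<Phi>"
abbreviation "\<Psi>F \<equiv> (tone 1 \<otimes> F) \<cdot> tmap [emb, \<Delta>] F \<cdot> \<Psi> \<cdot> tmap [\<Delta>, emb] G \<cdot> (G \<otimes> tone 1)"

lemma twist_inverse: "F \<cdot> G = tone 2" "G \<cdot> F = tone 2"
  using tinvertible_tinv[of 2 F] gauge by (simp_all add: gauge_transformation_def)

lemma assoc_inverse: "\<Phi> \<cdot> \<Psi> = tone 3" "\<Psi> \<cdot> \<Phi> = tone 3"
  using tinvertible_tinv[OF assoc_invertible] by simp_all

lemma even: "F \<in> tgrade 2 0" "G \<in> tgrade 2 0" "\<Phi> \<in> tgrade 3 0" "\<Psi> \<in> tgrade 3 0"
proof -
  show "F \<in> tgrade 2 0" "\<Phi> \<in> tgrade 3 0" using gauge by (rule twist_even) (rule assoc_even)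
  then show "G \<in> tgrade 2 0" "\<Psi> \<in> tgrade 3 0"
    using gauge assoc_invertible by (auto intro: tinv_even simp: gauge_transformation_def)
qed

lemmas mem = even[THEN tgrade_tpower]

lemma comult_pair_even:
  assumes "s \<in> tgrade 2 0"
  shows "tmap [\<Delta>, emb] s \<in> tgrade 3 0" "tmap [emb, \<Delta>] s \<in> tgrade 3 0"
  using tmap_tgrade[of "[\<Delta>, emb]" "[2, 1]" s] tmap_tgrade[of "[emb, \<Delta>]" "[1, 2]" s] assms
    even_homs by (simp_all add: Suc_small_numerals even_hom_def)

lemma comult_pair_mult:
  assumes "s \<in> tpower 2" "t \<in> tpower 2"
  shows "tmap [\<Delta>, emb] (s \<cdot> t) = tmap [\<Delta>, emb] s \<cdot> tmap [\<Delta>, emb] t"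
    "tmap [emb, \<Delta>] (s \<cdot> t) = tmap [emb, \<Delta>] s \<cdot> tmap [emb, \<Delta>] t"
  using tmap_tmult[of "[\<Delta>, emb]" "[2, 1]" s t] tmap_tmult[of "[emb, \<Delta>]" "[1, 2]" s t] assms
    even_homs by (simp_all add: Suc_small_numerals)

lemma comult_pair_tone: "tmap [\<Delta>, emb] (tone 2) = tone 3" "tmap [emb, \<Delta>] (tone 2) = tone 3"
  using tmap_tone[of "[\<Delta>, emb]" "[2, 1]"] tmap_tone[of "[emb, \<Delta>]" "[1, 2]"] even_homs
  by (simp_all add: Suc_small_numerals)

lemma tone_pad:
  assumes "s \<in> tgrade m 0"
  shows "s \<otimes> tone n \<in> tgrade (m + n) 0" "tone n \<otimes> s \<in> tgrade (n + m) 0"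
  using tensor_prod_tgrade[OF assms tone_tgrade[of n]] tensor_prod_tgrade[OF tone_tgrade[of n] assms] by simp_all

lemma pad_mem3:
  assumes "s \<in> tpower 2"
  shows "s \<otimes> tone 1 \<in> tpower 3" "tone 1 \<otimes> s \<in> tpower 3"
  using tensor_prod_closed[OF assms tone_tpower[of 1]] tensor_prod_closed[OF tone_tpower[of 1] assms]
  by simp_all

lemma pad_inverse3: "(F \<otimes> tone 1) \<cdot> (G \<otimes> tone 1) = tone 3" "(G \<otimes> tone 1) \<cdot> (F \<otimes> tone 1) = tone 3"
  "(tone 1 \<otimes> F) \<cdot> (tone 1 \<otimes> G) = tone 3" "(tone 1 \<otimes> G) \<cdot> (tone 1 \<otimes> F) = tone 3"
  using tensor_prod_inverse[of F G 2 "tone 1" "tone 1" 1] tensor_prod_inverse[of G F 2 "tone 1" "tone 1" 1]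
   tensor_prod_inverse[of "tone 1" "tone 1" 1 F G 2] tensor_prod_inverse[of "tone 1" "tone 1" 1 G F 2]
   twist_inverse even tone_tgrade tmult_tone[OF tone_tpower] by simp_all

lemma comult_pair_inverse:
  "tmap [\<Delta>, emb] F \<cdot> tmap [\<Delta>, emb] G = tone 3" "tmap [\<Delta>, emb] G \<cdot> tmap [\<Delta>, emb] F = tone 3"
  "tmap [emb, \<Delta>] F \<cdot> tmap [emb, \<Delta>] G = tone 3" "tmap [emb, \<Delta>] G \<cdot> tmap [emb, \<Delta>] F = tone 3"
  by (simp_all add: mem twist_inverse comult_pair_tone flip: comult_pair_mult)

text \<open>
  The rules \<open>word3\<close> normalise words in the third tensor power whose letters are \<open>\<Phi>\<close>, the paddings and
  coproducts of \<open>F\<close>, and the inverses of these: they associate to the right and cancel adjacent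
  inverse letters.
\<close>

lemmas mem3 = tmap_comult_tpower pad_mem3 mem tmult_closed[where n = 3] tone_tpower
lemmas inv3 = assoc_inverse pad_inverse3 comult_pair_inverse
lemmas cancel3 = inv3[THEN tmult_cancel]
lemmas word3 = tmult_assoc[where n = 3] mem3 inv3 cancel3 tmult_tone[where n = 3]

lemma twist_assoc_eq: "\<Phi>F = (F \<otimes> tone 1) \<cdot> tmap [\<Delta>, emb] F \<cdot> \<Phi> \<cdot> tmap [emb, \<Delta>] G \<cdot> (tone 1 \<otimes> G)"
  by (simp add: twist_assoc_def emb_one)

lemma twist_assoc_tpower: "\<Phi>F \<in> tpower 3" "\<Psi>F \<in> tpower 3"
  unfolding twist_assoc_eq by (simp_all add: mem3)

lemma twist_assoc_inverse: "\<Phi>F \<cdot> \<Psi>F = tone 3" "\<Psi>F \<cdot> \<Phi>F = tone 3"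
  unfolding twist_assoc_eq by (simp_all add: word3)

lemma twist_assoc_invertible: "tinvertible 3 \<Phi>F"
  using twist_assoc_inverse twist_assoc_tpower by (auto simp: tinvertible_def is_tinv_def)

lemma twist_assoc_tinv: "tinv 3 \<Phi>F = \<Psi>F"
  using twist_assoc_inverse twist_assoc_tpower by (intro tinv_eq) (auto simp: is_tinv_def)

lemma twist_assoc_even: "\<Phi>F \<in> tgrade 3 0"
proof -
  have *: "s \<cdot> t \<in> tgrade 3 0" if "s \<in> tgrade 3 0" "t \<in> tgrade 3 0" for s t
    using tmult_tgrade[OF that] by simp
  show ?thesis
    unfolding twist_assoc_eq
    using tone_pad[of _ 2 1] by (intro * comult_pair_even) (auto simp: even)
qed

lemma twist_comult_eq: "\<Delta>F = (\<lambda>a. F \<cdot> \<Delta> a \<cdot> G)"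
  by (simp add: fun_eq_iff twist_comult_def)

lemma even_hom_twist_comult: "even_hom \<Delta>F 2"
proof -
  have tp: "\<Delta>F a \<in> tpower 2" for a
    unfolding twist_comult_eq by (intro tmult_closed mem comult_in_tpower)
  have lin: "tlin 2 tscale (\<lambda>t. F \<cdot> t \<cdot> G)"
    by (intro tlin_mult_left tlin_tmult_right mem)
  have "Vector_Spaces.linear scale tscale \<Delta>F"
    using comult_linear tlin_add[OF lin] tlin_scale[OF lin] comult_in_tpower
    by (simp add: twist_comult_eq Vector_Spaces.linear_iff)
  moreover have "\<Delta>F a \<in> tgrade 2 d" if "a \<in> grade d" for a d
    using tmult_tgrade[OF tmult_tgrade[OF even(1) comult_grade[OF that]] even(2)]
    by (simp add: twist_comult_eq)
  moreover have "\<Delta>F 1 = tone 2"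
    by (simp add: twist_comult_eq comult_one tmult_tone mem twist_inverse)
  moreover have "\<Delta>F (x * y) = \<Delta>F x \<cdot> \<Delta>F y" for x y
    by (simp add: twist_comult_eq comult_mult tmult_assoc[where n = 2] tmult_closed[where n = 2] mem
        comult_in_tpower twist_inverse tmult_cancel[where n = 2])
  ultimately show ?thesis
    using tp by (simp add: even_hom_def even_map_def graded_linear_def)
qed

lemma twist_comult_pair:
  assumes "t \<in> tpower 2"
  shows "tmap [\<Delta>F, emb] t = (F \<otimes> tone 1) \<cdot> tmap [\<Delta>, emb] t \<cdot> (G \<otimes> tone 1)"
    "tmap [emb, \<Delta>F] t = (tone 1 \<otimes> F) \<cdot> tmap [emb, \<Delta>] t \<cdot> (tone 1 \<otimes> G)"
  using tmap_conj[of "[]" "[]" "[emb]" "[1]" \<Delta> 2 F G t] tmap_conj[of "[emb]" "[1]" "[]" "[]" \<Delta> 2 F G t]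
    graded_linear_emb_comult_counit even assms tensor_prod_closed[OF mem(1) tone_tpower[of 1]]
    tensor_prod_closed[OF mem(2) tone_tpower[of 1]]
  by (simp_all add: twist_comult_eq tone_zero tensor_prod_unit_left[of _ 3] tensor_prod_unit_right[of _ 2]
      mem Suc_small_numerals)

text \<open>
  Both sides reduce to the coproduct \<open>(\<Delta> \<otimes> 1)\<Delta>(a)\<close> multiplied on the left by
  \<open>(1 \<otimes> F) (1 \<otimes> \<Delta>) F \<Psi>\<close> and on the right by \<open>\<Phi> (1 \<otimes> \<Delta>) G (1 \<otimes> G)\<close>.
\<close>

lemma twist_quasi_coassoc:
  "tmap [emb, \<Delta>F] (\<Delta>F a) = tinv 3 \<Phi>F \<cdot> tmap [\<Delta>F, emb] (\<Delta>F a) \<cdot> \<Phi>F"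
proof -
  have c: "F \<cdot> \<Delta> a \<in> tpower 2" "F \<cdot> \<Delta> a \<cdot> G \<in> tpower 2" by (intro tmult_closed mem comult_in_tpower)+
  show ?thesis
    unfolding twist_assoc_tinv unfolding twist_assoc_eq
    by (simp add: twist_comult_pair twist_comult_def c comult_pair_mult mem comult_in_tpower
        quasi_coassoc word3)
qed

lemma tmap_counit_inverse: "tmap [of_form \<epsilon>, emb] G = tone 1" "tmap [emb, of_form \<epsilon>] G = tone 1"
proof -
  have "tmap [of_form \<epsilon>, emb] G \<in> tpower 1" "tmap [emb, of_form \<epsilon>] G \<in> tpower 1"
    by (rule tmap_counit_tpower[OF mem(2)])+
  moreover have "tmap [of_form \<epsilon>, emb] F \<cdot> tmap [of_form \<epsilon>, emb] G = tone 1"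
    "tmap [emb, of_form \<epsilon>] F \<cdot> tmap [emb, of_form \<epsilon>] G = tone 1"
    using tmap_tmult[of "[of_form \<epsilon>, emb]" "[0, 1]" F G] tmap_tmult[of "[emb, of_form \<epsilon>]" "[1, 0]" F G]
      tmap_tone[of "[of_form \<epsilon>, emb]" "[0, 1]"] tmap_tone[of "[emb, of_form \<epsilon>]" "[1, 0]"]
      even_homs mem twist_inverse by (simp_all add: Suc_small_numerals)
  ultimately show "tmap [of_form \<epsilon>, emb] G = tone 1" "tmap [emb, of_form \<epsilon>] G = tone 1"
    using gauge tmult_tone[where n = 1] by (simp_all add: gauge_transformation_def)
qed

lemma twist_counit:
  "tmap [of_form \<epsilon>, emb] (\<Delta>F a) = emb a" "tmap [emb, of_form \<epsilon>] (\<Delta>F a) = emb a"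
proof -
  have c: "F \<cdot> \<Delta> a \<in> tpower 2" by (intro tmult_closed mem comult_in_tpower)
  have "tmap [of_form \<epsilon>, emb] (s \<cdot> t) = tmap [of_form \<epsilon>, emb] s \<cdot> tmap [of_form \<epsilon>, emb] t"
    "tmap [emb, of_form \<epsilon>] (s \<cdot> t) = tmap [emb, of_form \<epsilon>] s \<cdot> tmap [emb, of_form \<epsilon>] t"
    if "s \<in> tpower 2" "t \<in> tpower 2" for s t
    using tmap_tmult[of "[of_form \<epsilon>, emb]" "[0, 1]" s t] tmap_tmult[of "[emb, of_form \<epsilon>]" "[1, 0]" s t]
      that even_homs by (simp_all add: Suc_small_numerals)
  then show "tmap [of_form \<epsilon>, emb] (\<Delta>F a) = emb a" "tmap [emb, of_form \<epsilon>] (\<Delta>F a) = emb a"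
    using gauge tmult_tone[OF emb_in_tpower]
    by (simp_all add: twist_comult_eq c mem comult_in_tpower counit_left counit_right
        tmap_counit_inverse gauge_transformation_def)
qed

lemma tmap_emb_emb: "t \<in> tpower 2 \<Longrightarrow> tmap [emb, emb] t = t"
  using tmap_emb[of t 2] by (simp add: numeral_2_eq_2)

lemma tmap_singleton_emb: "even_hom f n \<Longrightarrow> (\<lambda>a. tmap [f] (emb a)) = f"
  using tmap_emb_singleton by (auto simp: even_hom_def even_map_def)

lemma tmap_tmap_pair_comult:
  assumes "even_hom f k" "even_hom g l" "even_hom h m" "t \<in> tpower 2"
  shows "tmap [f, g, h] (tmap [\<Delta>, emb] t) = tmap [\<lambda>a. tmap [f, g] (\<Delta> a), h] t"
    "tmap [f, g, h] (tmap [emb, \<Delta>] t) = tmap [f, \<lambda>a. tmap [g, h] (\<Delta> a)] t"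
  using tmap_tmap_pair[of \<Delta> 2 emb 1 "[f, g]" "[k, l]" "[h]" "[m]" t]
    tmap_tmap_pair[of emb 1 \<Delta> 2 "[f]" "[k]" "[g, h]" "[l, m]" t] assms
    graded_linear_emb_comult_counit tmap_singleton_emb[OF assms(1)] tmap_singleton_emb[OF assms(3)]
  by (simp_all add: even_hom_def even_map_def)

lemma tmap_pad:
  assumes "even_hom f k" "even_hom g l" "even_hom h m" "t \<in> tpower 2"
  shows "tmap [f, g, h] (t \<otimes> tone 1) = tmap [f, g] t \<otimes> tone m"
    "tmap [f, g, h] (tone 1 \<otimes> t) = tone k \<otimes> tmap [g, h] t"
  using tmap_tensor_prod[of "[f, g]" "[k, l]" "[h]" "[m]" t "tone 1"]
    tmap_tensor_prod[of "[f]" "[k]" "[g, h]" "[l, m]" "tone 1" t] assms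
    tmap_tone[of "[h]" "[m]"] tmap_tone[of "[f]" "[k]"] tone_tpower[of 1]
  by (simp_all add: even_hom_def even_map_def Suc_small_numerals)

text \<open>
  The counit axiom for \<open>\<Phi>\<^sub>F\<close> and, up to conjugation by \<open>F\<close>, the three coproducts of \<open>\<Phi>\<^sub>F\<close> in the pentagon
  are of this form.
\<close>

lemma tmap_twist_assoc:
  assumes "even_hom f k" "even_hom g l" "even_hom h m"
  shows "tmap [f, g, h] \<Phi>F = (tmap [f, g] F \<otimes> tone m) \<cdot> tmap [\<lambda>a. tmap [f, g] (\<Delta> a), h] F \<cdot>
    tmap [f, g, h] \<Phi> \<cdot> tmap [f, \<lambda>a. tmap [g, h] (\<Delta> a)] G \<cdot> (tone k \<otimes> tmap [g, h] G)"
proof -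
  have hom: "tmap [f, g, h] (s \<cdot> t) = tmap [f, g, h] s \<cdot> tmap [f, g, h] t"
    if "s \<in> tpower 3" "t \<in> tpower 3" for s t
    using tmap_tmult[of "[f, g, h]" "[k, l, m]" s t] that assms by (simp add: Suc_small_numerals)
  show ?thesis
    unfolding twist_assoc_eq
    by (simp add: hom mem3 tmap_pad[OF assms] tmap_tmap_pair_comult[OF assms])
qed

lemma twist_counit_assoc: "tmap [emb, of_form \<epsilon>, emb] \<Phi>F = tone 2"
proof -
  have "(\<lambda>a. tmap [emb, of_form \<epsilon>] (\<Delta> a)) = emb" "(\<lambda>a. tmap [of_form \<epsilon>, emb] (\<Delta> a)) = emb"
    using counit_left counit_right by auto
  then show ?thesis
    using gauge tone_add[of 1 1] tmap_twist_assoc[OF even_hom_emb even_hom_counit even_hom_emb]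
    by (simp add: tmap_emb_emb mem tmap_counit_inverse gauge_transformation_def counit_assoc
        tmult_tone twist_inverse tone_tpower)
qed

text \<open>
  Quasi-coassociativity applied inside \<open>F\<close> and \<open>G\<close>. This lets \<open>\<Phi> \<otimes> 1\<close> and \<open>1 \<otimes> \<Phi>\<close> pass through the iterated
  coproducts of the twist in the pentagon.
\<close>

lemma coassoc_pair:
  "tmap [\<lambda>a. tmap [emb, \<Delta>] (\<Delta> a), emb] F =
    (\<Psi> \<otimes> tone 1) \<cdot> tmap [\<lambda>a. tmap [\<Delta>, emb] (\<Delta> a), emb] F \<cdot> (\<Phi> \<otimes> tone 1)"
  "tmap [emb, \<lambda>a. tmap [emb, \<Delta>] (\<Delta> a)] G =
    (tone 1 \<otimes> \<Psi>) \<cdot> tmap [emb, \<lambda>a. tmap [\<Delta>, emb] (\<Delta> a)] G \<cdot> (tone 1 \<otimes> \<Phi>)"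
proof -
  have f: "graded_linear (\<lambda>a. tmap [\<Delta>, emb] (\<Delta> a)) 3"
    using graded_linear_tmap[of \<Delta> 2 "[\<Delta>, emb]" "[2, 1]"] graded_linear_emb_comult_counit
    by (simp add: Suc_small_numerals)
  have "tensor_prod \<Phi> (tone 1) \<in> tpower 4" "tensor_prod \<Psi> (tone 1) \<in> tpower 4"
    using tensor_prod_closed[OF mem(3) tone_tpower[of 1]] tensor_prod_closed[OF mem(4) tone_tpower[of 1]]
    by simp_all
  then show "tmap [\<lambda>a. tmap [emb, \<Delta>] (\<Delta> a), emb] F =
      (\<Psi> \<otimes> tone 1) \<cdot> tmap [\<lambda>a. tmap [\<Delta>, emb] (\<Delta> a), emb] F \<cdot> (\<Phi> \<otimes> tone 1)"
    "tmap [emb, \<lambda>a. tmap [emb, \<Delta>] (\<Delta> a)] G =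
      (tone 1 \<otimes> \<Psi>) \<cdot> tmap [emb, \<lambda>a. tmap [\<Delta>, emb] (\<Delta> a)] G \<cdot> (tone 1 \<otimes> \<Phi>)"
    unfolding quasi_coassoc
    using tmap_conj[of "[]" "[]" "[emb]" "[1]" _ 3 \<Psi> \<Phi> F, OF _ _ f]
      tmap_conj[of "[emb]" "[1]" "[]" "[]" _ 3 \<Psi> \<Phi> G, OF _ _ f] graded_linear_emb_comult_counit
    by (simp_all add: even mem tone_zero tensor_prod_unit_left[of _ 4] tensor_prod_unit_right[of _ 3]
        Suc_small_numerals)
qed

lemma twist_comult_triple:
  assumes "t \<in> tpower 3"
  shows "tmap [\<Delta>F, emb, emb] t = (F \<otimes> tone 2) \<cdot> tmap [\<Delta>, emb, emb] t \<cdot> (G \<otimes> tone 2)"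
    "tmap [emb, \<Delta>F, emb] t =
      (tone 1 \<otimes> F \<otimes> tone 1) \<cdot> tmap [emb, \<Delta>, emb] t \<cdot> (tone 1 \<otimes> G \<otimes> tone 1)"
    "tmap [emb, emb, \<Delta>F] t = (tone 2 \<otimes> F) \<cdot> tmap [emb, emb, \<Delta>] t \<cdot> (tone 2 \<otimes> G)"
  using tmap_conj[of "[]" "[]" "[emb, emb]" "[1, 1]" \<Delta> 2 F G t]
    tmap_conj[of "[emb]" "[1]" "[emb]" "[1]" \<Delta> 2 F G t]
    tmap_conj[of "[emb, emb]" "[1, 1]" "[]" "[]" \<Delta> 2 F G t]
    graded_linear_emb_comult_counit even assms tensor_prod_closed[OF mem(1) tone_tpower[of 2]]
    tensor_prod_closed[OF mem(2) tone_tpower[of 2]]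
  by (simp_all add: twist_comult_eq tone_zero tensor_prod_unit_left[of _ 4] tensor_prod_unit_right[of _ 2]
      mem Suc_small_numerals)

lemma tensor_prod_mult_tone:
  assumes "s \<in> tpower 3" "t \<in> tpower 3"
  shows "(s \<cdot> t) \<otimes> tone 1 = (s \<otimes> tone 1) \<cdot> (t \<otimes> tone 1)"
    "tone 1 \<otimes> (s \<cdot> t) = (tone 1 \<otimes> s) \<cdot> (tone 1 \<otimes> t)"
  using tmult_tensor_prod_even_left[OF assms(1) tone_tgrade assms(2) tone_tpower, of 1]
    tmult_tensor_prod_even_right[OF tone_tpower assms(1) tone_tgrade assms(2), of 1]
    tmult_tone(1)[OF tone_tpower[of 1]] by simp_all

lemma tone_move:
  "(tone 1 \<otimes> G) \<otimes> tone 1 = tone 1 \<otimes> G \<otimes> tone 1" "tone 1 \<otimes> tone 1 \<otimes> G = tone 2 \<otimes> G"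
  "(F \<otimes> tone 1) \<otimes> tone 1 = F \<otimes> tone 2"
  using tensor_prod_assoc[OF tone_tpower[of 1] mem(2) tone_tpower[of 1]]
    tensor_prod_assoc[OF tone_tpower[of 1] tone_tpower[of 1] mem(2)]
    tensor_prod_assoc[OF mem(1) tone_tpower[of 1] tone_tpower[of 1]] tone_add[of 1 1] by simp_all

lemma mem4:
  "s \<in> tpower 3 \<Longrightarrow> s \<otimes> tone 1 \<in> tpower 4" "s \<in> tpower 3 \<Longrightarrow> tone 1 \<otimes> s \<in> tpower 4"
  "s \<in> tpower 2 \<Longrightarrow> s \<otimes> tone 2 \<in> tpower 4" "s \<in> tpower 2 \<Longrightarrow> tone 2 \<otimes> s \<in> tpower 4"
  "s \<in> tpower 2 \<Longrightarrow> tone 1 \<otimes> s \<otimes> tone 1 \<in> tpower 4"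
  "t \<in> tpower 3 \<Longrightarrow> tmap [\<Delta>, emb, emb] t \<in> tpower 4"
  "t \<in> tpower 3 \<Longrightarrow> tmap [emb, \<Delta>, emb] t \<in> tpower 4"
  "t \<in> tpower 3 \<Longrightarrow> tmap [emb, emb, \<Delta>] t \<in> tpower 4"
  "s \<in> tpower 2 \<Longrightarrow> tmap [\<Delta>, \<Delta>] s \<in> tpower 4"
  "s \<in> tpower 2 \<Longrightarrow> tmap [\<lambda>a. tmap [\<Delta>, emb] (\<Delta> a), emb] s \<in> tpower 4"
  "s \<in> tpower 2 \<Longrightarrow> tmap [emb, \<lambda>a. tmap [\<Delta>, emb] (\<Delta> a)] s \<in> tpower 4"
proof -
  note gl = graded_linear_emb_comult_counit
  have f: "graded_linear (\<lambda>a. tmap [\<Delta>, emb] (\<Delta> a)) 3"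
    using graded_linear_tmap[of \<Delta> 2 "[\<Delta>, emb]" "[2, 1]"] gl by (simp add: Suc_small_numerals)
  show "s \<in> tpower 3 \<Longrightarrow> s \<otimes> tone 1 \<in> tpower 4" "s \<in> tpower 3 \<Longrightarrow> tone 1 \<otimes> s \<in> tpower 4"
    "s \<in> tpower 2 \<Longrightarrow> s \<otimes> tone 2 \<in> tpower 4" "s \<in> tpower 2 \<Longrightarrow> tone 2 \<otimes> s \<in> tpower 4"
    using tensor_prod_closed[of s 3 "tone 1" 1] tensor_prod_closed[of "tone 1" 1 s 3]
      tensor_prod_closed[of s 2 "tone 2" 2] tensor_prod_closed[of "tone 2" 2 s 2] tone_tpower
    by simp_all
  show "s \<in> tpower 2 \<Longrightarrow> tone 1 \<otimes> s \<otimes> tone 1 \<in> tpower 4"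
    using tensor_prod_closed[of "tone 1" 1 "s \<otimes> tone 1" 3] pad_mem3(1)[of s] tone_tpower by simp
  show "t \<in> tpower 3 \<Longrightarrow> tmap [\<Delta>, emb, emb] t \<in> tpower 4"
    "t \<in> tpower 3 \<Longrightarrow> tmap [emb, \<Delta>, emb] t \<in> tpower 4"
    "t \<in> tpower 3 \<Longrightarrow> tmap [emb, emb, \<Delta>] t \<in> tpower 4"
    using tmap_closed[of "[\<Delta>, emb, emb]" "[2, 1, 1]" t] tmap_closed[of "[emb, \<Delta>, emb]" "[1, 2, 1]" t]
      tmap_closed[of "[emb, emb, \<Delta>]" "[1, 1, 2]" t] gl
    by (simp_all add: Suc_small_numerals)
  show "s \<in> tpower 2 \<Longrightarrow> tmap [\<Delta>, \<Delta>] s \<in> tpower 4"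
    "s \<in> tpower 2 \<Longrightarrow> tmap [\<lambda>a. tmap [\<Delta>, emb] (\<Delta> a), emb] s \<in> tpower 4"
    "s \<in> tpower 2 \<Longrightarrow> tmap [emb, \<lambda>a. tmap [\<Delta>, emb] (\<Delta> a)] s \<in> tpower 4"
    using tmap_closed[of "[\<Delta>, \<Delta>]" "[2, 2]" s]
      tmap_closed[of "[\<lambda>a. tmap [\<Delta>, emb] (\<Delta> a), emb]" "[3, 1]" s]
      tmap_closed[of "[emb, \<lambda>a. tmap [\<Delta>, emb] (\<Delta> a)]" "[1, 3]" s] gl f
    by (simp_all add: Suc_small_numerals)
qed

lemma inv4:
  "(\<Phi> \<otimes> tone 1) \<cdot> (\<Psi> \<otimes> tone 1) = tone 4" "(tone 1 \<otimes> \<Phi>) \<cdot> (tone 1 \<otimes> \<Psi>) = tone 4"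
  "(tone 1 \<otimes> \<Psi>) \<cdot> (tone 1 \<otimes> \<Phi>) = tone 4"
  "(tone 1 \<otimes> F \<otimes> tone 1) \<cdot> (tone 1 \<otimes> G \<otimes> tone 1) = tone 4"
  "(tone 1 \<otimes> G \<otimes> tone 1) \<cdot> (tone 1 \<otimes> F \<otimes> tone 1) = tone 4"
  "(tone 2 \<otimes> G) \<cdot> (tone 2 \<otimes> F) = tone 4"
  "(G \<otimes> tone 2) \<cdot> (F \<otimes> tone 2) = tone 4"
  "(tmap [emb, \<Delta>] G \<otimes> tone 1) \<cdot> (tmap [emb, \<Delta>] F \<otimes> tone 1) = tone 4"
  "(tone 1 \<otimes> tmap [\<Delta>, emb] G) \<cdot> (tone 1 \<otimes> tmap [\<Delta>, emb] F) = tone 4"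
  "tmap [\<Delta>, \<Delta>] G \<cdot> tmap [\<Delta>, \<Delta>] F = tone 4"
proof -
  have t: "tone n \<cdot> tone n = tone n" "tone n \<in> tgrade n 0" for n
    by (rule tmult_tone[OF tone_tpower] tone_tgrade)+
  note r3 = tensor_prod_inverse[of _ _ 3 "tone 1" "tone 1" 1] and l3 = tensor_prod_inverse[of "tone 1" "tone 1" 1 _ _ 3]
  show "(\<Phi> \<otimes> tone 1) \<cdot> (\<Psi> \<otimes> tone 1) = tone 4" "(tone 1 \<otimes> \<Phi>) \<cdot> (tone 1 \<otimes> \<Psi>) = tone 4"
    "(tone 1 \<otimes> \<Psi>) \<cdot> (tone 1 \<otimes> \<Phi>) = tone 4"
    "(tmap [emb, \<Delta>] G \<otimes> tone 1) \<cdot> (tmap [emb, \<Delta>] F \<otimes> tone 1) = tone 4"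
    "(tone 1 \<otimes> tmap [\<Delta>, emb] G) \<cdot> (tone 1 \<otimes> tmap [\<Delta>, emb] F) = tone 4"
    using r3 l3 by (simp_all add: inv3 even comult_pair_even t)
  show "(tone 1 \<otimes> F \<otimes> tone 1) \<cdot> (tone 1 \<otimes> G \<otimes> tone 1) = tone 4"
    "(tone 1 \<otimes> G \<otimes> tone 1) \<cdot> (tone 1 \<otimes> F \<otimes> tone 1) = tone 4"
    using l3 tone_pad(1)[OF even(1), of 1] tone_pad(1)[OF even(2), of 1] by (simp_all add: inv3 t)
  show "(tone 2 \<otimes> G) \<cdot> (tone 2 \<otimes> F) = tone 4" "(G \<otimes> tone 2) \<cdot> (F \<otimes> tone 2) = tone 4"
    using tensor_prod_inverse[of "tone 2" "tone 2" 2 G F 2] tensor_prod_inverse[of G F 2 "tone 2" "tone 2" 2]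
    by (simp_all add: even t twist_inverse)
  show "tmap [\<Delta>, \<Delta>] G \<cdot> tmap [\<Delta>, \<Delta>] F = tone 4"
    using tmap_tmult[of "[\<Delta>, \<Delta>]" "[2, 2]" G F] tmap_tone[of "[\<Delta>, \<Delta>]" "[2, 2]"] even_homs mem twist_inverse
    by (simp add: Suc_small_numerals)
qed

lemmas cancel4 = inv4[THEN tmult_cancel]

text \<open>
  The only two factors in the pentagon that have to be interchanged; they act on disjoint slots.
\<close>

lemma disjoint_commute: "(G \<otimes> tone 2) \<cdot> (tone 2 \<otimes> F) = (tone 2 \<otimes> F) \<cdot> (G \<otimes> tone 2)"
  using tmult_tensor_prod_even_left[OF mem(2) tone_tgrade[of 2] tone_tpower[of 2] mem(1)]
    tmult_tensor_prod_even_left[OF tone_tpower[of 2] even(1) mem(2) tone_tpower[of 2]]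
  by (simp add: tmult_tone mem)

text \<open>
  On the left-hand side, \<open>(\<Delta> \<otimes> \<Delta>) G\<close> and \<open>(\<Delta> \<otimes> \<Delta>) F\<close> meet in the middle. They cancel once the factors
  \<open>1 \<otimes> 1 \<otimes> G\<close>, \<open>G \<otimes> 1 \<otimes> 1\<close>, \<open>1 \<otimes> 1 \<otimes> F\<close>, \<open>F \<otimes> 1 \<otimes> 1\<close> between them have been interchanged and cancelled, and
  then the original pentagon applies. On the right-hand side the letters of each of the three
  terms cancel against those of its neighbours. Both sides become the product of
  \<open>F \<otimes> 1 \<otimes> 1\<close>, \<open>(\<Delta> \<otimes> 1) F \<otimes> 1\<close>, \<open>((\<Delta> \<otimes> 1)\<Delta> \<otimes> 1) F\<close>, \<open>\<Phi> \<otimes> 1\<close>, \<open>(1 \<otimes> \<Delta> \<otimes> 1) \<Phi>\<close>,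
  \<open>(1 \<otimes> (\<Delta> \<otimes> 1)\<Delta>) G\<close>, \<open>1 \<otimes> \<Phi>\<close>, \<open>1 \<otimes> (1 \<otimes> \<Delta>) G\<close> and \<open>1 \<otimes> 1 \<otimes> G\<close>.
\<close>

lemma twist_pentagon:
  "tmap [\<Delta>F, emb, emb] \<Phi>F \<cdot> tmap [emb, emb, \<Delta>F] \<Phi>F =
    (\<Phi>F \<otimes> emb 1) \<cdot> tmap [emb, \<Delta>F, emb] \<Phi>F \<cdot> (emb 1 \<otimes> \<Phi>F)"
proof -
  have comult_emb: "(\<lambda>a. tmap [emb, emb] (\<Delta> a)) = \<Delta>"
    using tmap_emb_emb comult_in_tpower by auto
  note tmap_assoc = tmap_twist_assoc[OF even_hom_comult even_hom_emb even_hom_emb]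
    tmap_twist_assoc[OF even_hom_emb even_hom_comult even_hom_emb]
    tmap_twist_assoc[OF even_hom_emb even_hom_emb even_hom_comult]
  have pad: "\<Phi>F \<otimes> tone 1 = (F \<otimes> tone 2) \<cdot> ((tmap [\<Delta>, emb] F \<otimes> tone 1) \<cdot> ((\<Phi> \<otimes> tone 1) \<cdot>
      ((tmap [emb, \<Delta>] G \<otimes> tone 1) \<cdot> (tone 1 \<otimes> G \<otimes> tone 1))))"
    "tone 1 \<otimes> \<Phi>F = (tone 1 \<otimes> F \<otimes> tone 1) \<cdot> ((tone 1 \<otimes> tmap [\<Delta>, emb] F) \<cdot> ((tone 1 \<otimes> \<Phi>) \<cdot>
      ((tone 1 \<otimes> tmap [emb, \<Delta>] G) \<cdot> (tone 2 \<otimes> G))))"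
    by (simp_all add: twist_assoc_eq tensor_prod_mult_tone mem3 mem4 tmult_assoc[where n = 4]
        tmult_closed[where n = 4] tone_move)
  have pentagon': "tmap [\<Delta>, emb, emb] \<Phi> \<cdot> (tmap [emb, emb, \<Delta>] \<Phi> \<cdot> u) =
      (\<Phi> \<otimes> tone 1) \<cdot> (tmap [emb, \<Delta>, emb] \<Phi> \<cdot> ((tone 1 \<otimes> \<Phi>) \<cdot> u))" if "u \<in> tpower 4" for u
    using pentagon that
    by (simp add: mem4 mem emb_one tmult_closed[where n = 4] flip: tmult_assoc[where n = 4])
  have disjoint': "(G \<otimes> tone 2) \<cdot> ((tone 2 \<otimes> F) \<cdot> u) = (tone 2 \<otimes> F) \<cdot> ((G \<otimes> tone 2) \<cdot> u)"
    if "u \<in> tpower 4" for u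
    using disjoint_commute that
    by (simp add: mem4 mem flip: tmult_assoc[where n = 4])
  show ?thesis
    unfolding emb_one pad
    by (simp add: twist_comult_triple twist_assoc_tpower tmap_assoc comult_emb tmap_emb_emb mem
        coassoc_pair mem4 mem3 tmult_assoc[where n = 4] tmult_closed[where n = 4] cancel4
        pentagon' disjoint')
qed

lemma twist_quasi_bialgebra: "graded_quasi_bialgebra scale grade \<Delta>F \<epsilon> \<Phi>F"
proof (intro graded_quasi_bialgebra.intro graded_quasi_bialgebra_axioms.intro superalgebra_axioms)
  show "Vector_Spaces.linear scale tscale \<Delta>F" "\<And>a. \<Delta>F a \<in> tpower 2"
    "\<And>a d. a \<in> grade d \<Longrightarrow> \<Delta>F a \<in> tgrade 2 d" "\<Delta>F 1 = tone 2"
    "\<And>a b. \<Delta>F (a * b) = \<Delta>F a \<cdot> \<Delta>F b"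
    using even_hom_twist_comult by (simp_all add: even_hom_def even_map_def graded_linear_def)
  show "thomogeneous 3 \<Phi>F" using twist_assoc_even by (auto simp: thomogeneous_def)
  show "\<And>a. a \<in> grade 1 \<Longrightarrow> \<epsilon> a = 0" by (rule counit_odd)
qed (rule counit_linear counit_one counit_mult twist_counit twist_counit_assoc twist_pentagon
    twist_quasi_coassoc twist_assoc_invertible)+

end

section \<open>Evaluation of tensors in the algebra\<close>

context tensor_powers
begin

text \<open>
  The linear extension of an \<open>A\<close>-valued multilinear map, chosen to be linear on all functionals so
  that no membership conditions are needed.
\<close>

definition extension :: "nat \<Rightarrow> ('a list \<Rightarrow> 'a) \<Rightarrow> ('a, 'k) tensor \<Rightarrow> 'a" where
  "extension n g = (SOME h. Vector_Spaces.linear tscale scale h \<and>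
     (\<forall>xs. length xs = n \<longrightarrow> h (pure xs) = g xs))"

lemma extension:
  assumes "multilinear scale n g"
  shows linear_extension: "Vector_Spaces.linear tscale scale (extension n g)"
    and extension_pure: "\<And>xs. length xs = n \<Longrightarrow> extension n g (pure xs) = g xs"
proof -
  note h = someI_ex[OF tensor_universal[OF vector_space_axioms assms], folded extension_def]
  show "Vector_Spaces.linear tscale scale (extension n g)" using h by (rule conjunct1)
  show "extension n g (pure xs) = g xs" if "length xs = n" for xs using h that by simp
qed

lemma tlin_extension:
  "multilinear scale n g \<Longrightarrow> tlin m tscale f \<Longrightarrow> tlin m scale (\<lambda>t. extension n g (f t))"
  by (rule tlin_compose_linear[OF linear_extension])

end

lemma bit_add_self: "x + x = (0 :: bit)" "x + (x + y) = (y :: bit)"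
  by (cases x; cases y; simp)+

context superalgebra
begin

lemma multilinear_prod_list: "multilinear scale n prod_list"
  unfolding multilinear_def
proof (intro allI impI)
  fix xs :: "'a list" and i assume "length xs = n \<and> i < n"
  then have "prod_list (xs[i := x]) = prod_list (take i xs) * (x * prod_list (drop (Suc i) xs))" for x
    by (simp add: upd_conv_take_nth_drop)
  then show "Vector_Spaces.linear scale scale (\<lambda>x. prod_list (xs[i := x]))"
    by (simp add: Vector_Spaces.linear_iff vector_space_axioms distrib_left distrib_right
        scale_mult_left scale_mult_right)
qed

lemma mprod_eq_extension:
  assumes "t \<in> tpower n" shows "mprod t = extension n prod_list t"
proof -
  have m: "multilinear tscale n (\<lambda>xs. emb (prod_list xs))"
    by (rule multilinear_compose[OF multilinear_prod_list linear_emb])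
  have "lift (\<lambda>xs. emb (prod_list xs)) t = emb (extension n prod_list t)"
    by (rule tlin_eq[OF linear_imp_tlin[OF linear_lift] _ _ assms])
      (auto intro!: tlin_compose_linear[OF linear_emb] tlin_extension tlin_id multilinear_prod_list
        simp: lift_pure[OF m] extension_pure[OF multilinear_prod_list])
  then show ?thesis by (simp add: mprod_def)
qed

lemma tlin_mprod:
  assumes "tlin n tscale f" "\<And>t. t \<in> tpower n \<Longrightarrow> f t \<in> tpower m"
  shows "tlin n scale (\<lambda>t. mprod (f t))"
proof -
  have "tlin n scale (\<lambda>t. extension m prod_list (f t))"
    by (rule tlin_extension[OF multilinear_prod_list assms(1)])
  then show ?thesis
    using assms(2) by (simp add: tlin_def mprod_eq_extension[of _ m] tpower_add tpower_tscale)
qed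

lemma mprod_pure: "mprod (pure xs) = prod_list xs"
  by (simp only: mprod_eq_extension[OF pure_in_tpower[OF refl]]
      extension_pure[OF multilinear_prod_list refl])

lemma homogeneous_list2:
  assumes "length xs = 2" "homogeneous_list xs ds"
  obtains x y d e where "xs = [x, y]" "ds = [d, e]" "x \<in> grade d" "y \<in> grade e"
proof -
  obtain x y where xs: "xs = [x, y]"
    using assms(1) by (auto simp: length_Suc_conv numeral_2_eq_2)
  obtain d e where "ds = [d, e]" "x \<in> grade d" "y \<in> grade e"
    using assms(2) by (auto simp: xs list_all2_Cons1)
  then show ?thesis using xs that by blast
qed

lemma homogeneous_list3:
  assumes "length xs = 3" "homogeneous_list xs ds"
  obtains x y z d e f where "xs = [x, y, z]" "ds = [d, e, f]" "x \<in> grade d" "y \<in> grade e" "z \<in> grade f"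
proof -
  obtain x y z where xs: "xs = [x, y, z]"
    using assms(1) by (auto simp: length_Suc_conv numeral_3_eq_3)
  obtain d e f where "ds = [d, e, f]" "x \<in> grade d" "y \<in> grade e" "z \<in> grade f"
    using assms(2) by (auto simp: xs list_all2_Cons1)
  then show ?thesis using xs that by blast
qed

lemma emb_pure: "emb x \<otimes> pure xs = pure (x # xs)" "pure xs \<otimes> emb x = pure (xs @ [x])"
  "emb x \<otimes> emb y = pure [x, y]"
  by (simp_all add: emb_def tensor_prod_pure)

lemma tmult_pure2:
  assumes "x \<in> grade d1" "y \<in> grade d2" "x' \<in> grade e1" "y' \<in> grade e2"
  shows "pure [x, y] \<cdot> pure [x', y'] = tscale (ksign (d2 * e1)) (pure [x * x', y * y'])"
  using tmult_pure_homogeneous[of "[x, y]" "[d1, d2]" "[x', y']" "[e1, e2]"] assms by simp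

lemma tmult_pure3:
  assumes "x \<in> grade d1" "y \<in> grade d2" "z \<in> grade d3" "x' \<in> grade e1" "y' \<in> grade e2" "z' \<in> grade e3"
  shows "pure [x, y, z] \<cdot> pure [x', y', z'] =
    tscale (ksign ((d2 + d3) * e1 + d3 * e2)) (pure [x * x', y * y', z * z'])"
  using tmult_pure_homogeneous[of "[x, y, z]" "[d1, d2, d3]" "[x', y', z']" "[e1, e2, e3]"] assms
  by simp

end

section \<open>Evaluations with an anti-homomorphism\<close>

locale graded_antihom = superalgebra scale grade
  for scale :: "'k::field \<Rightarrow> 'a::ring_1 \<Rightarrow> 'a" (infixr \<open>*s\<close> 75)
    and grade :: "bit \<Rightarrow> 'a set" +
  fixes S :: "'a \<Rightarrow> 'a"
  assumes S_linear: "Vector_Spaces.linear scale scale S"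
    and S_one: "S 1 = 1"
    and S_mult: "a \<in> grade d \<Longrightarrow> b \<in> grade e \<Longrightarrow> S (a * b) = ksign (d * e) *s (S b * S a)"
    and S_grade: "a \<in> grade d \<Longrightarrow> S a \<in> grade d"
begin

text \<open>
  The four evaluations whose values the antipode axioms prescribe. They make sense for any
  parameters \<open>\<gamma>\<close> and \<open>\<delta>\<close>, and the parameters are what changes under twisting.
\<close>

definition \<mu> :: "'a \<Rightarrow> ('a, 'k) tensor \<Rightarrow> 'a" where
  "\<mu> \<gamma> = extension 2 (\<lambda>xs. S (xs ! 0) * \<gamma> * xs ! 1)"

definition \<nu> :: "'a \<Rightarrow> ('a, 'k) tensor \<Rightarrow> 'a" where
  "\<nu> \<delta> = extension 2 (\<lambda>xs. xs ! 0 * \<delta> * S (xs ! 1))"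

definition \<omega> :: "'a \<Rightarrow> 'a \<Rightarrow> ('a, 'k) tensor \<Rightarrow> 'a" where
  "\<omega> \<gamma> \<delta> = extension 3 (\<lambda>xs. S (xs ! 0) * \<gamma> * xs ! 1 * \<delta> * S (xs ! 2))"

definition \<chi> :: "'a \<Rightarrow> 'a \<Rightarrow> ('a, 'k) tensor \<Rightarrow> 'a" where
  "\<chi> \<delta> \<gamma> = extension 3 (\<lambda>xs. xs ! 0 * \<delta> * S (xs ! 1) * \<gamma> * xs ! 2)"

lemma S_simps: "S (x + y) = S x + S y" "S (c *s x) = c *s S x"
  using S_linear by (simp_all add: Vector_Spaces.linear_iff)

lemmas linear_simps = S_simps distrib_left distrib_right scale_mult_left scale_mult_right
  scale_right_distrib scale_left_distrib scale_scale mult.assoc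

lemma multilinear2:
  assumes "\<And>x. Vector_Spaces.linear scale scale (g x)" "\<And>y. Vector_Spaces.linear scale scale (\<lambda>x. g x y)"
  shows "multilinear scale 2 (\<lambda>xs. g (xs ! 0) (xs ! 1))"
  unfolding multilinear_def
proof (intro allI impI)
  fix xs :: "'a list" and i :: nat assume *: "length xs = 2 \<and> i < 2"
  then have "i = 0 \<or> i = 1" by auto
  then show "Vector_Spaces.linear scale scale (\<lambda>x. g (xs[i := x] ! 0) (xs[i := x] ! 1))"
    using * assms by auto
qed

lemma multilinear3:
  assumes "\<And>x y. Vector_Spaces.linear scale scale (g x y)" "\<And>x z. Vector_Spaces.linear scale scale (\<lambda>y. g x y z)"
    "\<And>y z. Vector_Spaces.linear scale scale (\<lambda>x. g x y z)"
  shows "multilinear scale 3 (\<lambda>xs. g (xs ! 0) (xs ! 1) (xs ! 2))"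
  unfolding multilinear_def
proof (intro allI impI)
  fix xs :: "'a list" and i :: nat assume *: "length xs = 3 \<and> i < 3"
  then have "i = 0 \<or> i = 1 \<or> i = 2" by auto
  then show "Vector_Spaces.linear scale scale (\<lambda>x. g (xs[i := x] ! 0) (xs[i := x] ! 1) (xs[i := x] ! 2))"
    using * assms by auto
qed

lemma
  shows linear_\<mu>: "Vector_Spaces.linear tscale scale (\<mu> \<gamma>)"
    and linear_\<nu>: "Vector_Spaces.linear tscale scale (\<nu> \<gamma>)"
    and linear_\<omega>: "Vector_Spaces.linear tscale scale (\<omega> \<gamma> \<delta>)"
    and linear_\<chi>: "Vector_Spaces.linear tscale scale (\<chi> \<delta> \<gamma>)"
    and \<mu>_pure: "\<mu> \<gamma> (pure [x, y]) = S x * \<gamma> * y"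
    and \<nu>_pure: "\<nu> \<delta> (pure [x, y]) = x * \<delta> * S y"
    and \<omega>_pure: "\<omega> \<gamma> \<delta> (pure [x, y, z]) = S x * \<gamma> * y * \<delta> * S z"
    and \<chi>_pure: "\<chi> \<delta> \<gamma> (pure [x, y, z]) = x * \<delta> * S y * \<gamma> * z"
proof -
  have ml: "multilinear scale 2 (\<lambda>xs. S (xs ! 0) * \<gamma> * xs ! 1)"
    "multilinear scale 2 (\<lambda>xs. xs ! 0 * \<gamma> * S (xs ! 1))"
    "multilinear scale 3 (\<lambda>xs. S (xs ! 0) * \<gamma> * xs ! 1 * \<delta> * S (xs ! 2))"
    "multilinear scale 3 (\<lambda>xs. xs ! 0 * \<delta> * S (xs ! 1) * \<gamma> * xs ! 2)" for \<gamma> \<delta>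
    by (rule multilinear2 multilinear3;
        simp add: Vector_Spaces.linear_iff vector_space_axioms linear_simps)+
  show "Vector_Spaces.linear tscale scale (\<mu> \<gamma>)" "Vector_Spaces.linear tscale scale (\<nu> \<gamma>)"
    "Vector_Spaces.linear tscale scale (\<omega> \<gamma> \<delta>)" "Vector_Spaces.linear tscale scale (\<chi> \<delta> \<gamma>)"
    unfolding \<mu>_def \<nu>_def \<omega>_def \<chi>_def by (intro linear_extension ml)+
  show "\<mu> \<gamma> (pure [x, y]) = S x * \<gamma> * y" "\<nu> \<delta> (pure [x, y]) = x * \<delta> * S y"
    "\<omega> \<gamma> \<delta> (pure [x, y, z]) = S x * \<gamma> * y * \<delta> * S z"
    "\<chi> \<delta> \<gamma> (pure [x, y, z]) = x * \<delta> * S y * \<gamma> * z"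
    unfolding \<mu>_def \<nu>_def \<omega>_def \<chi>_def by (subst extension_pure; simp add: ml)+
qed

lemma eval_simps:
  "\<mu> \<gamma> (s + t) = \<mu> \<gamma> s + \<mu> \<gamma> t" "\<mu> \<gamma> (tscale c t) = c *s \<mu> \<gamma> t"
  "\<nu> \<gamma> (s + t) = \<nu> \<gamma> s + \<nu> \<gamma> t" "\<nu> \<gamma> (tscale c t) = c *s \<nu> \<gamma> t"
  "\<omega> \<gamma> \<delta> (s + t) = \<omega> \<gamma> \<delta> s + \<omega> \<gamma> \<delta> t" "\<omega> \<gamma> \<delta> (tscale c t) = c *s \<omega> \<gamma> \<delta> t"
  "\<chi> \<delta> \<gamma> (s + t) = \<chi> \<delta> \<gamma> s + \<chi> \<delta> \<gamma> t" "\<chi> \<delta> \<gamma> (tscale c t) = c *s \<chi> \<delta> \<gamma> t"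
  using linear_\<mu> linear_\<nu> linear_\<omega> linear_\<chi> by (simp_all add: Vector_Spaces.linear_iff)

lemmas tlin_eval = tlin_compose_linear[OF linear_\<mu>] tlin_compose_linear[OF linear_\<nu>]
  tlin_compose_linear[OF linear_\<omega>] tlin_compose_linear[OF linear_\<chi>]

lemma tone_pure2: "tone 2 = pure [1, 1]"
  by (simp add: tone_def numeral_2_eq_2)

lemma \<mu>_tone: "\<mu> \<gamma> (tone 2) = \<gamma>" and \<nu>_tone: "\<nu> \<gamma> (tone 2) = \<gamma>"
  by (simp_all add: tone_pure2 \<mu>_pure \<nu>_pure S_one)

lemma \<mu>_grade: "\<gamma> \<in> grade 0 \<Longrightarrow> t \<in> tgrade 2 d \<Longrightarrow> \<mu> \<gamma> t \<in> grade d"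
  and \<nu>_grade: "\<gamma> \<in> grade 0 \<Longrightarrow> t \<in> tgrade 2 d \<Longrightarrow> \<nu> \<gamma> t \<in> grade d"
proof -
  assume \<gamma>: "\<gamma> \<in> grade 0" and t: "t \<in> tgrade 2 d"
  have zero: "\<mu> \<gamma> 0 = 0" "\<nu> \<gamma> 0 = 0"
    using eval_simps(2)[of \<gamma> 0 0] eval_simps(4)[of \<gamma> 0 0] by (simp_all add: tscale_def zero_fun_def)
  have sub: "tensor.subspace {t. \<mu> \<gamma> t \<in> grade d}" "tensor.subspace {t. \<nu> \<gamma> t \<in> grade d}"
    using grade_subspace[of d]
    by (auto intro!: tensor.subspaceI simp: zero eval_simps subspace_0 subspace_add subspace_scale)
  have "\<mu> \<gamma> u \<in> grade d \<and> \<nu> \<gamma> u \<in> grade d"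
    if u: "u \<in> {pure xs | xs ds. length xs = 2 \<and> homogeneous_list xs ds \<and> sum_list ds = d}" for u
  proof -
    from u obtain xs ds where xs: "u = pure xs" "length xs = 2" "homogeneous_list xs ds" "sum_list ds = d"
      by blast
    obtain x y d1 d2 where *: "xs = [x, y]" "ds = [d1, d2]" "x \<in> grade d1" "y \<in> grade d2"
      using homogeneous_list2[OF xs(2,3)] .
    have "S x * \<gamma> * y \<in> grade (d1 + 0 + d2)" "x * \<gamma> * S y \<in> grade (d1 + 0 + d2)"
      by (intro grade_mult S_grade * \<gamma>)+
    then show ?thesis using xs * by (simp add: \<mu>_pure \<nu>_pure)
  qed
  then have "tgrade 2 d \<subseteq> {t. \<mu> \<gamma> t \<in> grade d}" "tgrade 2 d \<subseteq> {t. \<nu> \<gamma> t \<in> grade d}"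
    unfolding tgrade_def by (intro tensor.span_minimal sub subsetI; simp)+
  with t show "\<mu> \<gamma> t \<in> grade d" "\<nu> \<gamma> t \<in> grade d" by auto
qed

lemma graded_linear_S: "graded_linear (emb \<circ> S) 1"
  by (rule graded_linear_compose[OF graded_linear_emb S_linear])

lemma tmap_pair_S:
  "tmap [emb \<circ> S, emb] (pure [x, y]) = pure [S x, y]" "tmap [emb, emb \<circ> S] (pure [x, y]) = pure [x, S y]"
  using graded_linear_S graded_linear_emb by (simp_all add: tmap_pair[of _ 1 _ 1] emb_pure)

lemma tmap_triple_S:
  "tmap [emb, emb \<circ> S, emb] (pure [x, y, z]) = pure [x, S y, z]"
  "tmap [emb, emb, emb \<circ> S] (pure [x, y, z]) = pure [x, y, S z]"
  "tmap [emb \<circ> S, emb, emb] (pure [x, y, z]) = pure [S x, y, z]"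
  using graded_linear_S graded_linear_emb
  by (simp_all add: tmap_Cons[of _ _ 1 "[1, 1]"] tmap_pair[of _ 1 _ 1] emb_pure)

text \<open>
  For even \<open>\<gamma>\<close> and \<open>\<delta>\<close> the graded product in \<open>(1 \<otimes> \<gamma>)(S \<otimes> 1)\<close> and its analogues introduces no sign, so
  this and the next lemmas identify the expressions in the axioms with the evaluations.
\<close>

lemma mprod_eq_\<mu>:
  assumes \<gamma>: "\<gamma> \<in> grade 0" and t: "t \<in> tpower 2"
  shows "mprod ((emb 1 \<otimes> emb \<gamma>) \<cdot> tmap [emb \<circ> S, emb] t) = \<mu> \<gamma> t"
proof (rule tlin_eq_homogeneous[OF _ linear_imp_tlin[OF linear_\<mu>] t])
  have closed: "tmap [emb \<circ> S, emb] t \<in> tpower 2" if "t \<in> tpower 2" for t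
    using tmap_closed[of "[emb \<circ> S, emb]" "[1, 1]" t] graded_linear_S graded_linear_emb that
    by (simp add: Suc_small_numerals)
  have u: "emb 1 \<otimes> emb \<gamma> \<in> tpower 2" by (simp add: emb_pure pure_in_tpower)
  show "tlin 2 scale (\<lambda>t. mprod ((emb 1 \<otimes> emb \<gamma>) \<cdot> tmap [emb \<circ> S, emb] t))"
    by (rule tlin_mprod[where m = 2], rule tlin_mult_right[OF u])
      (auto intro: tlin_tmap tlin_id closed tmult_closed u)
  fix xs ds assume "length xs = 2" "homogeneous_list xs ds"
  then obtain x y d e where "xs = [x, y]" "x \<in> grade d" "y \<in> grade e" by (rule homogeneous_list2)
  then show "mprod ((emb 1 \<otimes> emb \<gamma>) \<cdot> tmap [emb \<circ> S, emb] (pure xs)) = \<mu> \<gamma> (pure xs)"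
    using tmult_pure2[OF grade_one \<gamma> S_grade] by (simp add: tmap_pair_S emb_pure mprod_pure \<mu>_pure mult.assoc)
qed

lemma mprod_eq_\<nu>:
  assumes \<delta>: "\<delta> \<in> grade 0" and t: "t \<in> tpower 2"
  shows "mprod ((emb 1 \<otimes> emb \<delta>) \<cdot> tmap [emb, emb \<circ> S] t) = \<nu> \<delta> t"
proof (rule tlin_eq_homogeneous[OF _ linear_imp_tlin[OF linear_\<nu>] t])
  have closed: "tmap [emb, emb \<circ> S] t \<in> tpower 2" if "t \<in> tpower 2" for t
    using tmap_closed[of "[emb, emb \<circ> S]" "[1, 1]" t] graded_linear_S graded_linear_emb that
    by (simp add: Suc_small_numerals)
  have u: "emb 1 \<otimes> emb \<delta> \<in> tpower 2" by (simp add: emb_pure pure_in_tpower)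
  show "tlin 2 scale (\<lambda>t. mprod ((emb 1 \<otimes> emb \<delta>) \<cdot> tmap [emb, emb \<circ> S] t))"
    by (rule tlin_mprod[where m = 2], rule tlin_mult_right[OF u])
      (auto intro: tlin_tmap tlin_id closed tmult_closed u)
  fix xs ds assume "length xs = 2" "homogeneous_list xs ds"
  then obtain x y d e where "xs = [x, y]" "x \<in> grade d" "y \<in> grade e" by (rule homogeneous_list2)
  then show "mprod ((emb 1 \<otimes> emb \<delta>) \<cdot> tmap [emb, emb \<circ> S] (pure xs)) = \<nu> \<delta> (pure xs)"
    using tmult_pure2[OF grade_one \<delta> _ S_grade] by (simp add: tmap_pair_S emb_pure mprod_pure \<nu>_pure mult.assoc)
qed

lemma tmap_triple_S_closed:
  assumes "t \<in> tpower 3"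
  shows "tmap [emb, emb \<circ> S, emb] t \<in> tpower 3" "tmap [emb, emb, emb \<circ> S] t \<in> tpower 3"
    "tmap [emb \<circ> S, emb, emb] t \<in> tpower 3"
  using tmap_closed[of "[emb, emb \<circ> S, emb]" "[1, 1, 1]" t] tmap_closed[of "[emb, emb, emb \<circ> S]" "[1, 1, 1]" t]
    tmap_closed[of "[emb \<circ> S, emb, emb]" "[1, 1, 1]" t] graded_linear_S graded_linear_emb assms
  by (simp_all add: Suc_small_numerals)

lemma mprod_eq_\<chi>:
  assumes \<gamma>: "\<gamma> \<in> grade 0" and \<delta>: "\<delta> \<in> grade 0" and t: "t \<in> tpower 3"
  shows "mprod ((emb 1 \<otimes> emb \<delta> \<otimes> emb \<gamma>) \<cdot> tmap [emb, emb \<circ> S, emb] t) = \<chi> \<delta> \<gamma> t"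
proof (rule tlin_eq_homogeneous[OF _ linear_imp_tlin[OF linear_\<chi>] t])
  have u: "emb 1 \<otimes> emb \<delta> \<otimes> emb \<gamma> \<in> tpower 3" by (simp add: emb_pure pure_in_tpower)
  show "tlin 3 scale (\<lambda>t. mprod ((emb 1 \<otimes> emb \<delta> \<otimes> emb \<gamma>) \<cdot> tmap [emb, emb \<circ> S, emb] t))"
    by (rule tlin_mprod[where m = 3], rule tlin_mult_right[OF u])
      (auto intro: tlin_tmap tlin_id tmap_triple_S_closed tmult_closed u)
  fix xs ds assume "length xs = 3" "homogeneous_list xs ds"
  then obtain x y z d e f where "xs = [x, y, z]" "x \<in> grade d" "y \<in> grade e" "z \<in> grade f"
    by (rule homogeneous_list3)
  then show "mprod ((emb 1 \<otimes> emb \<delta> \<otimes> emb \<gamma>) \<cdot> tmap [emb, emb \<circ> S, emb] (pure xs)) = \<chi> \<delta> \<gamma> (pure xs)"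
    using tmult_pure3[OF grade_one \<delta> \<gamma> _ S_grade]
    by (simp add: tmap_triple_S emb_pure mprod_pure \<chi>_pure mult.assoc)
qed

lemma mprod_eq_\<omega>:
  assumes \<gamma>: "\<gamma> \<in> grade 0" and \<delta>: "\<delta> \<in> grade 0" and t: "t \<in> tpower 3"
  shows "mprod (tmap [emb \<circ> S, emb, emb] ((emb 1 \<otimes> emb \<gamma> \<otimes> emb \<delta>) \<cdot> tmap [emb, emb, emb \<circ> S] t)) = \<omega> \<gamma> \<delta> t"
proof (rule tlin_eq_homogeneous[OF _ linear_imp_tlin[OF linear_\<omega>] t])
  have u: "emb 1 \<otimes> emb \<gamma> \<otimes> emb \<delta> \<in> tpower 3" by (simp add: emb_pure pure_in_tpower)
  show "tlin 3 scale (\<lambda>t. mprod (tmap [emb \<circ> S, emb, emb]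
      ((emb 1 \<otimes> emb \<gamma> \<otimes> emb \<delta>) \<cdot> tmap [emb, emb, emb \<circ> S] t)))"
    by (rule tlin_mprod[where m = 3], rule tlin_tmap, rule tlin_mult_right[OF u])
      (auto intro: tlin_tmap tlin_id tmap_triple_S_closed tmult_closed u)
  fix xs ds assume "length xs = 3" "homogeneous_list xs ds"
  then obtain x y z d e f where "xs = [x, y, z]" "x \<in> grade d" "y \<in> grade e" "z \<in> grade f"
    by (rule homogeneous_list3)
  then show "mprod (tmap [emb \<circ> S, emb, emb] ((emb 1 \<otimes> emb \<gamma> \<otimes> emb \<delta>) \<cdot> tmap [emb, emb, emb \<circ> S] (pure xs))) =
      \<omega> \<gamma> \<delta> (pure xs)"
    using tmult_pure3[OF grade_one \<gamma> \<delta> _ _ S_grade]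
    by (simp add: tmap_triple_S emb_pure mprod_pure \<omega>_pure mult.assoc)
qed

section \<open>Evaluations of products\<close>

text \<open>
  In this and the following five lemmas a factor of degree \<open>d\<close> is pulled into the parameter of an
  evaluation. On pure tensors \<open>p \<otimes> q\<close> the exchange in the product and the reversal by \<open>S\<close>
  contribute signs that depend on the degrees of \<open>p\<close> and \<open>q\<close> separately; their product depends on them
  only through \<open>d\<close>, so it is constant on \<open>tgrade 2 d\<close>.
\<close>

lemma \<mu>_mult_pure:
  assumes x: "x \<in> grade e1" "y \<in> grade e2" and s: "s \<in> tgrade 2 d"
  shows "\<mu> \<gamma> (s \<cdot> pure [x, y]) = ksign (d * e1) *s (S x * \<mu> \<gamma> s * y)"
proof (rule tlin_eq_tgrade[OF _ _ s])
  show "tlin 2 scale (\<lambda>s. \<mu> \<gamma> (s \<cdot> pure [x, y]))"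
    by (intro tlin_eval tlin_mult_left tlin_id)
  show "tlin 2 scale (\<lambda>s. ksign (d * e1) *s (S x * \<mu> \<gamma> s * y))"
    by (simp add: tlin_def eval_simps linear_simps mult.commute)
  fix ps ds assume *: "length ps = 2" "homogeneous_list ps ds" "sum_list ds = d"
  then obtain p q d1 d2 where p: "ps = [p, q]" "ds = [d1, d2]" "p \<in> grade d1" "q \<in> grade d2"
    using homogeneous_list2 by metis
  then have d: "d = d1 + d2" using * by simp
  show "\<mu> \<gamma> (pure ps \<cdot> pure [x, y]) = ksign (d * e1) *s (S x * \<mu> \<gamma> (pure ps) * y)"
    unfolding p(1) tmult_pure2[OF p(3,4) x]
    by (simp add: eval_simps \<mu>_pure S_mult[OF p(3) x(1)] linear_simps d algebra_simps bit_add_self flip: ksign_add)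
qed

lemma \<nu>_mult_pure:
  assumes x: "x \<in> grade e1" "y \<in> grade e2" and s: "s \<in> tgrade 2 d"
  shows "\<nu> \<gamma> (pure [x, y] \<cdot> s) = ksign (d * e2) *s (x * \<nu> \<gamma> s * S y)"
proof (rule tlin_eq_tgrade[OF _ _ s])
  show "tlin 2 scale (\<lambda>s. \<nu> \<gamma> (pure [x, y] \<cdot> s))"
    by (intro tlin_eval tlin_tmult_right) (simp add: pure_in_tpower)
  show "tlin 2 scale (\<lambda>s. ksign (d * e2) *s (x * \<nu> \<gamma> s * S y))"
    by (simp add: tlin_def eval_simps linear_simps mult.commute)
  fix ps ds assume *: "length ps = 2" "homogeneous_list ps ds" "sum_list ds = d"
  then obtain p q d1 d2 where p: "ps = [p, q]" "ds = [d1, d2]" "p \<in> grade d1" "q \<in> grade d2"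
    using homogeneous_list2 by metis
  then have d: "d = d1 + d2" using * by simp
  show "\<nu> \<gamma> (pure [x, y] \<cdot> pure ps) = ksign (d * e2) *s (x * \<nu> \<gamma> (pure ps) * S y)"
    unfolding p(1) tmult_pure2[OF x p(3,4)]
    by (simp add: eval_simps \<nu>_pure S_mult[OF x(2) p(4)] linear_simps d algebra_simps bit_add_self flip: ksign_add)
qed

lemma \<omega>_mult_left:
  assumes g: "g \<in> grade c" and x: "x \<in> grade e1" "y \<in> grade e2" "z \<in> grade e3" and s: "s \<in> tgrade 2 d"
  shows "\<omega> \<gamma> \<delta> ((s \<otimes> emb g) \<cdot> pure [x, y, z]) =
    ksign (d * e1 + c * (e1 + e2 + e3)) *s (S x * \<mu> \<gamma> s * y * \<delta> * S z * S g)"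
proof (rule tlin_eq_tgrade[OF _ _ s])
  show "tlin 2 scale (\<lambda>s. \<omega> \<gamma> \<delta> ((s \<otimes> emb g) \<cdot> pure [x, y, z]))"
    by (intro tlin_eval tlin_mult_left tlin_left tlin_id)
  show "tlin 2 scale (\<lambda>s. ksign (d * e1 + c * (e1 + e2 + e3)) *s (S x * \<mu> \<gamma> s * y * \<delta> * S z * S g))"
    by (simp add: tlin_def eval_simps linear_simps mult.commute)
  fix ps ds assume *: "length ps = 2" "homogeneous_list ps ds" "sum_list ds = d"
  then obtain p q d1 d2 where p: "ps = [p, q]" "ds = [d1, d2]" "p \<in> grade d1" "q \<in> grade d2"
    using homogeneous_list2 by metis
  then have d: "d = d1 + d2" using * by simp
  have pure: "pure ps \<otimes> emb g = pure [p, q, g]" by (simp add: p emb_pure)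
  show "\<omega> \<gamma> \<delta> ((pure ps \<otimes> emb g) \<cdot> pure [x, y, z]) =
      ksign (d * e1 + c * (e1 + e2 + e3)) *s (S x * \<mu> \<gamma> (pure ps) * y * \<delta> * S z * S g)"
    unfolding pure unfolding p(1) tmult_pure3[OF p(3,4) g x]
    by (simp add: eval_simps \<omega>_pure \<mu>_pure S_mult[OF p(3) x(1)] S_mult[OF g x(3)] linear_simps d algebra_simps
        bit_add_self flip: ksign_add)
qed

lemma \<omega>_mult_right:
  assumes g: "g \<in> grade c" and x: "x \<in> grade e1" "y \<in> grade e2" "z \<in> grade e3" and s: "s \<in> tgrade 2 d"
  shows "\<omega> \<gamma> \<delta> (pure [x, y, z] \<cdot> (emb g \<otimes> s)) =
    ksign (c * (e1 + e2 + e3) + d * e3) *s (S g * S x * \<gamma> * y * \<nu> \<delta> s * S z)"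
proof (rule tlin_eq_tgrade[OF _ _ s])
  show "tlin 2 scale (\<lambda>s. \<omega> \<gamma> \<delta> (pure [x, y, z] \<cdot> (emb g \<otimes> s)))"
    by (intro tlin_eval tlin_mult_right[where m = 3] tlin_tensor_prod_right[where m = 1])
      (use tensor_prod_closed[OF emb_in_tpower[of g], of _ 2] in \<open>auto simp: pure_in_tpower emb_in_tpower\<close>)
  show "tlin 2 scale (\<lambda>s. ksign (c * (e1 + e2 + e3) + d * e3) *s (S g * S x * \<gamma> * y * \<nu> \<delta> s * S z))"
    by (simp add: tlin_def eval_simps linear_simps mult.commute)
  fix ps ds assume *: "length ps = 2" "homogeneous_list ps ds" "sum_list ds = d"
  then obtain p q d1 d2 where p: "ps = [p, q]" "ds = [d1, d2]" "p \<in> grade d1" "q \<in> grade d2"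
    using homogeneous_list2 by metis
  then have d: "d = d1 + d2" using * by simp
  have pure: "emb g \<otimes> pure ps = pure [g, p, q]" by (simp add: p emb_pure)
  show "\<omega> \<gamma> \<delta> (pure [x, y, z] \<cdot> (emb g \<otimes> pure ps)) =
      ksign (c * (e1 + e2 + e3) + d * e3) *s (S g * S x * \<gamma> * y * \<nu> \<delta> (pure ps) * S z)"
    unfolding pure unfolding p(1) tmult_pure3[OF x g p(3,4)]
    by (simp add: eval_simps \<omega>_pure \<nu>_pure S_mult[OF x(1) g] S_mult[OF x(3) p(4)] linear_simps d algebra_simps
        bit_add_self flip: ksign_add)
qed

lemma \<chi>_mult_left:
  assumes g: "g \<in> grade c" and x: "x \<in> grade e1" "y \<in> grade e2" "z \<in> grade e3" and s: "s \<in> tgrade 2 d"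
  shows "\<chi> \<delta> \<gamma> ((emb g \<otimes> s) \<cdot> pure [x, y, z]) = ksign (d * (e1 + e2)) *s (g * x * \<delta> * S y * \<mu> \<gamma> s * z)"
proof (rule tlin_eq_tgrade[OF _ _ s])
  show "tlin 2 scale (\<lambda>s. \<chi> \<delta> \<gamma> ((emb g \<otimes> s) \<cdot> pure [x, y, z]))"
    by (intro tlin_eval tlin_mult_left tlin_tensor_prod_right[OF emb_in_tpower])
  show "tlin 2 scale (\<lambda>s. ksign (d * (e1 + e2)) *s (g * x * \<delta> * S y * \<mu> \<gamma> s * z))"
    by (simp add: tlin_def eval_simps linear_simps mult.commute)
  fix ps ds assume *: "length ps = 2" "homogeneous_list ps ds" "sum_list ds = d"
  then obtain p q d1 d2 where p: "ps = [p, q]" "ds = [d1, d2]" "p \<in> grade d1" "q \<in> grade d2"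
    using homogeneous_list2 by metis
  then have d: "d = d1 + d2" using * by simp
  have pure: "emb g \<otimes> pure ps = pure [g, p, q]" by (simp add: p emb_pure)
  show "\<chi> \<delta> \<gamma> ((emb g \<otimes> pure ps) \<cdot> pure [x, y, z]) = ksign (d * (e1 + e2)) *s (g * x * \<delta> * S y * \<mu> \<gamma> (pure ps) * z)"
    unfolding pure unfolding p(1) tmult_pure3[OF g p(3,4) x]
    by (simp add: eval_simps \<chi>_pure \<mu>_pure S_mult[OF p(3) x(2)] linear_simps d algebra_simps
        bit_add_self flip: ksign_add)
qed

lemma \<chi>_mult_right:
  assumes g: "g \<in> grade c" and x: "x \<in> grade e1" "y \<in> grade e2" "z \<in> grade e3" and s: "s \<in> tgrade 2 d"
  shows "\<chi> \<delta> \<gamma> (pure [x, y, z] \<cdot> (s \<otimes> emb g)) = ksign (d * (e2 + e3)) *s (x * \<nu> \<delta> s * S y * \<gamma> * z * g)"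
proof (rule tlin_eq_tgrade[OF _ _ s])
  show "tlin 2 scale (\<lambda>s. \<chi> \<delta> \<gamma> (pure [x, y, z] \<cdot> (s \<otimes> emb g)))"
    by (intro tlin_eval tlin_mult_right[where m = 3] tlin_left tlin_id)
      (use tensor_prod_closed[OF _ emb_in_tpower[of g], of _ 2] in \<open>auto simp: pure_in_tpower\<close>)
  show "tlin 2 scale (\<lambda>s. ksign (d * (e2 + e3)) *s (x * \<nu> \<delta> s * S y * \<gamma> * z * g))"
    by (simp add: tlin_def eval_simps linear_simps mult.commute)
  fix ps ds assume *: "length ps = 2" "homogeneous_list ps ds" "sum_list ds = d"
  then obtain p q d1 d2 where p: "ps = [p, q]" "ds = [d1, d2]" "p \<in> grade d1" "q \<in> grade d2"
    using homogeneous_list2 by metis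
  then have d: "d = d1 + d2" using * by simp
  have pure: "pure ps \<otimes> emb g = pure [p, q, g]" by (simp add: p emb_pure)
  show "\<chi> \<delta> \<gamma> (pure [x, y, z] \<cdot> (pure ps \<otimes> emb g)) = ksign (d * (e2 + e3)) *s (x * \<nu> \<delta> (pure ps) * S y * \<gamma> * z * g)"
    unfolding pure unfolding p(1) tmult_pure3[OF x p(3,4) g]
    by (simp add: eval_simps \<chi>_pure \<nu>_pure S_mult[OF x(2) p(4)] linear_simps d algebra_simps
        bit_add_self flip: ksign_add)
qed

text \<open>
  Absorption of even factors, which is how the canonical elements arise: for \<open>s = G\<close> the new parameter
  \<open>\<mu> \<alpha> G\<close> is the twisted \<open>\<alpha>\<close>.
\<close>

lemma \<mu>_even:
  assumes "s \<in> tgrade 2 0" "t \<in> tpower 2"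
  shows "\<mu> \<gamma> (s \<cdot> t) = \<mu> (\<mu> \<gamma> s) t"
proof (rule tlin_eq_homogeneous[OF _ linear_imp_tlin[OF linear_\<mu>] assms(2)])
  show "tlin 2 scale (\<lambda>t. \<mu> \<gamma> (s \<cdot> t))"
    by (intro tlin_eval tlin_tmult_right tgrade_tpower[OF assms(1)])
  fix xs ds assume "length xs = 2" "homogeneous_list xs ds"
  then obtain x y d e where xs: "xs = [x, y]" "x \<in> grade d" "y \<in> grade e"
    by (rule homogeneous_list2)
  show "\<mu> \<gamma> (s \<cdot> pure xs) = \<mu> (\<mu> \<gamma> s) (pure xs)"
    using \<mu>_mult_pure[OF xs(2,3) assms(1)] by (simp add: xs(1) \<mu>_pure)
qed

lemma \<nu>_even:
  assumes "s \<in> tgrade 2 0" "t \<in> tpower 2"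
  shows "\<nu> \<delta> (t \<cdot> s) = \<nu> (\<nu> \<delta> s) t"
proof (rule tlin_eq_homogeneous[OF _ linear_imp_tlin[OF linear_\<nu>] assms(2)])
  show "tlin 2 scale (\<lambda>t. \<nu> \<delta> (t \<cdot> s))"
    by (intro tlin_eval tlin_mult_left tlin_id)
  fix xs ds assume "length xs = 2" "homogeneous_list xs ds"
  then obtain x y d e where xs: "xs = [x, y]" "x \<in> grade d" "y \<in> grade e"
    by (rule homogeneous_list2)
  show "\<nu> \<delta> (pure xs \<cdot> s) = \<nu> (\<nu> \<delta> s) (pure xs)"
    using \<nu>_mult_pure[OF xs(2,3) assms(1)] by (simp add: xs(1) \<nu>_pure)
qed

lemma \<omega>_even_left:
  assumes "s \<in> tgrade 2 0" "t \<in> tpower 3"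
  shows "\<omega> \<gamma> \<delta> ((s \<otimes> tone 1) \<cdot> t) = \<omega> (\<mu> \<gamma> s) \<delta> t"
proof (rule tlin_eq_homogeneous[OF _ linear_imp_tlin[OF linear_\<omega>] assms(2)])
  have "s \<otimes> tone 1 \<in> tpower 3"
    using tensor_prod_closed[OF tgrade_tpower[OF assms(1)] tone_tpower[of 1]] by simp
  then show "tlin 3 scale (\<lambda>t. \<omega> \<gamma> \<delta> ((s \<otimes> tone 1) \<cdot> t))"
    by (intro tlin_eval tlin_tmult_right)
  fix xs ds assume "length xs = 3" "homogeneous_list xs ds"
  then obtain x y z d e f where xs: "xs = [x, y, z]" "x \<in> grade d" "y \<in> grade e" "z \<in> grade f"
    by (rule homogeneous_list3)
  show "\<omega> \<gamma> \<delta> ((s \<otimes> tone 1) \<cdot> pure xs) = \<omega> (\<mu> \<gamma> s) \<delta> (pure xs)"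
    using \<omega>_mult_left[OF grade_one xs(2-4) assms(1)] by (simp add: xs(1) S_one \<omega>_pure emb_one)
qed

lemma \<omega>_even_right:
  assumes "s \<in> tgrade 2 0" "t \<in> tpower 3"
  shows "\<omega> \<gamma> \<delta> (t \<cdot> (tone 1 \<otimes> s)) = \<omega> \<gamma> (\<nu> \<delta> s) t"
proof (rule tlin_eq_homogeneous[OF _ linear_imp_tlin[OF linear_\<omega>] assms(2)])
  show "tlin 3 scale (\<lambda>t. \<omega> \<gamma> \<delta> (t \<cdot> (tone 1 \<otimes> s)))"
    by (intro tlin_eval tlin_mult_left tlin_id)
  fix xs ds assume "length xs = 3" "homogeneous_list xs ds"
  then obtain x y z d e f where xs: "xs = [x, y, z]" "x \<in> grade d" "y \<in> grade e" "z \<in> grade f"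
    by (rule homogeneous_list3)
  show "\<omega> \<gamma> \<delta> (pure xs \<cdot> (tone 1 \<otimes> s)) = \<omega> \<gamma> (\<nu> \<delta> s) (pure xs)"
    using \<omega>_mult_right[OF grade_one xs(2-4) assms(1)] by (simp add: xs(1) S_one \<omega>_pure emb_one)
qed

lemma \<chi>_even_left:
  assumes "s \<in> tgrade 2 0" "t \<in> tpower 3"
  shows "\<chi> \<delta> \<gamma> ((tone 1 \<otimes> s) \<cdot> t) = \<chi> \<delta> (\<mu> \<gamma> s) t"
proof (rule tlin_eq_homogeneous[OF _ linear_imp_tlin[OF linear_\<chi>] assms(2)])
  have "tone 1 \<otimes> s \<in> tpower 3"
    using tensor_prod_closed[OF tone_tpower[of 1] tgrade_tpower[OF assms(1)]] by simp
  then show "tlin 3 scale (\<lambda>t. \<chi> \<delta> \<gamma> ((tone 1 \<otimes> s) \<cdot> t))"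
    by (intro tlin_eval tlin_tmult_right)
  fix xs ds assume "length xs = 3" "homogeneous_list xs ds"
  then obtain x y z d e f where xs: "xs = [x, y, z]" "x \<in> grade d" "y \<in> grade e" "z \<in> grade f"
    by (rule homogeneous_list3)
  show "\<chi> \<delta> \<gamma> ((tone 1 \<otimes> s) \<cdot> pure xs) = \<chi> \<delta> (\<mu> \<gamma> s) (pure xs)"
    using \<chi>_mult_left[OF grade_one xs(2-4) assms(1)] by (simp add: xs(1) \<chi>_pure emb_one)
qed

lemma \<chi>_even_right:
  assumes "s \<in> tgrade 2 0" "t \<in> tpower 3"
  shows "\<chi> \<delta> \<gamma> (t \<cdot> (s \<otimes> tone 1)) = \<chi> (\<nu> \<delta> s) \<gamma> t"
proof (rule tlin_eq_homogeneous[OF _ linear_imp_tlin[OF linear_\<chi>] assms(2)])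
  show "tlin 3 scale (\<lambda>t. \<chi> \<delta> \<gamma> (t \<cdot> (s \<otimes> tone 1)))"
    by (intro tlin_eval tlin_mult_left tlin_id)
  fix xs ds assume "length xs = 3" "homogeneous_list xs ds"
  then obtain x y z d e f where xs: "xs = [x, y, z]" "x \<in> grade d" "y \<in> grade e" "z \<in> grade f"
    by (rule homogeneous_list3)
  show "\<chi> \<delta> \<gamma> (pure xs \<cdot> (s \<otimes> tone 1)) = \<chi> (\<nu> \<delta> s) \<gamma> (pure xs)"
    using \<chi>_mult_right[OF grade_one xs(2-4) assms(1)] by (simp add: xs(1) \<chi>_pure emb_one)
qed

end

sublocale quasi_hopf_superalgebra \<subseteq> graded_antihom
  by (intro graded_antihom.intro graded_antihom_axioms.intro superalgebra_axioms antipode_linear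
      antipode_one antipode_mult antipode_grade)

section \<open>The twisted antipode axioms\<close>

locale twisted_quasi_hopf = quasi_hopf_superalgebra scale grade \<Delta> \<epsilon> \<Phi> S \<alpha> \<beta>
  for scale :: "'k::field \<Rightarrow> 'a::ring_1 \<Rightarrow> 'a" (infixr \<open>*s\<close> 75)
    and grade :: "bit \<Rightarrow> 'a set"
    and \<Delta> :: "'a \<Rightarrow> ('a, 'k) tensor"
    and \<epsilon> :: "'a \<Rightarrow> 'k"
    and \<Phi> :: "('a, 'k) tensor"
    and S :: "'a \<Rightarrow> 'a"
    and \<alpha> \<beta> :: 'a +
  fixes F :: "('a, 'k) tensor"
  assumes gauge_F: "gauge_transformation \<epsilon> F"

sublocale twisted_quasi_hopf \<subseteq> twisted_quasi_bialgebra
  by (intro twisted_quasi_bialgebra.intro twisted_quasi_bialgebra_axioms.intro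
      graded_quasi_bialgebra_axioms gauge_F)

context quasi_hopf_superalgebra
begin

lemma \<mu>_comult: "\<mu> \<alpha> (\<Delta> a) = \<epsilon> a *s \<alpha>"
  using antipode_alpha mprod_eq_\<mu>[OF alpha_even comult_in_tpower] by simp

lemma \<nu>_comult: "\<nu> \<beta> (\<Delta> a) = \<epsilon> a *s \<beta>"
  using antipode_beta mprod_eq_\<nu>[OF beta_even comult_in_tpower] by simp

lemma counit_simps: "\<epsilon> (x + y) = \<epsilon> x + \<epsilon> y" "\<epsilon> (c *s x) = c * \<epsilon> x"
  using counit_linear by (simp_all add: Vector_Spaces.linear_iff)

lemma comult_simps: "\<Delta> (x + y) = \<Delta> x + \<Delta> y"
  using comult_linear by (simp add: Vector_Spaces.linear_iff)

lemma homogeneous_induct: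
  assumes "\<And>a d. a \<in> grade d \<Longrightarrow> P a" "\<And>a b. P a \<Longrightarrow> P b \<Longrightarrow> P (a + b)"
  shows "P a"
  using grade_sum[of a] assms by blast

text \<open>
  The signs that occur when a coproduct \<open>\<Delta> a\<close> is absorbed only matter for odd \<open>a\<close>, and there the counit
  vanishes.
\<close>

lemma counit_ksign: "a \<in> grade d \<Longrightarrow> \<epsilon> a * ksign (d * e) = \<epsilon> a"
  using counit_odd by (cases d) auto

lemma \<mu>_comult_mult:
  assumes t: "t \<in> tpower 2" shows "\<mu> \<alpha> (\<Delta> a \<cdot> t) = \<epsilon> a *s \<mu> \<alpha> t"
proof (induction a rule: homogeneous_induct)
  case (1 a d)
  show ?case
  proof (rule tlin_eq_homogeneous[OF _ _ t])
    show "tlin 2 scale (\<lambda>t. \<mu> \<alpha> (\<Delta> a \<cdot> t))"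
      by (intro tlin_eval tlin_tmult_right comult_in_tpower)
    show "tlin 2 scale (\<lambda>t. \<epsilon> a *s \<mu> \<alpha> t)"
      by (simp add: tlin_def eval_simps linear_simps mult.commute)
    fix xs ds assume "length xs = 2" "homogeneous_list xs ds"
    then obtain x y d' e' where xs: "xs = [x, y]" "x \<in> grade d'" "y \<in> grade e'"
      by (rule homogeneous_list2)
    show "\<mu> \<alpha> (\<Delta> a \<cdot> pure xs) = \<epsilon> a *s \<mu> \<alpha> (pure xs)"
      using \<mu>_mult_pure[OF xs(2,3) comult_grade[OF 1], of \<alpha>] counit_ksign[OF 1, of d']
      by (simp add: xs(1) \<mu>_pure \<mu>_comult linear_simps mult.commute[of "ksign _"])
  qed
next
  case (2 a b)
  have "(\<Delta> a + \<Delta> b) \<cdot> t = \<Delta> a \<cdot> t + \<Delta> b \<cdot> t"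
    using linear_tmult_left by (simp add: Vector_Spaces.linear_iff)
  with 2 show ?case by (simp only: comult_simps counit_simps eval_simps scale_left_distrib)
qed

lemma \<nu>_mult_comult:
  assumes t: "t \<in> tpower 2" shows "\<nu> \<beta> (t \<cdot> \<Delta> a) = \<epsilon> a *s \<nu> \<beta> t"
proof (induction a rule: homogeneous_induct)
  case (1 a d)
  show ?case
  proof (rule tlin_eq_homogeneous[OF _ _ t])
    show "tlin 2 scale (\<lambda>t. \<nu> \<beta> (t \<cdot> \<Delta> a))"
      by (intro tlin_eval tlin_mult_left tlin_id)
    show "tlin 2 scale (\<lambda>t. \<epsilon> a *s \<nu> \<beta> t)"
      by (simp add: tlin_def eval_simps linear_simps mult.commute)
    fix xs ds assume "length xs = 2" "homogeneous_list xs ds"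
    then obtain x y d' e' where xs: "xs = [x, y]" "x \<in> grade d'" "y \<in> grade e'"
      by (rule homogeneous_list2)
    show "\<nu> \<beta> (pure xs \<cdot> \<Delta> a) = \<epsilon> a *s \<nu> \<beta> (pure xs)"
      using \<nu>_mult_pure[OF xs(2,3) comult_grade[OF 1], of \<beta>] counit_ksign[OF 1, of e']
      by (simp add: xs(1) \<nu>_pure \<nu>_comult linear_simps mult.commute[of "ksign _"])
  qed
next
  case (2 a b)
  have "t \<cdot> (\<Delta> a + \<Delta> b) = t \<cdot> \<Delta> a + t \<cdot> \<Delta> b"
    by (rule tlin_add[OF tlin_tmult_right[OF t] comult_in_tpower comult_in_tpower])
  with 2 show ?case by (simp only: comult_simps counit_simps eval_simps scale_left_distrib)
qed

lemma tmap_comult_pair: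
  "tmap [\<Delta>, emb] (pure [x, y]) = \<Delta> x \<otimes> emb y" "tmap [emb, \<Delta>] (pure [x, y]) = emb x \<otimes> \<Delta> y"
  using graded_linear_emb_comult_counit tmap_pair by blast+

lemma tmap_counit_pair:
  "tmap [of_form \<epsilon>, emb] (pure [x, y]) = tscale (\<epsilon> x) (emb y)"
  "tmap [emb, of_form \<epsilon>] (pure [x, y]) = tscale (\<epsilon> y) (emb x)"
  using graded_linear_emb_comult_counit tmap_pair[of "of_form \<epsilon>" 0 emb 1 x y] tmap_pair[of emb 1 "of_form \<epsilon>" 0 x y]
    tensor_prod_unit_left[OF emb_in_tpower] tensor_prod_unit_right[OF emb_in_tpower]
    tensor_prod_tscale_right[OF emb_in_tpower pure_in_tpower[of "[]" 0]]
  by (simp_all add: of_form_def tensor_prod_tscale_left)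

lemma pad_tone2:
  assumes "u \<in> tpower 1"
  shows "tone 2 \<otimes> u \<in> tpower 3" "u \<otimes> tone 2 \<in> tpower 3"
  using tensor_prod_closed[OF tone_tpower[of 2] assms] tensor_prod_closed[OF assms tone_tpower[of 2]]
  by simp_all

lemma tlin_tmap_self: "tlin n tscale (tmap fs)"
  by (rule linear_imp_tlin[OF linear_tmap])

text \<open>
  In this and the next three lemmas, the antipode axioms for \<open>\<Delta>\<close> turn \<open>(\<Delta> \<otimes> 1) s\<close> inside an evaluation
  into \<open>1 \<otimes> 1 \<otimes> (\<epsilon> \<otimes> 1) s\<close>, and \<open>(1 \<otimes> \<Delta>) s\<close> into \<open>(1 \<otimes> \<epsilon>) s \<otimes> 1 \<otimes> 1\<close>. A counital \<open>s\<close> is therefore invisible.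
  The replacement is checked for pure \<open>s\<close> and \<open>t\<close>; the normalisation of \<open>s\<close> enters only at the end, as it
  does not hold for pure tensors.
\<close>

lemma \<omega>_comult_left:
  assumes s: "s \<in> tpower 2" "tmap [of_form \<epsilon>, emb] s = tone 1" and t: "t \<in> tpower 3"
  shows "\<omega> \<alpha> \<delta> (tmap [\<Delta>, emb] s \<cdot> t) = \<omega> \<alpha> \<delta> t"
proof -
  have "\<omega> \<alpha> \<delta> (tmap [\<Delta>, emb] s \<cdot> t) = \<omega> \<alpha> \<delta> ((tone 2 \<otimes> tmap [of_form \<epsilon>, emb] s) \<cdot> t)"
  proof (rule tlin_eq_homogeneous[OF _ _ t])
    show "tlin 3 scale (\<lambda>t. \<omega> \<alpha> \<delta> (tmap [\<Delta>, emb] s \<cdot> t))"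
      "tlin 3 scale (\<lambda>t. \<omega> \<alpha> \<delta> ((tone 2 \<otimes> tmap [of_form \<epsilon>, emb] s) \<cdot> t))"
      by (intro tlin_eval tlin_tmult_right tmap_comult_tpower pad_tone2 tmap_counit_tpower s(1))+
    fix xs ds assume "length xs = 3" "homogeneous_list xs ds"
    then obtain x y z e1 e2 e3 where xs: "xs = [x, y, z]" "x \<in> grade e1" "y \<in> grade e2" "z \<in> grade e3"
      by (rule homogeneous_list3)
    show "\<omega> \<alpha> \<delta> (tmap [\<Delta>, emb] s \<cdot> pure xs) = \<omega> \<alpha> \<delta> ((tone 2 \<otimes> tmap [of_form \<epsilon>, emb] s) \<cdot> pure xs)"
    proof (rule tlin_eq_homogeneous[OF _ _ s(1)])
      show "tlin 2 scale (\<lambda>s. \<omega> \<alpha> \<delta> (tmap [\<Delta>, emb] s \<cdot> pure xs))"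
        by (intro tlin_eval tlin_mult_left tlin_tmap_self)
      show "tlin 2 scale (\<lambda>s. \<omega> \<alpha> \<delta> ((tone 2 \<otimes> tmap [of_form \<epsilon>, emb] s) \<cdot> pure xs))"
        by (intro tlin_eval tlin_mult_left tlin_right[OF tone_tpower] tlin_tmap_self)
          (rule tmap_counit_tpower)
      fix fs cs assume "length fs = 2" "homogeneous_list fs cs"
      then obtain f g d c where fs: "fs = [f, g]" "f \<in> grade d" "g \<in> grade c"
        by (rule homogeneous_list2)
      show "\<omega> \<alpha> \<delta> (tmap [\<Delta>, emb] (pure fs) \<cdot> pure xs) =
          \<omega> \<alpha> \<delta> ((tone 2 \<otimes> tmap [of_form \<epsilon>, emb] (pure fs)) \<cdot> pure xs)"
        using \<omega>_mult_left[OF fs(3) xs(2-4) comult_grade[OF fs(2)], of \<alpha> \<delta>]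
          \<omega>_mult_left[OF fs(3) xs(2-4) tone_tgrade, of \<alpha> \<delta>] counit_odd[of f] fs(2)
        by (cases d) (simp_all add: fs(1) xs(1) tmap_comult_pair tmap_counit_pair tmult_tscale_left eval_simps
            tensor_prod_tscale_right[OF tone_tpower emb_in_tpower] \<mu>_comult \<mu>_tone linear_simps mult.commute
            del: tensor.scale_zero_left)
    qed
  qed
  then show ?thesis
    using tone_add[of 2 1] t by (simp add: s(2) tmult_tone)
qed

lemma \<omega>_comult_right:
  assumes s: "s \<in> tpower 2" "tmap [emb, of_form \<epsilon>] s = tone 1" and t: "t \<in> tpower 3"
  shows "\<omega> \<gamma> \<beta> (t \<cdot> tmap [emb, \<Delta>] s) = \<omega> \<gamma> \<beta> t"
proof -
  have "\<omega> \<gamma> \<beta> (t \<cdot> tmap [emb, \<Delta>] s) = \<omega> \<gamma> \<beta> (t \<cdot> (tmap [emb, of_form \<epsilon>] s \<otimes> tone 2))"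
  proof (rule tlin_eq_homogeneous[OF _ _ t])
    show "tlin 3 scale (\<lambda>t. \<omega> \<gamma> \<beta> (t \<cdot> tmap [emb, \<Delta>] s))"
      "tlin 3 scale (\<lambda>t. \<omega> \<gamma> \<beta> (t \<cdot> (tmap [emb, of_form \<epsilon>] s \<otimes> tone 2)))"
      by (intro tlin_eval tlin_mult_left tlin_id)+
    fix xs ds assume len: "length xs = 3" and "homogeneous_list xs ds"
    then obtain x y z e1 e2 e3 where xs: "xs = [x, y, z]" "x \<in> grade e1" "y \<in> grade e2" "z \<in> grade e3"
      by (rule homogeneous_list3)
    note px = pure_in_tpower[OF len]
    show "\<omega> \<gamma> \<beta> (pure xs \<cdot> tmap [emb, \<Delta>] s) = \<omega> \<gamma> \<beta> (pure xs \<cdot> (tmap [emb, of_form \<epsilon>] s \<otimes> tone 2))"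
    proof (rule tlin_eq_homogeneous[OF _ _ s(1)])
      show "tlin 2 scale (\<lambda>s. \<omega> \<gamma> \<beta> (pure xs \<cdot> tmap [emb, \<Delta>] s))"
        by (intro tlin_eval tlin_mult_right[OF px] tlin_tmap_self) (rule tmap_comult_tpower)
      show "tlin 2 scale (\<lambda>s. \<omega> \<gamma> \<beta> (pure xs \<cdot> (tmap [emb, of_form \<epsilon>] s \<otimes> tone 2)))"
        by (intro tlin_eval tlin_mult_right[OF px] tlin_left tlin_tmap_self)
          (intro pad_tone2 tmap_counit_tpower)
      fix fs cs assume "length fs = 2" "homogeneous_list fs cs"
      then obtain f g d c where fs: "fs = [f, g]" "f \<in> grade d" "g \<in> grade c"
        by (rule homogeneous_list2)
      show "\<omega> \<gamma> \<beta> (pure xs \<cdot> tmap [emb, \<Delta>] (pure fs)) =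
          \<omega> \<gamma> \<beta> (pure xs \<cdot> (tmap [emb, of_form \<epsilon>] (pure fs) \<otimes> tone 2))"
        using \<omega>_mult_right[OF fs(2) xs(2-4) comult_grade[OF fs(3)], of \<gamma> \<beta>]
          \<omega>_mult_right[OF fs(2) xs(2-4) tone_tgrade, of \<gamma> \<beta>] counit_odd[of g] fs(3)
          tmult_tscale_right[OF px pad_tone2(2)[OF emb_in_tpower]]
        by (cases c) (simp_all add: fs(1) xs(1) tmap_comult_pair tmap_counit_pair eval_simps
            tensor_prod_tscale_left \<nu>_comult \<nu>_tone linear_simps mult.commute
            del: tensor.scale_zero_left)
    qed
  qed
  then show ?thesis
    using tone_add[of 1 2] t by (simp add: s(2) tmult_tone)
qed

lemma \<chi>_comult_left:
  assumes s: "s \<in> tpower 2" "tmap [emb, of_form \<epsilon>] s = tone 1" and t: "t \<in> tpower 3"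
  shows "\<chi> \<delta> \<alpha> (tmap [emb, \<Delta>] s \<cdot> t) = \<chi> \<delta> \<alpha> t"
proof -
  have "\<chi> \<delta> \<alpha> (tmap [emb, \<Delta>] s \<cdot> t) = \<chi> \<delta> \<alpha> ((tmap [emb, of_form \<epsilon>] s \<otimes> tone 2) \<cdot> t)"
  proof (rule tlin_eq_homogeneous[OF _ _ t])
    show "tlin 3 scale (\<lambda>t. \<chi> \<delta> \<alpha> (tmap [emb, \<Delta>] s \<cdot> t))"
      "tlin 3 scale (\<lambda>t. \<chi> \<delta> \<alpha> ((tmap [emb, of_form \<epsilon>] s \<otimes> tone 2) \<cdot> t))"
      by (intro tlin_eval tlin_tmult_right tmap_comult_tpower pad_tone2 tmap_counit_tpower s(1))+
    fix xs ds assume "length xs = 3" "homogeneous_list xs ds"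
    then obtain x y z e1 e2 e3 where xs: "xs = [x, y, z]" "x \<in> grade e1" "y \<in> grade e2" "z \<in> grade e3"
      by (rule homogeneous_list3)
    show "\<chi> \<delta> \<alpha> (tmap [emb, \<Delta>] s \<cdot> pure xs) = \<chi> \<delta> \<alpha> ((tmap [emb, of_form \<epsilon>] s \<otimes> tone 2) \<cdot> pure xs)"
    proof (rule tlin_eq_homogeneous[OF _ _ s(1)])
      show "tlin 2 scale (\<lambda>s. \<chi> \<delta> \<alpha> (tmap [emb, \<Delta>] s \<cdot> pure xs))"
        "tlin 2 scale (\<lambda>s. \<chi> \<delta> \<alpha> ((tmap [emb, of_form \<epsilon>] s \<otimes> tone 2) \<cdot> pure xs))"
        by (intro tlin_eval tlin_mult_left tlin_left tlin_tmap_self)+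
      fix fs cs assume "length fs = 2" "homogeneous_list fs cs"
      then obtain f g d c where fs: "fs = [f, g]" "f \<in> grade d" "g \<in> grade c"
        by (rule homogeneous_list2)
      show "\<chi> \<delta> \<alpha> (tmap [emb, \<Delta>] (pure fs) \<cdot> pure xs) =
          \<chi> \<delta> \<alpha> ((tmap [emb, of_form \<epsilon>] (pure fs) \<otimes> tone 2) \<cdot> pure xs)"
        using \<chi>_mult_left[OF fs(2) xs(2-4) comult_grade[OF fs(3)], of \<delta> \<alpha>]
          \<chi>_mult_left[OF fs(2) xs(2-4) tone_tgrade, of \<delta> \<alpha>] counit_odd[of g] fs(3)
        by (cases c) (simp_all add: fs(1) xs(1) tmap_comult_pair tmap_counit_pair tmult_tscale_left eval_simps
            tensor_prod_tscale_left \<mu>_comult \<mu>_tone linear_simps mult.commute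
            del: tensor.scale_zero_left)
    qed
  qed
  then show ?thesis
    using tone_add[of 1 2] t by (simp add: s(2) tmult_tone)
qed

lemma \<chi>_comult_right:
  assumes s: "s \<in> tpower 2" "tmap [of_form \<epsilon>, emb] s = tone 1" and t: "t \<in> tpower 3"
  shows "\<chi> \<beta> \<gamma> (t \<cdot> tmap [\<Delta>, emb] s) = \<chi> \<beta> \<gamma> t"
proof -
  have "\<chi> \<beta> \<gamma> (t \<cdot> tmap [\<Delta>, emb] s) = \<chi> \<beta> \<gamma> (t \<cdot> (tone 2 \<otimes> tmap [of_form \<epsilon>, emb] s))"
  proof (rule tlin_eq_homogeneous[OF _ _ t])
    show "tlin 3 scale (\<lambda>t. \<chi> \<beta> \<gamma> (t \<cdot> tmap [\<Delta>, emb] s))"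
      "tlin 3 scale (\<lambda>t. \<chi> \<beta> \<gamma> (t \<cdot> (tone 2 \<otimes> tmap [of_form \<epsilon>, emb] s)))"
      by (intro tlin_eval tlin_mult_left tlin_id)+
    fix xs ds assume len: "length xs = 3" and "homogeneous_list xs ds"
    then obtain x y z e1 e2 e3 where xs: "xs = [x, y, z]" "x \<in> grade e1" "y \<in> grade e2" "z \<in> grade e3"
      by (rule homogeneous_list3)
    note px = pure_in_tpower[OF len]
    show "\<chi> \<beta> \<gamma> (pure xs \<cdot> tmap [\<Delta>, emb] s) = \<chi> \<beta> \<gamma> (pure xs \<cdot> (tone 2 \<otimes> tmap [of_form \<epsilon>, emb] s))"
    proof (rule tlin_eq_homogeneous[OF _ _ s(1)])
      show "tlin 2 scale (\<lambda>s. \<chi> \<beta> \<gamma> (pure xs \<cdot> tmap [\<Delta>, emb] s))"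
        by (intro tlin_eval tlin_mult_right[OF px] tlin_tmap_self) (rule tmap_comult_tpower)
      show "tlin 2 scale (\<lambda>s. \<chi> \<beta> \<gamma> (pure xs \<cdot> (tone 2 \<otimes> tmap [of_form \<epsilon>, emb] s)))"
        by (intro tlin_eval tlin_mult_right[OF px] tlin_right[OF tone_tpower, where k = 1] tlin_tmap_self)
          (auto intro: pad_tone2 tmap_counit_tpower)
      fix fs cs assume "length fs = 2" "homogeneous_list fs cs"
      then obtain f g d c where fs: "fs = [f, g]" "f \<in> grade d" "g \<in> grade c"
        by (rule homogeneous_list2)
      show "\<chi> \<beta> \<gamma> (pure xs \<cdot> tmap [\<Delta>, emb] (pure fs)) =
          \<chi> \<beta> \<gamma> (pure xs \<cdot> (tone 2 \<otimes> tmap [of_form \<epsilon>, emb] (pure fs)))"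
        using \<chi>_mult_right[OF fs(3) xs(2-4) comult_grade[OF fs(2)], of \<beta> \<gamma>]
          \<chi>_mult_right[OF fs(3) xs(2-4) tone_tgrade, of \<beta> \<gamma>] counit_odd[of f] fs(2)
          tmult_tscale_right[OF px pad_tone2(1)[OF emb_in_tpower]]
        by (cases d) (simp_all add: fs(1) xs(1) tmap_comult_pair tmap_counit_pair eval_simps
            tensor_prod_tscale_right[OF tone_tpower emb_in_tpower] \<nu>_comult \<nu>_tone linear_simps mult.commute
            del: tensor.scale_zero_left)
    qed
  qed
  then show ?thesis
    using tone_add[of 2 1] t by (simp add: s(2) tmult_tone)
qed

end

context twisted_quasi_hopf
begin

lemma twist_alpha_eq: "twist_alpha F S \<alpha> = \<mu> \<alpha> G"
  unfolding twist_alpha_def by (rule mprod_eq_\<mu>[OF alpha_even mem(2)])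

lemma twist_beta_eq: "twist_beta F S \<beta> = \<nu> \<beta> F"
  unfolding twist_beta_def by (rule mprod_eq_\<nu>[OF beta_even mem(1)])

lemma twist_alpha_beta_even: "\<mu> \<alpha> G \<in> grade 0" "\<nu> \<beta> F \<in> grade 0"
  using \<mu>_grade[OF alpha_even even(2)] \<nu>_grade[OF beta_even even(1)] .

text \<open>
  The identity \<open>G \<cdot> F = 1\<close>, read through the absorption rules: evaluating \<open>F\<close> or \<open>G\<close> with a twisted
  parameter gives back the original one.
\<close>

lemma untwist: "\<mu> (\<mu> \<alpha> G) F = \<alpha>" "\<nu> (\<nu> \<beta> F) G = \<beta>"
  using \<mu>_even[OF even(2) mem(1)] \<nu>_even[OF even(1) mem(2)]
  by (simp_all add: twist_inverse \<mu>_tone \<nu>_tone flip: \<mu>_even[OF even(2) mem(1)] \<nu>_even[OF even(1) mem(2)])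

text \<open>
  By absorption \<open>\<Delta>\<^sub>F a\<close> is evaluated after multiplication by \<open>G\<close>, which cancels the \<open>F\<close> on its left; the
  \<open>G\<close> on its right remains and turns \<open>\<epsilon> a *s \<alpha>\<close> into \<open>\<epsilon> a *s \<alpha>\<^sub>F\<close>.
\<close>

lemma twist_antipode_alpha: "\<mu> (\<mu> \<alpha> G) (\<Delta>F a) = \<epsilon> a *s \<mu> \<alpha> G"
proof -
  have "\<mu> (\<mu> \<alpha> G) (\<Delta>F a) = \<mu> \<alpha> (G \<cdot> \<Delta>F a)"
    using \<mu>_even[OF even(2)] even_hom_twist_comult
    by (simp add: even_hom_def even_map_def graded_linear_def)
  also have "G \<cdot> \<Delta>F a = \<Delta> a \<cdot> G"
    by (simp add: twist_comult_eq tmult_assoc[where n = 2] tmult_closed[where n = 2] mem comult_in_tpower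
        twist_inverse tmult_cancel[where n = 2])
  finally show ?thesis by (simp add: \<mu>_comult_mult mem)
qed

lemma twist_antipode_beta: "\<nu> (\<nu> \<beta> F) (\<Delta>F a) = \<epsilon> a *s \<nu> \<beta> F"
proof -
  have "\<nu> (\<nu> \<beta> F) (\<Delta>F a) = \<nu> \<beta> (\<Delta>F a \<cdot> F)"
    using \<nu>_even[OF even(1)] even_hom_twist_comult
    by (simp add: even_hom_def even_map_def graded_linear_def)
  also have "\<Delta>F a \<cdot> F = F \<cdot> \<Delta> a"
    by (simp add: twist_comult_eq tmult_assoc[where n = 2] tmult_closed[where n = 2] mem comult_in_tpower
        twist_inverse tmult_tone)
  finally show ?thesis by (simp add: \<nu>_mult_comult mem)
qed

text \<open>
  The factors of \<open>\<Phi>\<^sub>F\<close> are removed from the outside to the inside: \<open>F \<otimes> 1\<close> and \<open>1 \<otimes> G\<close> restore the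
  parameters \<open>\<alpha>\<close> and \<open>\<beta>\<close>, for which the inner coproduct factors can be dropped.
\<close>

lemma twist_antipode_assoc: "\<omega> (\<mu> \<alpha> G) (\<nu> \<beta> F) \<Phi>F = 1"
proof -
  have "\<omega> (\<mu> \<alpha> G) (\<nu> \<beta> F) \<Phi>F = \<omega> (\<mu> \<alpha> G) (\<nu> \<beta> F)
      ((F \<otimes> tone 1) \<cdot> ((tmap [\<Delta>, emb] F \<cdot> \<Phi> \<cdot> tmap [emb, \<Delta>] G) \<cdot> (tone 1 \<otimes> G)))"
    by (simp add: twist_assoc_eq word3)
  also have "\<dots> = \<omega> \<alpha> (\<nu> \<beta> F) ((tmap [\<Delta>, emb] F \<cdot> \<Phi> \<cdot> tmap [emb, \<Delta>] G) \<cdot> (tone 1 \<otimes> G))"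
    using \<omega>_even_left[OF even(1)] by (simp add: mem3 untwist)
  also have "\<dots> = \<omega> \<alpha> \<beta> (tmap [\<Delta>, emb] F \<cdot> \<Phi> \<cdot> tmap [emb, \<Delta>] G)"
    using \<omega>_even_right[OF even(2)] by (simp add: mem3 untwist)
  also have "\<dots> = \<omega> \<alpha> \<beta> (tmap [\<Delta>, emb] F \<cdot> \<Phi>)"
    by (rule \<omega>_comult_right) (simp_all add: mem3 tmap_counit_inverse)
  also have "\<dots> = \<omega> \<alpha> \<beta> \<Phi>"
    using gauge by (intro \<omega>_comult_left) (simp_all add: mem3 gauge_transformation_def)
  also have "\<dots> = 1"
    using antipode_assoc mprod_eq_\<omega>[OF alpha_even beta_even mem(3)] by simp
  finally show ?thesis .
qed

lemma twist_antipode_assoc_inv: "\<chi> (\<nu> \<beta> F) (\<mu> \<alpha> G) \<Psi>F = 1"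
proof -
  have "\<chi> (\<nu> \<beta> F) (\<mu> \<alpha> G) \<Psi>F = \<chi> (\<nu> \<beta> F) (\<mu> \<alpha> G)
      ((tone 1 \<otimes> F) \<cdot> ((tmap [emb, \<Delta>] F \<cdot> \<Psi> \<cdot> tmap [\<Delta>, emb] G) \<cdot> (G \<otimes> tone 1)))"
    by (simp add: word3)
  also have "\<dots> = \<chi> (\<nu> \<beta> F) \<alpha> ((tmap [emb, \<Delta>] F \<cdot> \<Psi> \<cdot> tmap [\<Delta>, emb] G) \<cdot> (G \<otimes> tone 1))"
    using \<chi>_even_left[OF even(1)] by (simp add: mem3 untwist)
  also have "\<dots> = \<chi> \<beta> \<alpha> (tmap [emb, \<Delta>] F \<cdot> \<Psi> \<cdot> tmap [\<Delta>, emb] G)"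
    using \<chi>_even_right[OF even(2)] by (simp add: mem3 untwist)
  also have "\<dots> = \<chi> \<beta> \<alpha> (tmap [emb, \<Delta>] F \<cdot> \<Psi>)"
    by (rule \<chi>_comult_right) (simp_all add: mem3 tmap_counit_inverse)
  also have "\<dots> = \<chi> \<beta> \<alpha> \<Psi>"
    using gauge by (intro \<chi>_comult_left) (simp_all add: mem3 gauge_transformation_def)
  also have "\<dots> = 1"
    using antipode_assoc_inv mprod_eq_\<chi>[OF alpha_even beta_even mem(4)] by simp
  finally show ?thesis .
qed

lemma twist_quasi_hopf:
  "quasi_hopf_superalgebra scale grade \<Delta>F \<epsilon> \<Phi>F S (twist_alpha F S \<alpha>) (twist_beta F S \<beta>)"
proof (intro quasi_hopf_superalgebra.intro quasi_hopf_superalgebra_axioms.intro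
    twist_quasi_bialgebra
    antipode_linear antipode_one antipode_mult antipode_grade)
  have tp: "\<Delta>F a \<in> tpower 2" for a
    using even_hom_twist_comult by (simp add: even_hom_def even_map_def graded_linear_def)
  note ev = twist_alpha_beta_even
  show "twist_alpha F S \<alpha> \<in> grade 0" "twist_beta F S \<beta> \<in> grade 0"
    unfolding twist_alpha_eq twist_beta_eq by (rule ev)+
  show "mprod ((emb 1 \<otimes> emb (twist_alpha F S \<alpha>)) \<cdot> tmap [emb \<circ> S, emb] (\<Delta>F a)) = \<epsilon> a *s twist_alpha F S \<alpha>" for a
    unfolding twist_alpha_eq mprod_eq_\<mu>[OF ev(1) tp] by (rule twist_antipode_alpha)
  show "mprod ((emb 1 \<otimes> emb (twist_beta F S \<beta>)) \<cdot> tmap [emb, emb \<circ> S] (\<Delta>F a)) = \<epsilon> a *s twist_beta F S \<beta>" for a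
    unfolding twist_beta_eq mprod_eq_\<nu>[OF ev(2) tp] by (rule twist_antipode_beta)
  show "mprod ((emb 1 \<otimes> emb (twist_beta F S \<beta>) \<otimes> emb (twist_alpha F S \<alpha>)) \<cdot>
      tmap [emb, emb \<circ> S, emb] (tinv 3 \<Phi>F)) = 1"
    unfolding twist_alpha_eq twist_beta_eq twist_assoc_tinv mprod_eq_\<chi>[OF ev twist_assoc_tpower(2)]
    by (rule twist_antipode_assoc_inv)
  show "mprod (tmap [emb \<circ> S, emb, emb] ((emb 1 \<otimes> emb (twist_alpha F S \<alpha>) \<otimes> emb (twist_beta F S \<beta>)) \<cdot>
      tmap [emb, emb, emb \<circ> S] \<Phi>F)) = 1"
    unfolding twist_alpha_eq twist_beta_eq mprod_eq_\<omega>[OF ev twist_assoc_tpower(1)]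
    by (rule twist_antipode_assoc)
qed

end

theorem theorem1:
  fixes scale :: "'k::field \<Rightarrow> 'a::ring_1 \<Rightarrow> 'a"
    and grade :: "bit \<Rightarrow> 'a set"
    and \<Delta> :: "'a \<Rightarrow> ('a, 'k) tensor"
    and \<epsilon> :: "'a \<Rightarrow> 'k"
    and \<Phi> F :: "('a, 'k) tensor"
    and S :: "'a \<Rightarrow> 'a"
    and \<alpha> \<beta> :: 'a
  assumes "quasi_hopf_superalgebra scale grade \<Delta> \<epsilon> \<Phi> S \<alpha> \<beta>"
    and "superalgebra.gauge_transformation scale grade \<epsilon> F"
  shows "quasi_hopf_superalgebra scale grade
    (superalgebra.twist_comult scale grade F \<Delta>) \<epsilon>
    (superalgebra.twist_assoc scale grade F \<Delta> \<Phi>) S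
    (superalgebra.twist_alpha scale grade F S \<alpha>)
    (superalgebra.twist_beta scale grade F S \<beta>)"
  by (intro twisted_quasi_hopf.twist_quasi_hopf twisted_quasi_hopf.intro
      twisted_quasi_hopf_axioms.intro assms)

end
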